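(* As $\varepsilon\to 0$, the functionals $J^{ben}_\varepsilon$ $\Gamma$-converge to the functional $J^{LvK}$ in the following sense: (i) (liminf inequality) for every sequence $(w_\varepsilon)\subset W^{2,2}_{\langle 0\rangle}(S)$, every $w\in W^{2,2}_{\langle 0\rangle}(I)$ and every $\vartheta\in W^{1,2}_{\langle 0\rangle}(I)$ such that $w_\varepsilon\rightharpoonup w$ weakly in $W^{2,2}(S)$ and $\nabla_{\!\varepsilon} w_\varepsilon\rightharpoonup (w',\vartheta)$ weakly in $W^{1,2}(S;\mathbb{R}^2)$, we have $$\liminf_{\varepsilon\to 0} J^{ben}_\varepsilon(w_\varepsilon)\ge J^{LvK}(w,\vartheta);$$ (ii) (recovery sequence) for every $w\in W^{2,2}_{\langle 0\rangle}(I)$ and $\vartheta\in W^{1,2}_{\langle 0\rangle}(I)$ there exists a sequence $(w_\varepsilon)\subset W^{2,2}_{\langle 0\rangle}(S)$ such that $w_\varepsilon\rightharpoonup w$ weakly in $W^{2,2}(S)$, $\nabla_{\!\varepsilon} w_\varepsilon\rightharpoonup (w',\vartheta)$ weakly in $W^{1,2}(S;\mathbb{R}^2)$, and $$\limsup_{\varepsilon\to 0} J^{ben}_\varepsilon(w_\varepsilon)\le J^{LvK}(w,\vartheta).$$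
   Context: Let $\ell>0$, $I=(-\ell/2,\ell/2)$ and $S=I\times(-1/2,1/2)\subset\mathbb{R}^2$, with coordinates $x=(x_1,x_2)$. Functions on $I$ are identified with functions on $S$ that are independent of $x_2$. The parameter $\varepsilon>0$ tends to $0$; a "sequence" $(w_\varepsilon)$ is indexed by such $\varepsilon$. $\mathbb{R}^{2\times2}_{\rm sym}$ is the space of symmetric real $2\times 2$ matrices, and $Q_2:\mathbb{R}^{2\times 2}_{\rm sym}\to[0,+\infty)$ is a given positive definite quadratic form. For an open set $\Omega\subset\mathbb{R}^\alpha$, $\alpha=1,2$, $$W^{1,2}_{\langle 0\rangle}(\Omega):=\Big\{g\in W^{1,2}(\Omega): \int_\Omega g\,dx=0\Big\},\qquad W^{2,2}_{\langle 0\rangle}(\Omega):=\Big\{g\in W^{2,2}(\Omega): \int_\Omega g\,dx=0,\ \int_\Omega\nabla g\,dx=0\Big\}.$$ Scaled differential operators: for $w\in W^{2,2}(S)$, $$\nabla_{\!\varepsilon} w:=\Big(\partial_1 w,\tfrac1\varepsilon\partial_2 w\Big),\qquad \nabla^2_\varepsilon w:=\begin{pmatrix}\partial^2_{11}w & \frac1\varepsilon\partial^2_{12}w\\ \frac1\varepsilon\partial^2_{21}w & \frac1{\varepsilon^2}\partial^2_{22}w\end{pmatrix}.$$ Scaled bending energy, for $w\in W^{2,2}_{\langle 0\rangle}(S)$: $$J^{ben}_\varepsilon(w):=\frac1{24}\int_S Q_2(\nabla^2_\varepsilon w)\,dx.$$ Limit density $Q_1:\mathbb{R}\times\mathbb{R}\to[0,+\infty)$: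 $$Q_1(\kappa,\tau):=\min_{\gamma\in\mathbb{R}} Q_2\begin{pmatrix}\kappa&\tau\\ \tau&\gamma\end{pmatrix}.$$ Limit functional $J^{LvK}:W^{2,2}_{\langle 0\rangle}(I)\times W^{1,2}_{\langle 0\rangle}(I)\to\mathbb{R}$: $$J^{LvK}(w,\vartheta):=\frac1{24}\int_I Q_1(w'',\vartheta')\,dx_1.$$ *)

theory Defs
  imports "HOL-Analysis.Analysis"
begin

section \<open>Test functions and weak derivatives\<close>

primrec Ck :: "nat \<Rightarrow> ('a::euclidean_space \<Rightarrow> real) \<Rightarrow> bool" where
  "Ck 0 f \<longleftrightarrow> continuous_on UNIV f"
| "Ck (Suc k) f \<longleftrightarrow>
     (\<forall>x. f differentiable (at x)) \<and> (\<forall>v. Ck k (\<lambda>x. frechet_derivative f (at x) v))"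

text \<open>The space \<open>C\<^sub>c\<^sup>\<infinity>(\<Omega>)\<close>, every element being extended by zero to the whole space.\<close>

definition test_functions :: "'a::euclidean_space set \<Rightarrow> ('a \<Rightarrow> real) set" where
  "test_functions \<Omega> =
     {\<phi>. (\<forall>k. Ck k \<phi>) \<and> compact (closure {x. \<phi> x \<noteq> 0}) \<and> closure {x. \<phi> x \<noteq> 0} \<subseteq> \<Omega>}"

definition locally_integrable ::
    "'a::euclidean_space set \<Rightarrow> ('a \<Rightarrow> 'b::euclidean_space) \<Rightarrow> bool" where
  "locally_integrable \<Omega> f \<longleftrightarrow> (\<forall>K. compact K \<and> K \<subseteq> \<Omega> \<longrightarrow> integrable (lebesgue_on K) f)"

definition has_weak_partial ::
    "'a::euclidean_space set \<Rightarrow> 'a \<Rightarrow> ('a \<Rightarrow> 'b::euclidean_space) \<Rightarrow> ('a \<Rightarrow> 'b) \<Rightarrow> bool" where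
  "has_weak_partial \<Omega> b f g \<longleftrightarrow>
     locally_integrable \<Omega> f \<and> locally_integrable \<Omega> g \<and>
     (\<forall>\<phi>\<in>test_functions \<Omega>.
        (LINT x|lebesgue_on \<Omega>. frechet_derivative \<phi> (at x) b *\<^sub>R f x) =
        - (LINT x|lebesgue_on \<Omega>. \<phi> x *\<^sub>R g x))"

text \<open>
  Elements of Lebesgue and Sobolev spaces are represented by functions on the whole space whose
  values matter only almost everywhere in \<open>\<Omega>\<close>. A weak derivative is unique up to a null set;
  the following picks an arbitrary representative.
\<close>

definition weak_partial ::
    "'a::euclidean_space set \<Rightarrow> 'a \<Rightarrow> ('a \<Rightarrow> 'b::euclidean_space) \<Rightarrow> 'a \<Rightarrow> 'b" where
  "weak_partial \<Omega> b f = (SOME g. has_weak_partial \<Omega> b f g)"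

definition weak_gradient :: "'a::euclidean_space set \<Rightarrow> ('a \<Rightarrow> real) \<Rightarrow> 'a \<Rightarrow> 'a" where
  "weak_gradient \<Omega> f x = (\<Sum>b\<in>Basis. weak_partial \<Omega> b f x *\<^sub>R b)"


section \<open>Sobolev spaces and weak convergence\<close>

definition L2 :: "'a::euclidean_space set \<Rightarrow> ('a \<Rightarrow> 'b::euclidean_space) set" where
  "L2 \<Omega> = {f. f \<in> borel_measurable (lebesgue_on \<Omega>) \<and>
              integrable (lebesgue_on \<Omega>) (\<lambda>x. (norm (f x))\<^sup>2)}"

text \<open>\<open>sobolev k \<Omega>\<close> is \<open>W\<^sup>k\<^sup>,\<^sup>2(\<Omega>)\<close>, with values in a Euclidean space.\<close>

primrec sobolev :: "nat \<Rightarrow> 'a::euclidean_space set \<Rightarrow> ('a \<Rightarrow> 'b::euclidean_space) set" where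
  "sobolev 0 \<Omega> = L2 \<Omega>"
| "sobolev (Suc k) \<Omega> =
     {f \<in> L2 \<Omega>. \<forall>b\<in>Basis. \<exists>g\<in>sobolev k \<Omega>. has_weak_partial \<Omega> b f g}"

text \<open>The squared norm: the sum of the squared \<open>L\<^sup>2\<close> norms of all iterated partial derivatives of
  order at most \<open>k\<close>, mixed derivatives being counted once for each order of differentiation.\<close>

primrec sobolev_norm_sq ::
    "nat \<Rightarrow> 'a::euclidean_space set \<Rightarrow> ('a \<Rightarrow> 'b::euclidean_space) \<Rightarrow> real" where
  "sobolev_norm_sq 0 \<Omega> f = (LINT x|lebesgue_on \<Omega>. (norm (f x))\<^sup>2)"
| "sobolev_norm_sq (Suc k) \<Omega> f =
     (LINT x|lebesgue_on \<Omega>. (norm (f x))\<^sup>2) +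
     (\<Sum>b\<in>Basis. sobolev_norm_sq k \<Omega> (weak_partial \<Omega> b f))"

definition sobolev_norm ::
    "nat \<Rightarrow> 'a::euclidean_space set \<Rightarrow> ('a \<Rightarrow> 'b::euclidean_space) \<Rightarrow> real" where
  "sobolev_norm k \<Omega> f = sqrt (sobolev_norm_sq k \<Omega> f)"

text \<open>Bounded linear functionals; boundedness makes them independent of the representative.\<close>

definition sobolev_dual ::
    "nat \<Rightarrow> 'a::euclidean_space set \<Rightarrow> (('a \<Rightarrow> 'b::euclidean_space) \<Rightarrow> real) set" where
  "sobolev_dual k \<Omega> =
     {F. (\<forall>f\<in>sobolev k \<Omega>. \<forall>g\<in>sobolev k \<Omega>. F (\<lambda>x. f x + g x) = F f + F g) \<and>
         (\<forall>c. \<forall>f\<in>sobolev k \<Omega>. F (\<lambda>x. c *\<^sub>R f x) = c * F f) \<and>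
         (\<exists>C. \<forall>f\<in>sobolev k \<Omega>. \<bar>F f\<bar> \<le> C * sobolev_norm k \<Omega> f)}"

definition sobolev_weakly_converges ::
    "nat \<Rightarrow> 'a::euclidean_space set \<Rightarrow> ('i \<Rightarrow> 'a \<Rightarrow> 'b::euclidean_space) \<Rightarrow> ('a \<Rightarrow> 'b) \<Rightarrow>
     'i filter \<Rightarrow> bool" where
  "sobolev_weakly_converges k \<Omega> u u0 net \<longleftrightarrow>
     (\<forall>\<^sub>F i in net. u i \<in> sobolev k \<Omega>) \<and> u0 \<in> sobolev k \<Omega> \<and>
     (\<forall>F\<in>sobolev_dual k \<Omega>. ((\<lambda>i. F (u i)) \<longlongrightarrow> F u0) net)"

text \<open>
  The normalised spaces \<open>W\<^sup>1\<^sup>,\<^sup>2\<close> and \<open>W\<^sup>2\<^sup>,\<^sup>2\<close>, to be used for bounded \<open>\<Omega>\<close> only: there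
  square-integrable functions are integrable, so the integrals below are meaningful.
\<close>

definition W12_0 :: "'a::euclidean_space set \<Rightarrow> ('a \<Rightarrow> real) set" where
  "W12_0 \<Omega> = {g \<in> sobolev 1 \<Omega>. (LINT x|lebesgue_on \<Omega>. g x) = 0}"

definition W22_0 :: "'a::euclidean_space set \<Rightarrow> ('a \<Rightarrow> real) set" where
  "W22_0 \<Omega> = {g \<in> sobolev 2 \<Omega>. (LINT x|lebesgue_on \<Omega>. g x) = 0 \<and>
                                (LINT x|lebesgue_on \<Omega>. weak_gradient \<Omega> g x) = 0}"


section \<open>Quadratic forms\<close>

definition symmetric_matrices :: "(real^'n^'n) set" where
  "symmetric_matrices = {A. transpose A = A}"

text \<open>A quadratic form on a subspace \<open>V\<close>; asking for a bilinear form on the ambient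
  space is no restriction, since a bilinear form on \<open>V\<close> extends.\<close>

definition positive_definite_quadratic_form_on ::
    "'v::euclidean_space set \<Rightarrow> ('v \<Rightarrow> real) \<Rightarrow> bool" where
  "positive_definite_quadratic_form_on V Q \<longleftrightarrow>
     (\<exists>B. bilinear B \<and> (\<forall>A\<in>V. Q A = B A A)) \<and> (\<forall>A\<in>V. A \<noteq> 0 \<longrightarrow> Q A > 0)"


section \<open>The rod functionals\<close>

definition rod_interval :: "real \<Rightarrow> real set" where
  "rod_interval l = {- l / 2 <..< l / 2}"

definition rod_strip :: "real \<Rightarrow> (real \<times> real) set" where
  "rod_strip l = rod_interval l \<times> {- 1 / 2 <..< 1 / 2}"

abbreviation e1 :: "real \<times> real" where "e1 \<equiv> (1, 0)"
abbreviation e2 :: "real \<times> real" where "e2 \<equiv> (0, 1)"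

definition scaled_gradient ::
    "real \<Rightarrow> real \<Rightarrow> (real \<times> real \<Rightarrow> real) \<Rightarrow> real \<times> real \<Rightarrow> real \<times> real" where
  "scaled_gradient l \<epsilon> w x =
     (weak_partial (rod_strip l) e1 w x, 1 / \<epsilon> * weak_partial (rod_strip l) e2 w x)"

definition scaled_hessian ::
    "real \<Rightarrow> real \<Rightarrow> (real \<times> real \<Rightarrow> real) \<Rightarrow> real \<times> real \<Rightarrow> real^2^2" where
  "scaled_hessian l \<epsilon> w x =
     (let D = (\<lambda>a b. weak_partial (rod_strip l) a (weak_partial (rod_strip l) b w) x) in
      vector [vector [D e1 e1,         1 / \<epsilon> * D e1 e2],
              vector [1 / \<epsilon> * D e2 e1, 1 / \<epsilon>\<^sup>2 * D e2 e2]])"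

text \<open>The matrix \<open>scaled_hessian l \<epsilon> w x\<close> is symmetric for almost every \<open>x\<close>, so the values of
  \<open>Q2\<close> on non-symmetric matrices do not matter.\<close>

definition J_ben ::
    "(real^2^2 \<Rightarrow> real) \<Rightarrow> real \<Rightarrow> real \<Rightarrow> (real \<times> real \<Rightarrow> real) \<Rightarrow> real" where
  "J_ben Q2 l \<epsilon> w = 1 / 24 * (LINT x|lebesgue_on (rod_strip l). Q2 (scaled_hessian l \<epsilon> w x))"

text \<open>\<open>LEAST\<close> denotes the attained minimum over \<open>\<gamma>\<close>, which exists for positive definite \<open>Q2\<close>.\<close>

definition Q1 :: "(real^2^2 \<Rightarrow> real) \<Rightarrow> real \<Rightarrow> real \<Rightarrow> real" where
  "Q1 Q2 \<kappa> \<tau> = (LEAST q. \<exists>\<gamma>. q = Q2 (vector [vector [\<kappa>, \<tau>], vector [\<tau>, \<gamma>]]))"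

definition J_LvK ::
    "(real^2^2 \<Rightarrow> real) \<Rightarrow> real \<Rightarrow> (real \<Rightarrow> real) \<Rightarrow> (real \<Rightarrow> real) \<Rightarrow> real" where
  "J_LvK Q2 l w \<theta> =
     (let D = weak_partial (rod_interval l) 1 in
      1 / 24 * (LINT t|lebesgue_on (rod_interval l). Q1 Q2 (D (D w) t) (D \<theta> t)))"

text \<open>The joint convergence \<open>w\<^sub>\<epsilon> \<rightharpoonup> w\<close> in \<open>W\<^sup>2\<^sup>,\<^sup>2(S)\<close> and \<open>\<nabla>\<^sub>\<epsilon> w\<^sub>\<epsilon> \<rightharpoonup> (w', \<theta>)\<close> in
  \<open>W\<^sup>1\<^sup>,\<^sup>2(S; \<real>\<^sup>2)\<close> as \<open>\<epsilon>\<close> decreases to 0; composing with \<open>fst\<close> turns a function on the interval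
  into a function on the strip that is independent of the second coordinate.\<close>

definition rod_converges ::
    "real \<Rightarrow> (real \<Rightarrow> real \<times> real \<Rightarrow> real) \<Rightarrow> (real \<Rightarrow> real) \<Rightarrow> (real \<Rightarrow> real) \<Rightarrow> bool" where
  "rod_converges l w w0 \<theta> \<longleftrightarrow>
     sobolev_weakly_converges 2 (rod_strip l) w (\<lambda>x. w0 (fst x)) (at_right 0) \<and>
     sobolev_weakly_converges 1 (rod_strip l) (\<lambda>\<epsilon>. scaled_gradient l \<epsilon> (w \<epsilon>))
       (\<lambda>x. (weak_partial (rod_interval l) 1 w0 (fst x), \<theta> (fst x))) (at_right 0)"

end

theory Submission
  imports Defs "HOL-Real_Asymp.Real_Asymp"
begin

text \<open>
  Completing the square writes \<open>Q2\<close> as \<open>Q1 \<kappa> \<tau> + c * (\<gamma> - (p * \<kappa> + q * \<tau>))\<^sup>2\<close>, where \<open>Q1\<close> is itself a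
  nonnegative quadratic form. For the lower bound the square is dropped and \<open>Q1\<close> is bounded below by
  its linearisation at the limit \<open>(w'', \<theta>')\<close>; the linear term vanishes in the limit, because
  \<open>(\<kappa>, \<tau>)\<close> is the first partial derivative of the scaled gradient, which converges weakly.
  For the upper bound one takes \<open>w + \<epsilon> x\<^sub>2 \<theta>\<^sub>\<epsilon> + \<epsilon>\<^sup>2 (x\<^sub>2\<^sup>2 / 2 - 1 / 24) \<gamma>\<^sub>\<epsilon>\<close> with smooth \<open>\<theta>\<^sub>\<epsilon>\<close> and \<open>\<gamma>\<^sub>\<epsilon>\<close>
  approximating \<open>\<theta>\<close> and the minimiser \<open>p * w'' + q * \<theta>'\<close>: then all convergences are strong.
\<close>

text \<open>The trial function must lie in W^{2,2}, so each of its coefficients needs two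
  derivatives in the first variable. The limit \<open>w\<close> has two, \<open>\<theta>\<close> has
  one and the minimiser \<open>p * w'' + q * \<theta>'\<close> is merely square integrable; hence
  the last two are smoothed and \<open>w\<close> is kept. Compactly supported functions cannot
  approximate \<open>\<theta>\<close> in W^{1,2}, as \<open>\<theta>\<close> need not vanish at the
  ends of the interval; so \<open>\<theta>'\<close> is approximated and then integrated. The powers
  of the small parameter in the trial function are those which the scaled operators divide out
  again. The constant 1/24 is the mean of half the squared cross-sectional coordinate, so the
  quadratic corrector leaves the zero mean intact. In the lower bound one bounded functional does
  the work: pairing the first partial derivative with the gradient of \<open>Q1\<close> at the
  limit. Linearisation rests on an identity for quadratic forms: value minus tangent is the value of
  the form at the difference of the arguments.\<close>

section \<open>Smooth functions and approximation by test functions\<close>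

lemma Ck_SucD: "Ck (Suc k) f \<Longrightarrow> Ck k f"
proof (induction k arbitrary: f)
  case 0
  then show ?case
    by (auto simp: continuous_at_imp_continuous_on differentiable_imp_continuous_within)
next
  case (Suc k)
  then show ?case by (metis Ck.simps(2))
qed

text \<open>Derivatives are unique, so an explicit formula \<open>f'\<close> may stand in for the
  function chosen by \<open>frechet_derivative\<close>.\<close>

lemma Ck_SucI:
  assumes "\<And>x. (f has_derivative f' x) (at x)" "\<And>v. Ck k (\<lambda>x. f' x v)"
  shows "Ck (Suc k) f"
proof -
  have "frechet_derivative f (at x) = f' x" for x
    using assms(1) frechet_derivative_at by metis
  then show ?thesis
    using assms by (auto simp: differentiable_def)
qed

lemma Ck_has_derivative:
  "Ck (Suc k) f \<Longrightarrow> (f has_derivative frechet_derivative f (at x)) (at x)"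
  using frechet_derivative_works by auto

lemma Ck_const [simp]: "Ck k (\<lambda>x. c)"
  by (induction k arbitrary: c) (auto simp: frechet_derivative_const)

lemma Ck_bounded_linear:
  assumes "bounded_linear f" shows "Ck k f"
proof (cases k)
  case 0
  then show ?thesis using assms by (simp add: linear_continuous_on)
next
  case (Suc j)
  have "Ck (Suc j) f"
    by (rule Ck_SucI[where f'="\<lambda>_. f"]) (auto intro: bounded_linear_imp_has_derivative assms)
  then show ?thesis using Suc by simp
qed

lemma Ck_add: "Ck k f \<Longrightarrow> Ck k g \<Longrightarrow> Ck k (\<lambda>x. f x + g x)"
proof (induction k arbitrary: f g)
  case 0
  then show ?case by (auto intro: continuous_on_add)
next
  case (Suc k)
  show ?case
    by (rule Ck_SucI[OF has_derivative_add[OF Ck_has_derivative[OF Suc.prems(1)]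
            Ck_has_derivative[OF Suc.prems(2)]]])
      (use Suc in auto)
qed

lemma Ck_mult: "Ck k f \<Longrightarrow> Ck k g \<Longrightarrow> Ck k (\<lambda>x. f x * g x)"
proof (induction k arbitrary: f g)
  case 0
  then show ?case by (auto intro: continuous_on_mult)
next
  case (Suc k)
  have "Ck k f" "Ck k g"
    using Suc.prems Ck_SucD by auto
  then show ?case
    by (intro Ck_SucI[OF has_derivative_mult[OF Ck_has_derivative[OF Suc.prems(1)]
            Ck_has_derivative[OF Suc.prems(2)]]] Ck_add Suc.IH)
      (use Suc.prems in auto)
qed

lemma Ck_prod: "finite I \<Longrightarrow> (\<And>i. i \<in> I \<Longrightarrow> Ck k (f i)) \<Longrightarrow> Ck k (\<lambda>x. \<Prod>i\<in>I. f i x)"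
  by (induction rule: finite_induct) (auto intro: Ck_mult)

text \<open>For an affine inner map, a directional derivative is again a smooth function composed
  with the same map, so the induction closes without a general chain rule.\<close>

lemma Ck_affine:
  fixes A :: "'a::euclidean_space \<Rightarrow> 'b::euclidean_space"
  assumes "Ck k f" "bounded_linear A"
  shows "Ck k (\<lambda>x. f (A x + c))"
  using assms(1)
proof (induction k arbitrary: f)
  case 0
  then show ?case
    using assms(2)
    by (simp add: continuous_on_compose2[of UNIV f UNIV "\<lambda>x. A x + c"] continuous_on_add
        linear_continuous_on)
next
  case (Suc k)
  have "((\<lambda>x. f (A x + c)) has_derivative (\<lambda>v. frechet_derivative f (at (A x + c)) (A v))) (at x)" for x
    by (rule has_derivative_compose[OF _ Ck_has_derivative[OF Suc.prems], where f="\<lambda>x. A x + c"])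
      (intro has_derivative_add_const bounded_linear_imp_has_derivative assms(2))
  then show ?case
    by (rule Ck_SucI) (use Suc in auto)
qed

lemma Ck_real_polynomial_function: "real_polynomial_function p \<Longrightarrow> Ck k p"
  by (induction rule: real_polynomial_function.induct)
    (auto intro: Ck_bounded_linear Ck_add Ck_mult)

section \<open>Test functions, cutoffs and approximation\<close>

lemma test_functionsD:
  assumes "\<phi> \<in> test_functions S"
  shows "Ck k \<phi>" "compact (closure {x. \<phi> x \<noteq> 0})" "closure {x. \<phi> x \<noteq> 0} \<subseteq> S"
  using assms unfolding test_functions_def mem_Collect_eq by blast+

lemma test_functionsI:
  assumes "\<And>k. Ck k \<phi>" "compact K" "K \<subseteq> S" "\<And>x. \<phi> x \<noteq> 0 \<Longrightarrow> x \<in> K"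
  shows "\<phi> \<in> test_functions S"
proof -
  have sub: "closure {x. \<phi> x \<noteq> 0} \<subseteq> K"
    by (rule closure_minimal) (use assms(4) compact_imp_closed[OF assms(2)] in auto)
  then have "compact (closure {x. \<phi> x \<noteq> 0})"
    using compact_Int_closed[OF assms(2) closed_closure] by (metis inf.absorb_iff2)
  then show ?thesis
    unfolding test_functions_def mem_Collect_eq using assms(1,3) sub by blast
qed

lemma test_function_support:
  assumes "\<phi> x \<noteq> 0" shows "x \<in> closure {x. \<phi> x \<noteq> 0}"
  using closure_subset[of "{x. \<phi> x \<noteq> 0}"] assms by blast

lemma test_functions_mult:
  assumes "\<And>k. Ck k g" "\<phi> \<in> test_functions S"
  shows "(\<lambda>x. g x * \<phi> x) \<in> test_functions S"
  by (rule test_functionsI[OF _ test_functionsD(2,3)[OF assms(2)]])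
    (use assms(1) test_functionsD(1)[OF assms(2)] in \<open>auto intro!: Ck_mult test_function_support\<close>)

lemma test_functions_mono: "S \<subseteq> S' \<Longrightarrow> test_functions S \<subseteq> test_functions S'"
  unfolding test_functions_def by blast

lemma test_function_eq_0: "\<phi> \<in> test_functions S \<Longrightarrow> x \<notin> S \<Longrightarrow> \<phi> x = 0"
  using test_functionsD(3) test_function_support by blast

text \<open>This family is closed under differentiation, also at \<open>0\<close>.\<close>

definition flat :: "real poly \<Rightarrow> real \<Rightarrow> real" where
  "flat p x = (if x > 0 then poly p (1 / x) * exp (- (1 / x)) else 0)"

lemma poly_times_exp_tendsto_0: "((\<lambda>y. poly p y * exp (- y)) \<longlongrightarrow> (0::real)) at_top"
proof -
  have "((\<lambda>y. \<Sum>i\<le>degree p. coeff p i * (y ^ i / exp y)) \<longlongrightarrow> (\<Sum>i\<le>degree p. coeff p i * (0::real))) at_top"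
    by (intro tendsto_intros tendsto_power_div_exp_0)
  then show ?thesis
    by (simp add: poly_altdef exp_minus sum_distrib_right sum_divide_distrib field_simps)
qed

text \<open>With \<open>y = 1 / x\<close> one has \<open>dy/dx = - y^2\<close>, so the derivative of
  \<open>p(y) exp(-y)\<close> is \<open>y^2 (p(y) - p'(y)) exp(-y)\<close>; the factor
  \<open>[:0,0,1:]\<close> is \<open>y^2\<close>.\<close>

lemma flat_has_real_derivative:
  "(flat p has_real_derivative flat ([:0,0,1:] * (p - pderiv p)) x) (at x)"
proof -
  consider "x < 0" | "x = 0" | "x > 0" by linarith
  then show ?thesis
  proof cases
    case 1
    have "((\<lambda>x. 0) has_real_derivative 0) (at x)" by simp
    then have "(flat p has_real_derivative 0) (at x)"
      by (rule DERIV_cong_ev[THEN iffD1, rotated -1])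
        (use 1 eventually_nhds_in_open[of "{..<0}" x] in \<open>auto simp: flat_def elim: eventually_mono\<close>)
    then show ?thesis using 1 by (simp add: flat_def)
  next
    case 2
    \<comment> \<open>The right difference quotient at \<open>0\<close> is
      \<open>y p(y) exp(-y)\<close> with \<open>y = 1 / h\<close>, hence the extra factor
      \<open>[:0,1:]\<close>.\<close>
    have "((\<lambda>h. poly ([:0,1:] * p) (inverse h) * exp (- inverse h)) \<longlongrightarrow> 0) (at_right (0::real))"
      by (rule filterlim_compose[OF poly_times_exp_tendsto_0 filterlim_inverse_at_top_right])
    then have "((\<lambda>h. flat p h / h) \<longlongrightarrow> 0) (at_right 0)"
      by (rule Lim_transform_eventually)
        (auto simp: flat_def eventually_at_filter field_simps)
    moreover have "((\<lambda>h. flat p h / h) \<longlongrightarrow> 0) (at_left 0)"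
      by (rule Lim_transform_eventually[OF tendsto_const]) (auto simp: flat_def eventually_at_filter)
    ultimately have "((\<lambda>h. flat p h / h) \<longlongrightarrow> 0) (at 0)"
      using filterlim_split_at by blast
    then show ?thesis using 2 by (simp add: DERIV_def flat_def)
  next
    case 3
    have "((\<lambda>x. poly p (1 / x) * exp (- (1 / x))) has_real_derivative
        flat ([:0,0,1:] * (p - pderiv p)) x) (at x)"
      using 3 by (auto intro!: derivative_eq_intros DERIV_chain2[OF poly_DERIV] simp: flat_def field_simps)
    then show ?thesis
      by (rule DERIV_cong_ev[THEN iffD1, rotated -1])
        (use 3 eventually_nhds_in_open[of "{0<..}" x] in \<open>auto simp: flat_def elim: eventually_mono\<close>)
  qed
qed

lemma Ck_flat: "Ck k (flat p)"
proof (induction k arbitrary: p)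
  case 0
  then show ?case
    using flat_has_real_derivative by (auto intro!: continuous_at_imp_continuous_on dest: DERIV_isCont)
next
  case (Suc k)
  show ?case
    by (rule Ck_SucI[OF flat_has_real_derivative[THEN has_field_derivative_imp_has_derivative]])
      (auto intro!: Ck_mult Suc)
qed

lemma flat_1: "flat 1 x = (if x > 0 then exp (- (1 / x)) else 0)"
  by (simp add: flat_def)

text \<open>One factor per face of the box: \<open>flat 1\<close> of a multiple of the distance to
  that face, shifted by \<open>1\<close>. The shift keeps the support at distance
  \<open>1 / Suc n\<close> from the boundary. Inside the box the arguments tend to infinity, where
  \<open>flat 1\<close> tends to \<open>1\<close>.\<close>

lemma ex_test_functions_tendsto_1:
  fixes a c :: "'a::euclidean_space"
  shows "\<exists>\<psi>. (\<forall>n::nat. \<psi> n \<in> test_functions (box a c)) \<and> (\<forall>n x. 0 \<le> \<psi> n x \<and> \<psi> n x \<le> 1) \<and>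
    (\<forall>x\<in>box a c. (\<lambda>n. \<psi> n x) \<longlonglongrightarrow> 1)"
proof -
  define \<psi> where "\<psi> n x = (\<Prod>b\<in>Basis. flat 1 (real (Suc n) * (x \<bullet> b - a \<bullet> b) - 1) *
      flat 1 (real (Suc n) * (c \<bullet> b - x \<bullet> b) - 1))" for n and x :: 'a
  have Ck: "Ck k (\<psi> n)" for k n
  proof -
    have "Ck k (\<lambda>x::'a. flat 1 (real (Suc n) * (x \<bullet> b) + (- real (Suc n) * (a \<bullet> b) - 1)))"
      "Ck k (\<lambda>x::'a. flat 1 (- real (Suc n) * (x \<bullet> b) + (real (Suc n) * (c \<bullet> b) - 1)))" for b
      by (intro Ck_affine Ck_flat bounded_linear_intros)+
    then show ?thesis
      unfolding \<psi>_def by (intro Ck_prod Ck_mult finite_Basis) (simp_all add: algebra_simps)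
  qed
  have nonzero: "x \<in> cbox (\<Sum>b\<in>Basis. (a \<bullet> b + 1 / Suc n) *\<^sub>R b) (\<Sum>b\<in>Basis. (c \<bullet> b - 1 / Suc n) *\<^sub>R b)"
    (is "_ \<in> ?K n") if "\<psi> n x \<noteq> 0" for n x
    using that by (auto simp: \<psi>_def mem_box flat_1 field_simps split: if_splits)
  have sub: "?K n \<subseteq> box a c" for n
  proof
    fix x assume x: "x \<in> ?K n"
    have "1 / real (Suc n) > 0" by simp
    then have *: "a \<bullet> b < a \<bullet> b + 1 / Suc n" "c \<bullet> b - 1 / Suc n < c \<bullet> b" for b
      by linarith+
    have "a \<bullet> b + 1 / Suc n \<le> x \<bullet> b" "x \<bullet> b \<le> c \<bullet> b - 1 / Suc n" if "b \<in> Basis" for b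
      using x that by (simp_all add: mem_box)
    then show "x \<in> box a c"
      unfolding mem_box using * less_le_trans le_less_trans by blast
  qed
  have "\<psi> n \<in> test_functions (box a c)" for n
    by (rule test_functionsI[OF Ck compact_cbox sub nonzero])
  moreover have "0 \<le> \<psi> n x \<and> \<psi> n x \<le> 1" for n x
    unfolding \<psi>_def by (intro conjI prod_nonneg prod_le_1) (auto simp: flat_1 intro!: mult_le_one)
  moreover have "(\<lambda>n. \<psi> n x) \<longlonglongrightarrow> 1" if "x \<in> box a c" for x
  proof -
    have *: "(\<lambda>n. flat 1 (real (Suc n) * t - 1)) \<longlonglongrightarrow> 1" if "t > 0" for t
    proof -
      have lim: "filterlim (\<lambda>n. real (Suc n) * t - 1) at_top sequentially"
        using that by real_asymp
      have "((\<lambda>y. exp (- (1 / y))) \<longlongrightarrow> (1::real)) at_top"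
        by real_asymp
      then have "(flat 1 \<longlongrightarrow> 1) at_top"
        by (rule Lim_transform_eventually)
          (auto simp: flat_1 intro: eventually_mono[OF eventually_gt_at_top[of 0]])
      then show ?thesis by (rule filterlim_compose[OF _ lim])
    qed
    have "(\<lambda>n. \<psi> n x) \<longlonglongrightarrow> (\<Prod>b\<in>(Basis::'a set). 1 * 1)"
      unfolding \<psi>_def
      by (intro tendsto_prod tendsto_mult *) (use that in \<open>auto simp: mem_box\<close>)
    then show ?thesis by simp
  qed
  ultimately show ?thesis by blast
qed

text \<open>Instead of convolution: a measurable function is an almost everywhere limit of
  continuous ones; these are truncated, replaced by polynomials through Stone-Weierstrass and
  multiplied by cutoffs. The uniform bound prepares for dominated convergence.\<close>

lemma ex_test_functions_tendsto_AE:
  fixes f :: "'a::euclidean_space \<Rightarrow> real"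
  assumes f: "f \<in> borel_measurable (lebesgue_on (box a c))" and M: "\<And>x. x \<in> box a c \<Longrightarrow> \<bar>f x\<bar> \<le> M"
  shows "\<exists>\<phi>. (\<forall>n::nat. \<phi> n \<in> test_functions (box a c)) \<and> (\<forall>n x. \<bar>\<phi> n x\<bar> \<le> \<bar>M\<bar> + 1) \<and>
    (AE x in lebesgue_on (box a c). (\<lambda>n. \<phi> n x) \<longlonglongrightarrow> f x)"
proof -
  have "f measurable_on (box a c)"
    using f by (simp add: measurable_on_iff_borel_measurable)
  then obtain N g where N: "negligible N" and g: "\<And>n. continuous_on UNIV (g n)"
      and lim: "\<And>x. x \<notin> N \<Longrightarrow> (\<lambda>n. g n x) \<longlonglongrightarrow> (if x \<in> box a c then f x else 0)"
    by (auto simp: measurable_on_def)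
  obtain \<psi> where \<psi>: "\<And>n::nat. \<psi> n \<in> test_functions (box a c)" "\<And>n x. 0 \<le> \<psi> n x" "\<And>n x. \<psi> n x \<le> 1"
      "\<And>x. x \<in> box a c \<Longrightarrow> (\<lambda>n. \<psi> n x) \<longlonglongrightarrow> 1"
    using ex_test_functions_tendsto_1[of a c] by blast
  \<comment> \<open>The continuous approximants carry no bound of their own, so they are clipped.
    \<open>M\<close> may be negative when the box is empty, hence
    \<open>\<bar>M\<bar>\<close>.\<close>
  define h where "h n x = max (- \<bar>M\<bar>) (min \<bar>M\<bar> (g n x))" for n x
  have "\<exists>p. real_polynomial_function p \<and> (\<forall>x\<in>cbox a c. \<bar>h n x - p x\<bar> < 1 / Suc n)" for n
  proof -
    have "continuous_on (cbox a c) (h n)"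
      unfolding h_def by (intro continuous_intros continuous_on_subset[OF g]) auto
    then show ?thesis
      using Stone_Weierstrass_real_polynomial_function[OF compact_cbox, of a c "h n" "1 / Suc n"]
      by (metis of_nat_0_less_iff zero_less_Suc zero_less_divide_1_iff)
  qed
  then obtain p where p: "\<And>n. real_polynomial_function (p n)"
      "\<And>n x. x \<in> cbox a c \<Longrightarrow> \<bar>h n x - p n x\<bar> < 1 / Suc n"
    by metis
  define \<phi> where "\<phi> n x = p n x * \<psi> n x" for n x
  have "\<phi> n \<in> test_functions (box a c)" for n
    unfolding \<phi>_def by (intro test_functions_mult Ck_real_polynomial_function p \<psi>)
  moreover have "\<bar>\<phi> n x\<bar> \<le> \<bar>M\<bar> + 1" for n x
  proof (cases "x \<in> box a c")
    case True
    then have "\<bar>h n x - p n x\<bar> < 1 / Suc n"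
      using p(2) box_subset_cbox by blast
    moreover have "1 / Suc n \<le> (1::real)" by simp
    moreover have "\<bar>h n x\<bar> \<le> \<bar>M\<bar>" by (auto simp: h_def)
    ultimately have "\<bar>p n x\<bar> \<le> \<bar>M\<bar> + 1" by linarith
    moreover have "\<bar>\<phi> n x\<bar> \<le> \<bar>p n x\<bar>"
      using \<psi>(2,3)[of n x] by (auto simp: \<phi>_def abs_mult intro: mult_left_le)
    ultimately show ?thesis by linarith
  next
    case False
    then show ?thesis using test_function_eq_0[OF \<psi>(1)] by (simp add: \<phi>_def)
  qed
  moreover have "AE x in lebesgue_on (box a c). (\<lambda>n. \<phi> n x) \<longlonglongrightarrow> f x"
  proof -
    have *: "(\<lambda>n. \<phi> n x) \<longlonglongrightarrow> f x" if "x \<notin> N" "x \<in> box a c" for x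
    proof -
      have "(\<lambda>n. h n x) \<longlonglongrightarrow> max (- \<bar>M\<bar>) (min \<bar>M\<bar> (f x))"
        unfolding h_def using lim[OF that(1)] that(2) by (intro tendsto_intros) auto
      moreover have "max (- \<bar>M\<bar>) (min \<bar>M\<bar> (f x)) = f x"
        using M[OF that(2)] by auto
      moreover have "(\<lambda>n. h n x - p n x) \<longlonglongrightarrow> 0"
      proof (rule Lim_null_comparison)
        show "\<forall>\<^sub>F n in sequentially. norm (h n x - p n x) \<le> 1 / Suc n"
          using p(2)[of x] that(2) box_subset_cbox[of a c] by (auto intro!: always_eventually less_imp_le)
        show "(\<lambda>n. 1 / real (Suc n)) \<longlonglongrightarrow> 0"
          using LIMSEQ_inverse_real_of_nat by (simp add: field_simps)
      qed
      \<comment> \<open>The polynomial is written as \<open>h\<close> minus the Stone-Weierstrass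
        error.\<close>
      ultimately have "(\<lambda>n. (h n x - (h n x - p n x)) * \<psi> n x) \<longlonglongrightarrow> (f x - 0) * 1"
        by (intro tendsto_intros \<psi>(4) that(2)) auto
      then show ?thesis by (simp add: \<phi>_def)
    qed
    have "AE x in lebesgue. x \<notin> N"
      using N by (simp add: AE_not_in negligible_iff_null_sets)
    then show ?thesis
      by (subst AE_restrict_space_iff) (auto elim: eventually_mono simp: *)
  qed
  ultimately show ?thesis by blast
qed

section \<open>Weak derivatives\<close>

lemma AE_lebesgue_on_subset:
  assumes "AE x in lebesgue_on S. P x" "K \<subseteq> S" "K \<in> sets lebesgue" "S \<in> sets lebesgue"
  shows "AE x in lebesgue_on K. P x"
proof -
  have "AE x in lebesgue. x \<in> S \<longrightarrow> P x"
    using assms(1,4) by (subst (asm) AE_restrict_space_iff) auto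
  then have "AE x in lebesgue. x \<in> K \<longrightarrow> P x"
    by eventually_elim (use assms(2) in blast)
  then show ?thesis
    using assms(3) by (subst AE_restrict_space_iff) auto
qed

text \<open>Lebesgue measure is complete, so a change on a null set preserves measurability.\<close>

lemma borel_measurable_lebesgue_on_AE:
  fixes f g :: "'a::euclidean_space \<Rightarrow> 'b::euclidean_space"
  assumes "f \<in> borel_measurable (lebesgue_on S)" "AE x in lebesgue_on S. f x = g x" "S \<in> sets lebesgue"
  shows "g \<in> borel_measurable (lebesgue_on S)"
proof -
  obtain N where N: "{x \<in> space (lebesgue_on S). f x \<noteq> g x} \<subseteq> N" "N \<in> null_sets (lebesgue_on S)"
    using AE_E[OF assms(2)] null_setsI by metis
  have "f \<in> borel_measurable (lebesgue_on (S - N))"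
    using borel_measurable_diff_null[OF N(2) assms(3)] assms(1) by blast
  then have "g \<in> borel_measurable (lebesgue_on (S - N))"
    by (rule measurable_lebesgue_cong[THEN iffD1, rotated]) (use N(1) in auto)
  then show ?thesis
    using borel_measurable_diff_null[OF N(2) assms(3)] by blast
qed

lemma
  fixes f g :: "'a::euclidean_space \<Rightarrow> 'b::euclidean_space"
  assumes "AE x in lebesgue_on S. f x = g x" "S \<in> sets lebesgue"
  shows integrable_lebesgue_on_cong_AE:
      "integrable (lebesgue_on S) f \<longleftrightarrow> integrable (lebesgue_on S) g" (is ?A)
    and integral_lebesgue_on_cong_AE: "integral\<^sup>L (lebesgue_on S) f = integral\<^sup>L (lebesgue_on S) g" (is ?B)
proof -
  have "AE x in lebesgue_on S. g x = f x"
    using assms(1) by eventually_elim simp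
  then have meas: "f \<in> borel_measurable (lebesgue_on S) \<longleftrightarrow> g \<in> borel_measurable (lebesgue_on S)"
    using borel_measurable_lebesgue_on_AE assms by blast
  show ?A
    using meas integrable_cong_AE[OF _ _ assms(1)] by (meson borel_measurable_integrable)
  show ?B
  proof (cases "f \<in> borel_measurable (lebesgue_on S)")
    case True
    then show ?thesis using meas integral_cong_AE[OF _ _ assms(1)] by blast
  next
    \<comment> \<open>Neither function is integrable then, and both integrals have the default value
      \<open>0\<close>.\<close>
    case False
    then have "\<not> integrable (lebesgue_on S) f" "\<not> integrable (lebesgue_on S) g"
      using meas by (auto dest: borel_measurable_integrable)
    then show ?thesis by (simp add: not_integrable_integral_eq)
  qed
qed

lemma integrable_lebesgue_on_subset:
  fixes f :: "'a::euclidean_space \<Rightarrow> 'b::euclidean_space"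
  assumes "integrable (lebesgue_on S) f" "K \<subseteq> S" "K \<in> sets lebesgue" "S \<in> sets lebesgue"
  shows "integrable (lebesgue_on K) f"
proof -
  have "set_integrable lebesgue S f"
    using assms(1,4) by (simp add: set_integrable_def integrable_restrict_space)
  then have "set_integrable lebesgue K f"
    using assms(2,3) set_integrable_subset by blast
  then show ?thesis
    using assms(3) by (simp add: set_integrable_def integrable_restrict_space)
qed

lemma
  fixes f :: "'a::euclidean_space \<Rightarrow> 'b::euclidean_space"
  assumes "K \<subseteq> S" "K \<in> sets lebesgue" "S \<in> sets lebesgue" "\<And>x. x \<in> S \<Longrightarrow> x \<notin> K \<Longrightarrow> f x = 0"
  shows integrable_lebesgue_on_support:
      "integrable (lebesgue_on S) f \<longleftrightarrow> integrable (lebesgue_on K) f"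
    and integral_lebesgue_on_support: "integral\<^sup>L (lebesgue_on S) f = integral\<^sup>L (lebesgue_on K) f"
proof -
  have eq: "(\<lambda>x. if x \<in> S then f x else 0) = (\<lambda>x. if x \<in> K then f x else 0)"
    using assms by (intro ext) auto
  show "integrable (lebesgue_on S) f \<longleftrightarrow> integrable (lebesgue_on K) f"
    using Lebesgue_Measure.integrable_restrict_UNIV[OF assms(2), of f]
      Lebesgue_Measure.integrable_restrict_UNIV[OF assms(3), of f]
    by (simp add: eq)
  show "integral\<^sup>L (lebesgue_on S) f = integral\<^sup>L (lebesgue_on K) f"
    using Lebesgue_Measure.integral_restrict_UNIV[OF assms(2), of f]
      Lebesgue_Measure.integral_restrict_UNIV[OF assms(3), of f]
    by (simp add: eq)
qed

text \<open>The product lives on the compact support of \<open>\<phi>\<close>, where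
  \<open>\<phi>\<close> is bounded and \<open>f\<close> is integrable.\<close>

lemma integrable_test_function_scaleR:
  fixes f :: "'a::euclidean_space \<Rightarrow> 'b::euclidean_space"
  assumes "\<phi> \<in> test_functions S" "locally_integrable S f" "S \<in> sets lebesgue"
  shows "integrable (lebesgue_on S) (\<lambda>x. \<phi> x *\<^sub>R f x)"
proof -
  define K where "K = closure {x. \<phi> x \<noteq> 0}"
  have K: "compact K" "K \<subseteq> S"
    using test_functionsD(2,3)[OF assms(1)] by (auto simp: K_def)
  have Kl: "K \<in> sets lebesgue"
    using K(1) by (simp add: compact_imp_closed borel_closed)
  have cont: "continuous_on UNIV \<phi>"
    using test_functionsD(1)[OF assms(1), of 0] by simp
  obtain C where C: "\<And>x. x \<in> K \<Longrightarrow> norm (\<phi> x) \<le> C"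
    using compact_imp_bounded[OF compact_continuous_image[OF continuous_on_subset[OF cont] K(1)]]
    by (auto simp: bounded_iff)
  have f: "integrable (lebesgue_on K) f"
    using assms(2) K by (simp add: locally_integrable_def)
  have "integrable (lebesgue_on K) (\<lambda>x. \<phi> x *\<^sub>R f x)"
  proof (rule Bochner_Integration.integrable_bound)
    show "integrable (lebesgue_on K) (\<lambda>x. C *\<^sub>R f x)"
      using f by simp
    show "(\<lambda>x. \<phi> x *\<^sub>R f x) \<in> borel_measurable (lebesgue_on K)"
      by (intro borel_measurable_scaleR borel_measurable_integrable[OF f]
          continuous_imp_measurable_on_sets_lebesgue continuous_on_subset[OF cont] Kl) simp
    show "AE x in lebesgue_on K. norm (\<phi> x *\<^sub>R f x) \<le> norm (C *\<^sub>R f x)"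
      by (rule AE_I2) (use C in \<open>force intro!: mult_right_mono\<close>)
  qed
  then show ?thesis
    using K(2) Kl assms(3) test_function_support[of \<phi>]
    by (subst integrable_lebesgue_on_support[of K]) (auto simp: K_def)
qed

lemma test_functions_frechet_derivative:
  assumes "\<phi> \<in> test_functions S"
  shows "(\<lambda>x. frechet_derivative \<phi> (at x) v) \<in> test_functions S"
proof (rule test_functionsI[OF _ test_functionsD(2,3)[OF assms]])
  show "Ck k (\<lambda>x. frechet_derivative \<phi> (at x) v)" for k
    using test_functionsD(1)[OF assms, of "Suc k"] by simp
  fix x assume nz: "frechet_derivative \<phi> (at x) v \<noteq> 0"
  show "x \<in> closure {x. \<phi> x \<noteq> 0}"
  proof (rule ccontr)
    assume x: "x \<notin> closure {x. \<phi> x \<noteq> 0}"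
    \<comment> \<open>Off its closed support \<open>\<phi>\<close> vanishes on a whole
      neighbourhood, so its derivative is \<open>0\<close> there.\<close>
    have "((\<lambda>_. 0) has_derivative (\<lambda>_. 0)) (at x)" by simp
    then have "(\<phi> has_derivative (\<lambda>_. 0)) (at x)"
      by (rule has_derivative_transform_within_open[of _ _ _ _ "- closure {x. \<phi> x \<noteq> 0}"])
        (use x test_function_support[of \<phi>] in auto)
    then show False
      using nz frechet_derivative_at by metis
  qed
qed

section \<open>The fundamental lemma of the calculus of variations\<close>

lemma locally_integrable_inner:
  assumes "locally_integrable S f" shows "locally_integrable S (\<lambda>x. f x \<bullet> b)"
  using assms by (auto simp: locally_integrable_def)

text \<open>Testing against bounded smooth approximations of \<open>sgn f\<close> yields \<open>\<integral>\<bar>f\<bar> = 0\<close> on every box.\<close>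

lemma fundamental_lemma_real:
  fixes f :: "'a::euclidean_space \<Rightarrow> real"
  assumes "open S" "locally_integrable S f"
    and 0: "\<And>\<phi>. \<phi> \<in> test_functions S \<Longrightarrow> (LINT x|lebesgue_on S. \<phi> x * f x) = 0"
  shows "AE x in lebesgue_on S. f x = 0"
proof -
  \<comment> \<open>The closed box is compact in \<open>S\<close>, which makes \<open>f\<close>
    integrable on it, while the test functions live on the open box.\<close>
  have box: "AE x in lebesgue. x \<in> cbox a c \<longrightarrow> f x = 0" if sub: "cbox a c \<subseteq> S" for a c
  proof -
    let ?M = "lebesgue_on (box a c)"
    have box_sub: "box a c \<subseteq> S" using sub box_subset_cbox by blast
    have f: "integrable ?M f"
      using assms(2) sub
      by (intro integrable_lebesgue_on_subset[of "cbox a c" f "box a c"])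
        (simp_all add: locally_integrable_def box_subset_cbox)
    have [measurable]: "f \<in> borel_measurable ?M" using f by simp
    have "(\<lambda>x. sgn (f x)) \<in> borel_measurable ?M" by simp
    then obtain \<phi> where \<phi>: "\<And>n::nat. \<phi> n \<in> test_functions (box a c)" "\<And>n x. \<bar>\<phi> n x\<bar> \<le> \<bar>1\<bar> + 1"
        "AE x in ?M. (\<lambda>n. \<phi> n x) \<longlonglongrightarrow> sgn (f x)"
      using ex_test_functions_tendsto_AE[of "\<lambda>x. sgn (f x)" a c 1] by (auto simp: abs_sgn_eq)
    have meas: "\<phi> n \<in> borel_measurable ?M" for n
      using test_functionsD(1)[OF \<phi>(1)[of n], of 0]
      by (intro continuous_imp_measurable_on_sets_lebesgue) (auto intro: continuous_on_subset)
    have lim: "(\<lambda>n. LINT x|?M. \<phi> n x * f x) \<longlonglongrightarrow> (LINT x|?M. sgn (f x) * f x)"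
    \<comment> \<open>The factor \<open>2\<close> is the bound \<open>\<bar>1\<bar> + 1\<close> of
      the approximants to \<open>sgn (f x)\<close>.\<close>
    proof (rule integral_dominated_convergence[where w="\<lambda>x. 2 * \<bar>f x\<bar>"])
      show "AE x in ?M. (\<lambda>n. \<phi> n x * f x) \<longlonglongrightarrow> sgn (f x) * f x"
        using \<phi>(3) by eventually_elim (intro tendsto_intros)
      show "AE x in ?M. norm (\<phi> n x * f x) \<le> 2 * \<bar>f x\<bar>" for n
        using \<phi>(2)[of n] by (intro AE_I2) (auto simp: abs_mult intro!: mult_right_mono)
    qed (use f meas in simp_all)
    have eq: "(\<lambda>n. LINT x|?M. \<phi> n x * f x) = (\<lambda>n. 0)"
    proof
      fix n
      have "(LINT x|lebesgue_on S. \<phi> n x * f x) = (LINT x|?M. \<phi> n x * f x)"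
        by (intro integral_lebesgue_on_support box_sub)
          (use assms(1) test_function_eq_0[OF \<phi>(1)] in auto)
      then show "(LINT x|?M. \<phi> n x * f x) = 0"
        using 0[of "\<phi> n"] \<phi>(1) test_functions_mono[OF box_sub] by auto
    qed
    have "(LINT x|?M. sgn (f x) * f x) = 0"
      using LIMSEQ_unique[OF lim[unfolded eq] tendsto_const] .
    then have "(LINT x|?M. \<bar>f x\<bar>) = 0"
      by (simp add: abs_sgn mult.commute)
    then have "AE x in ?M. f x = 0"
      using f by (subst (asm) integral_nonneg_eq_0_iff_AE) auto
    then have "AE x in lebesgue. x \<in> box a c \<longrightarrow> f x = 0"
      by (subst (asm) AE_restrict_space_iff) auto
    moreover have "AE x in lebesgue. x \<notin> cbox a c - box a c"
      using negligible_frontier_interval[of a c] unfolding negligible_iff_null_sets by (rule AE_not_in)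
    ultimately show ?thesis by eventually_elim blast
  qed
  \<comment> \<open>An open set is a countable union of closed boxes, so the exceptional null sets
    add up to a null set.\<close>
  obtain \<D> where D: "countable \<D>" "\<D> \<subseteq> Pow S" "\<And>X. X \<in> \<D> \<Longrightarrow> \<exists>a b. X = cbox a b" "\<Union>\<D> = S"
    using open_countable_Union_open_cbox[OF assms(1)] by metis
  have "AE x in lebesgue. \<forall>X\<in>\<D>. x \<in> X \<longrightarrow> f x = 0"
  proof (subst AE_ball_countable[OF D(1)], intro ballI)
    fix X assume X: "X \<in> \<D>"
    then obtain a b where "X = cbox a b" using D(3) by blast
    then show "AE x in lebesgue. x \<in> X \<longrightarrow> f x = 0"
      using box[of a b] X D(2) by blast
  qed
  then have "AE x in lebesgue. x \<in> S \<longrightarrow> f x = 0"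
    by eventually_elim (use D(4) in blast)
  then show ?thesis
    using assms(1) by (subst AE_restrict_space_iff) auto
qed

lemma fundamental_lemma:
  fixes f :: "'a::euclidean_space \<Rightarrow> 'b::euclidean_space"
  assumes "open S" "locally_integrable S f"
    and 0: "\<And>\<phi>. \<phi> \<in> test_functions S \<Longrightarrow> (LINT x|lebesgue_on S. \<phi> x *\<^sub>R f x) = 0"
  shows "AE x in lebesgue_on S. f x = 0"
proof -
  have "AE x in lebesgue_on S. f x \<bullet> b = 0" for b
  proof (rule fundamental_lemma_real[OF assms(1) locally_integrable_inner[OF assms(2)]])
    fix \<phi> assume \<phi>: "\<phi> \<in> test_functions S"
    have "integrable (lebesgue_on S) (\<lambda>x. \<phi> x *\<^sub>R f x)"
      using \<phi> assms by (intro integrable_test_function_scaleR) auto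
    then have "(LINT x|lebesgue_on S. (\<phi> x *\<^sub>R f x) \<bullet> b) = (LINT x|lebesgue_on S. \<phi> x *\<^sub>R f x) \<bullet> b"
      by (rule integral_inner_left)
    then show "(LINT x|lebesgue_on S. \<phi> x * (f x \<bullet> b)) = 0"
      using 0[OF \<phi>] by simp
  qed
  then have "AE x in lebesgue_on S. \<forall>b\<in>Basis. f x \<bullet> b = 0"
    by (subst AE_ball_countable) (auto intro: countable_finite)
  then show ?thesis
    by eventually_elim (simp add: euclidean_all_zero_iff)
qed

section \<open>Uniqueness and rules for weak derivatives\<close>

lemma locally_integrable_AE:
  assumes "locally_integrable S f" "AE x in lebesgue_on S. f x = g x" "S \<in> sets lebesgue"
  shows "locally_integrable S g"
  unfolding locally_integrable_def
proof (intro allI impI, elim conjE)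
  fix K assume K: "compact K" "K \<subseteq> S"
  then have Kl: "K \<in> sets lebesgue" by (simp add: compact_imp_closed borel_closed)
  show "integrable (lebesgue_on K) g"
    using integrable_lebesgue_on_cong_AE[OF AE_lebesgue_on_subset[OF assms(2) K(2) Kl assms(3)] Kl]
      assms(1) K by (simp add: locally_integrable_def)
qed

lemma locally_integrable_add:
  "locally_integrable S f \<Longrightarrow> locally_integrable S g \<Longrightarrow> locally_integrable S (\<lambda>x. f x + g x)"
  by (auto simp: locally_integrable_def)

lemma locally_integrable_bounded_linear:
  "bounded_linear T \<Longrightarrow> locally_integrable S f \<Longrightarrow> locally_integrable S (\<lambda>x. T (f x))"
  by (auto simp: locally_integrable_def intro: integrable_bounded_linear)

lemma has_weak_partial_cong_AE:
  assumes "has_weak_partial S b f g" "AE x in lebesgue_on S. f x = f' x"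
    "AE x in lebesgue_on S. g x = g' x" "S \<in> sets lebesgue"
  shows "has_weak_partial S b f' g'"
proof -
  have "(LINT x|lebesgue_on S. frechet_derivative \<phi> (at x) b *\<^sub>R f' x) =
        (LINT x|lebesgue_on S. frechet_derivative \<phi> (at x) b *\<^sub>R f x)" for \<phi>
    by (rule integral_lebesgue_on_cong_AE[OF _ assms(4)]) (use assms(2) in eventually_elim, simp)
  moreover have "(LINT x|lebesgue_on S. \<phi> x *\<^sub>R g' x) = (LINT x|lebesgue_on S. \<phi> x *\<^sub>R g x)" for \<phi>
    by (rule integral_lebesgue_on_cong_AE[OF _ assms(4)]) (use assms(3) in eventually_elim, simp)
  ultimately show ?thesis
    using assms locally_integrable_AE by (auto simp: has_weak_partial_def)
qed

text \<open>The difference of two candidates integrates to \<open>0\<close> against every test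
  function, so the fundamental lemma applies.\<close>

lemma has_weak_partial_unique:
  assumes "open S" "has_weak_partial S b f g" "has_weak_partial S b f g'"
  shows "AE x in lebesgue_on S. g x = g' x"
proof -
  have int: "integrable (lebesgue_on S) (\<lambda>x. \<phi> x *\<^sub>R h x)"
    if "\<phi> \<in> test_functions S" "h \<in> {g, g'}" for \<phi> h
    using that assms by (intro integrable_test_function_scaleR) (auto simp: has_weak_partial_def)
  have "AE x in lebesgue_on S. g x + (-1) *\<^sub>R g' x = 0"
  proof (rule fundamental_lemma[OF assms(1)])
    show "locally_integrable S (\<lambda>x. g x + (-1) *\<^sub>R g' x)"
      by (rule locally_integrable_add[OF _ locally_integrable_bounded_linear[OF bounded_linear_scaleR_right]])
        (use assms in \<open>auto simp: has_weak_partial_def\<close>)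
    fix \<phi> assume \<phi>: "\<phi> \<in> test_functions S"
    have "(LINT x|lebesgue_on S. \<phi> x *\<^sub>R g x) = (LINT x|lebesgue_on S. \<phi> x *\<^sub>R g' x)"
      using assms \<phi> unfolding has_weak_partial_def by (metis neg_equal_iff_equal)
    then show "(LINT x|lebesgue_on S. \<phi> x *\<^sub>R (g x + (-1) *\<^sub>R g' x)) = 0"
      using int[OF \<phi>] by (simp add: scaleR_right_diff_distrib)
  qed
  then show ?thesis by eventually_elim simp
qed

lemma has_weak_partial_bounded_linear:
  fixes T :: "'b::euclidean_space \<Rightarrow> 'c::euclidean_space"
  assumes "bounded_linear T" "has_weak_partial S b f g" "S \<in> sets lebesgue"
  shows "has_weak_partial S b (\<lambda>x. T (f x)) (\<lambda>x. T (g x))"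
proof -
  interpret T: bounded_linear T by fact
  have "(LINT x|lebesgue_on S. \<phi> x *\<^sub>R T (h x)) = T (LINT x|lebesgue_on S. \<phi> x *\<^sub>R h x)"
    if "\<phi> \<in> test_functions S" "locally_integrable S h" for \<phi> h
    using integral_bounded_linear[OF assms(1) integrable_test_function_scaleR[OF that assms(3)]]
    by (simp add: T.scaleR)
  then show ?thesis
    using assms(2) unfolding has_weak_partial_def
    by (auto simp: T.neg test_functions_frechet_derivative locally_integrable_bounded_linear[OF assms(1)])
qed

lemma has_weak_partial_add:
  assumes "has_weak_partial S b f g" "has_weak_partial S b f' g'" "S \<in> sets lebesgue"
  shows "has_weak_partial S b (\<lambda>x. f x + f' x) (\<lambda>x. g x + g' x)"
proof -
  have li: "locally_integrable S h" if "h \<in> {f, f', g, g'}" for h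
    using that assms by (auto simp: has_weak_partial_def)
  have add: "(LINT x|lebesgue_on S. \<phi> x *\<^sub>R (h x + h' x)) =
      (LINT x|lebesgue_on S. \<phi> x *\<^sub>R h x) + (LINT x|lebesgue_on S. \<phi> x *\<^sub>R h' x)"
    if "\<phi> \<in> test_functions S" "locally_integrable S h" "locally_integrable S h'" for \<phi> h h'
    unfolding scaleR_add_right
    by (intro Bochner_Integration.integral_add integrable_test_function_scaleR that assms(3))
  show ?thesis
    unfolding has_weak_partial_def
  proof (intro conjI ballI)
    fix \<phi> assume \<phi>: "\<phi> \<in> test_functions S"
    show "(LINT x|lebesgue_on S. frechet_derivative \<phi> (at x) b *\<^sub>R (f x + f' x)) =
        - (LINT x|lebesgue_on S. \<phi> x *\<^sub>R (g x + g' x))"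
      using assms(1,2) \<phi>
      by (simp add: add[OF \<phi>] add[OF test_functions_frechet_derivative[OF \<phi>]] li has_weak_partial_def)
  qed (auto intro: locally_integrable_add li)
qed

lemma weak_partial_works:
  "has_weak_partial S b f g \<Longrightarrow> has_weak_partial S b f (weak_partial S b f)"
  unfolding weak_partial_def by (rule someI[where P="has_weak_partial S b f"])

lemma weak_partial_eq_AE:
  "open S \<Longrightarrow> has_weak_partial S b f g \<Longrightarrow> AE x in lebesgue_on S. weak_partial S b f x = g x"
  using has_weak_partial_unique weak_partial_works by blast

text \<open>An equality everywhere, because both sides apply \<open>SOME\<close> to the same
  predicate. It permits rewriting inside iterated weak derivatives.\<close>

lemma weak_partial_cong_AE:
  assumes "AE x in lebesgue_on S. f x = f' x" "S \<in> sets lebesgue"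
  shows "weak_partial S b f = weak_partial S b f'"
proof -
  have "AE x in lebesgue_on S. f' x = f x"
    using assms(1) by eventually_elim simp
  then have "has_weak_partial S b f = has_weak_partial S b f'"
    using has_weak_partial_cong_AE[OF _ _ AE_I2 assms(2)] assms(1) by (intro ext) blast
  then show ?thesis by (simp add: weak_partial_def)
qed

section \<open>Square-integrable functions and Sobolev spaces\<close>

lemma L2_D:
  "f \<in> L2 S \<Longrightarrow> f \<in> borel_measurable (lebesgue_on S)"
  "f \<in> L2 S \<Longrightarrow> integrable (lebesgue_on S) (\<lambda>x. (norm (f x))\<^sup>2)"
  by (auto simp: L2_def)

lemma L2_AE:
  assumes "f \<in> L2 S" "AE x in lebesgue_on S. f x = g x" "S \<in> sets lebesgue"
  shows "g \<in> L2 S"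
proof -
  have "AE x in lebesgue_on S. (norm (f x))\<^sup>2 = (norm (g x))\<^sup>2"
    using assms(2) by eventually_elim simp
  from integrable_lebesgue_on_cong_AE[OF this assms(3)]
  have "integrable (lebesgue_on S) (\<lambda>x. (norm (g x))\<^sup>2)"
    using L2_D(2)[OF assms(1)] by simp
  then show ?thesis
    using borel_measurable_lebesgue_on_AE[OF L2_D(1)[OF assms(1)] assms(2,3)] by (simp add: L2_def)
qed

lemma L2_bound:
  fixes g :: "'a::euclidean_space \<Rightarrow> 'b::euclidean_space"
  assumes "f \<in> L2 S" "g \<in> borel_measurable (lebesgue_on S)" "\<And>x. x \<in> S \<Longrightarrow> norm (g x) \<le> C * norm (f x)"
  shows "g \<in> L2 S"
proof -
  have "integrable (lebesgue_on S) (\<lambda>x. (norm (g x))\<^sup>2)"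
  proof (rule Bochner_Integration.integrable_bound)
    show "integrable (lebesgue_on S) (\<lambda>x. C\<^sup>2 * (norm (f x))\<^sup>2)"
      using L2_D[OF assms(1)] by simp
    show "AE x in lebesgue_on S. norm ((norm (g x))\<^sup>2) \<le> norm (C\<^sup>2 * (norm (f x))\<^sup>2)"
      using power_mono[OF assms(3) norm_ge_zero, of _ 2] by (intro AE_I2) (auto simp: power_mult_distrib)
  qed (use assms(2) in simp)
  then show ?thesis using assms(2) by (simp add: L2_def)
qed

lemma norm_add_sq_le:
  fixes a b :: "'a::real_normed_vector"
  shows "(norm (a + b))\<^sup>2 \<le> 2 * (norm a)\<^sup>2 + 2 * (norm b)\<^sup>2"
  using power_mono[OF norm_triangle_ineq norm_ge_zero, of a b 2]
    sum_squares_ge_zero[of "norm a - norm b" 0]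
  by (auto simp: power2_eq_square algebra_simps)

lemma L2_add:
  assumes "f \<in> L2 S" "g \<in> L2 S" shows "(\<lambda>x. f x + g x) \<in> L2 S"
proof -
  have "integrable (lebesgue_on S) (\<lambda>x. (norm (f x + g x))\<^sup>2)"
  proof (rule Bochner_Integration.integrable_bound)
    show "integrable (lebesgue_on S) (\<lambda>x. 2 * (norm (f x))\<^sup>2 + 2 * (norm (g x))\<^sup>2)"
      using L2_D[OF assms(1)] L2_D[OF assms(2)] by simp
    show "AE x in lebesgue_on S. norm ((norm (f x + g x))\<^sup>2) \<le> norm (2 * (norm (f x))\<^sup>2 + 2 * (norm (g x))\<^sup>2)"
      by (simp add: norm_add_sq_le)
  qed (use L2_D[OF assms(1)] L2_D[OF assms(2)] in simp)
  then show ?thesis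
    using L2_D[OF assms(1)] L2_D[OF assms(2)] by (simp add: L2_def)
qed

lemma L2_bounded_linear:
  fixes T :: "'b::euclidean_space \<Rightarrow> 'c::euclidean_space"
  assumes "f \<in> L2 S" "bounded_linear T" shows "(\<lambda>x. T (f x)) \<in> L2 S"
proof -
  obtain C where "\<And>x. norm (T x) \<le> norm x * C"
    using bounded_linear.bounded[OF assms(2)] by blast
  then show ?thesis
    using borel_measurable_continuous_on[OF linear_continuous_on[OF assms(2)] L2_D(1)[OF assms(1)]]
    by (intro L2_bound[OF assms(1), of _ C]) (auto simp: mult.commute)
qed

lemma L2_diff:
  assumes "f \<in> L2 S" "g \<in> L2 S" shows "(\<lambda>x. f x - g x) \<in> L2 S"
  using L2_add[OF assms(1) L2_bounded_linear[OF assms(2) bounded_linear_minus[OF bounded_linear_ident]]]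
  by simp

lemma L2_const: "S \<in> lmeasurable \<Longrightarrow> (\<lambda>x. c) \<in> L2 S"
  using finite_measure.integrable_const[OF finite_measure_lebesgue_on] by (simp add: L2_def)

lemma integrable_inner_L2:
  fixes f g :: "'a::euclidean_space \<Rightarrow> 'b::euclidean_space"
  assumes "f \<in> L2 S" "g \<in> L2 S"
  shows "integrable (lebesgue_on S) (\<lambda>x. f x \<bullet> g x)"
proof (rule Bochner_Integration.integrable_bound)
  show "integrable (lebesgue_on S) (\<lambda>x. (norm (f x))\<^sup>2 + (norm (g x))\<^sup>2)"
    using L2_D[OF assms(1)] L2_D[OF assms(2)] by simp
  have "\<bar>f x \<bullet> g x\<bar> \<le> (norm (f x))\<^sup>2 + (norm (g x))\<^sup>2" for x
    using Cauchy_Schwarz_ineq2[of "f x" "g x"] sum_squares_bound[of "norm (f x)" "norm (g x)"]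
      mult_nonneg_nonneg[OF norm_ge_zero norm_ge_zero, of "f x" "g x"] by linarith
  then show "AE x in lebesgue_on S. norm (f x \<bullet> g x) \<le> norm ((norm (f x))\<^sup>2 + (norm (g x))\<^sup>2)"
    by simp
qed (use L2_D[OF assms(1)] L2_D[OF assms(2)] in simp)

lemma integrable_L2:
  assumes "f \<in> L2 S" "S \<in> lmeasurable" shows "integrable (lebesgue_on S) f"
proof (rule Bochner_Integration.integrable_bound)
  show "integrable (lebesgue_on S) (\<lambda>x. 1 + (norm (f x))\<^sup>2)"
    using L2_D[OF assms(1)] L2_const[OF assms(2), of "1::real"]
    by (auto simp: L2_def)
  have "norm (f x) \<le> 1 + (norm (f x))\<^sup>2" for x
    using sum_squares_bound[of "norm (f x)" 1] norm_ge_zero[of "f x"] by (simp del: norm_ge_zero)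
  then show "AE x in lebesgue_on S. norm (f x) \<le> norm (1 + (norm (f x))\<^sup>2)"
    by simp
qed (use L2_D[OF assms(1)] in simp)

lemma integrable_imp_locally_integrable:
  assumes "integrable (lebesgue_on S) f" "S \<in> sets lebesgue"
  shows "locally_integrable S f"
  unfolding locally_integrable_def
proof (intro allI impI, elim conjE)
  fix K assume "compact K" "K \<subseteq> S"
  then show "integrable (lebesgue_on K) f"
    using integrable_lebesgue_on_subset[OF assms(1) _ _ assms(2)] by (simp add: compact_imp_closed borel_closed)
qed

lemma locally_integrable_L2:
  "f \<in> L2 S \<Longrightarrow> S \<in> lmeasurable \<Longrightarrow> locally_integrable S f"
  by (simp add: integrable_L2 integrable_imp_locally_integrable)

text \<open>The discriminant argument: the integral of the squared norm of
  \<open>s *\<^sub>R f x - g x\<close> is a polynomial in \<open>s\<close> of degree at most two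
  that is never negative.\<close>

lemma Cauchy_Schwarz_L2:
  fixes f g :: "'a::euclidean_space \<Rightarrow> 'b::euclidean_space"
  assumes "f \<in> L2 S" "g \<in> L2 S"
  shows "\<bar>LINT x|lebesgue_on S. f x \<bullet> g x\<bar> \<le>
    sqrt (LINT x|lebesgue_on S. (norm (f x))\<^sup>2) * sqrt (LINT x|lebesgue_on S. (norm (g x))\<^sup>2)"
proof -
  define A where "A = (LINT x|lebesgue_on S. (norm (f x))\<^sup>2)"
  define B where "B = (LINT x|lebesgue_on S. (norm (g x))\<^sup>2)"
  define P where "P = (LINT x|lebesgue_on S. f x \<bullet> g x)"
  have "A \<ge> 0" "B \<ge> 0" by (simp_all add: A_def B_def)
  have quad: "0 \<le> s\<^sup>2 * A - 2 * s * P + B" for s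
  proof -
    have "0 \<le> (LINT x|lebesgue_on S. (norm (s *\<^sub>R f x - g x))\<^sup>2)" by simp
    also have "(\<lambda>x. (norm (s *\<^sub>R f x - g x))\<^sup>2) = (\<lambda>x. s\<^sup>2 * (norm (f x))\<^sup>2 - 2 * s * (f x \<bullet> g x) + (norm (g x))\<^sup>2)"
    proof
      fix x show "(norm (s *\<^sub>R f x - g x))\<^sup>2 = s\<^sup>2 * (norm (f x))\<^sup>2 - 2 * s * (f x \<bullet> g x) + (norm (g x))\<^sup>2"
        unfolding power2_norm_eq_inner
        by (simp add: inner_diff_left inner_diff_right inner_commute[of "g x" "f x"] power2_eq_square
            right_diff_distrib)
    qed
    also have "integral\<^sup>L (lebesgue_on S) \<dots> = s\<^sup>2 * A - 2 * s * P + B"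
      using L2_D[OF assms(1)] L2_D[OF assms(2)] integrable_inner_L2[OF assms]
      by (simp add: A_def B_def P_def)
    finally show ?thesis .
  qed
  have "P\<^sup>2 \<le> A * B"
  proof (cases "A = 0")
    case True
    have "P = 0"
    proof (rule ccontr)
      assume "P \<noteq> 0"
      \<comment> \<open>With \<open>A = 0\<close> the polynomial is affine, and at this
        \<open>s\<close> its value is \<open>-1\<close>.\<close>
      then show False using quad[of "(B + 1) / (2 * P)"] True by simp
    qed
    then show ?thesis using True by simp
  next
    case False
    then have "A > 0" using \<open>A \<ge> 0\<close> by simp
    \<comment> \<open>\<open>P / A\<close> is the minimum point of the polynomial.\<close>
    moreover have "0 \<le> B - P\<^sup>2 / A"
      using quad[of "P / A"] False by (simp add: power2_eq_square field_simps)
    ultimately show ?thesis by (simp add: field_simps)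
  qed
  then have "\<bar>P\<bar> \<le> sqrt (A * B)"
    using real_sqrt_le_mono by fastforce
  then show ?thesis by (simp add: A_def B_def P_def real_sqrt_mult)
qed

section \<open>Sobolev spaces, weak convergence and bounded functionals\<close>

lemma sobolev_subset_L2: "f \<in> sobolev k S \<Longrightarrow> f \<in> L2 S"
  by (cases k) auto

lemma sobolev_AE:
  assumes "f \<in> sobolev k S" "AE x in lebesgue_on S. f x = g x" "S \<in> sets lebesgue"
  shows "g \<in> sobolev k S"
proof (cases k)
  case 0
  then show ?thesis using assms L2_AE by auto
next
  case (Suc j)
  then show ?thesis
    using assms L2_AE[OF _ assms(2,3)] has_weak_partial_cong_AE[OF _ assms(2) AE_I2 assms(3)] by fastforce
qed

text \<open>Two linear maps at once let a single induction cover sums, differences and linear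
  images.\<close>

lemma sobolev_linear:
  fixes T T' :: "'b::euclidean_space \<Rightarrow> 'c::euclidean_space"
  assumes "bounded_linear T" "bounded_linear T'" "S \<in> sets lebesgue"
  shows "f \<in> sobolev k S \<Longrightarrow> g \<in> sobolev k S \<Longrightarrow> (\<lambda>x. T (f x) + T' (g x)) \<in> sobolev k S"
proof (induction k arbitrary: f g)
  case 0
  then show ?case
    using L2_add[OF L2_bounded_linear[OF _ assms(1)] L2_bounded_linear[OF _ assms(2)]] by simp
next
  case (Suc k)
  have "\<exists>h\<in>sobolev k S. has_weak_partial S b (\<lambda>x. T (f x) + T' (g x)) h" if "b \<in> Basis" for b
  proof -
    from Suc.prems that obtain f' where "f' \<in> sobolev k S" "has_weak_partial S b f f'"
      by auto
    moreover from Suc.prems that obtain g' where "g' \<in> sobolev k S" "has_weak_partial S b g g'"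
      by auto
    ultimately show ?thesis
      using Suc.IH has_weak_partial_add[OF has_weak_partial_bounded_linear[OF assms(1)]
          has_weak_partial_bounded_linear[OF assms(2)]] assms(3) by blast
  qed
  moreover have "(\<lambda>x. T (f x) + T' (g x)) \<in> L2 S"
    using L2_add[OF L2_bounded_linear[OF sobolev_subset_L2[OF Suc.prems(1)] assms(1)]
        L2_bounded_linear[OF sobolev_subset_L2[OF Suc.prems(2)] assms(2)]] .
  ultimately show ?case by auto
qed

lemma sobolev_diff:
  "S \<in> sets lebesgue \<Longrightarrow> f \<in> sobolev k S \<Longrightarrow> g \<in> sobolev k S \<Longrightarrow> (\<lambda>x. f x - g x) \<in> sobolev k S"
  using sobolev_linear[OF bounded_linear_ident bounded_linear_minus[OF bounded_linear_ident], of S f k g]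
  by simp

lemma sobolev_Suc_weak_partial:
  assumes "f \<in> sobolev (Suc k) S" "b \<in> Basis" "open S"
  shows "weak_partial S b f \<in> sobolev k S" "has_weak_partial S b f (weak_partial S b f)"
proof -
  obtain g where g: "g \<in> sobolev k S" "has_weak_partial S b f g"
    using assms by auto
  show "has_weak_partial S b f (weak_partial S b f)"
    using weak_partial_works[OF g(2)] .
  have "AE x in lebesgue_on S. g x = weak_partial S b f x"
    using weak_partial_eq_AE[OF assms(3) g(2)] by eventually_elim simp
  then show "weak_partial S b f \<in> sobolev k S"
    using sobolev_AE[OF g(1)] assms(3) by simp
qed

text \<open>No induction: the weak derivatives of \<open>f\<close> and \<open>g\<close> are
  literally the same chosen functions.\<close>

lemma sobolev_norm_sq_cong_AE:
  assumes "AE x in lebesgue_on S. f x = g x" "S \<in> sets lebesgue"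
  shows "sobolev_norm_sq k S f = sobolev_norm_sq k S g"
proof -
  have "AE x in lebesgue_on S. (norm (f x))\<^sup>2 = (norm (g x))\<^sup>2"
    using assms(1) by eventually_elim simp
  from integral_lebesgue_on_cong_AE[OF this assms(2)] show ?thesis
    by (cases k) (simp_all add: weak_partial_cong_AE[OF assms])
qed

text \<open>A functional in the dual is additive and bounded, so its change from \<open>u0\<close>
  to \<open>u i\<close> is at most a constant times the norm of the difference.\<close>

lemma sobolev_weakly_convergesI:
  fixes u :: "'i \<Rightarrow> 'a::euclidean_space \<Rightarrow> 'b::euclidean_space"
  assumes "open S" "\<forall>\<^sub>F i in net. u i \<in> sobolev k S" "u0 \<in> sobolev k S"
    and lim: "((\<lambda>i. sobolev_norm_sq k S (\<lambda>x. u i x - u0 x)) \<longlongrightarrow> 0) net"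
  shows "sobolev_weakly_converges k S u u0 net"
  unfolding sobolev_weakly_converges_def
proof (intro conjI ballI assms(2,3))
  fix F :: "('a \<Rightarrow> 'b) \<Rightarrow> real" assume "F \<in> sobolev_dual k S"
  then obtain C where add: "\<And>f g. f \<in> sobolev k S \<Longrightarrow> g \<in> sobolev k S \<Longrightarrow> F (\<lambda>x. f x + g x) = F f + F g"
      and C: "\<And>f. f \<in> sobolev k S \<Longrightarrow> \<bar>F f\<bar> \<le> C * sobolev_norm k S f"
    unfolding sobolev_dual_def mem_Collect_eq by blast
  have "((\<lambda>i. F (u i) - F u0) \<longlongrightarrow> 0) net"
  proof (rule Lim_null_comparison)
    show "\<forall>\<^sub>F i in net. norm (F (u i) - F u0) \<le> C * sobolev_norm k S (\<lambda>x. u i x - u0 x)"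
      using assms(2)
    proof eventually_elim
      case (elim i)
      then have diff: "(\<lambda>x. u i x - u0 x) \<in> sobolev k S"
        using sobolev_diff[OF _ elim assms(3)] assms(1) by simp
      show ?case
        using add[OF diff assms(3)] C[OF diff] by simp
    qed
    have "((\<lambda>i. C * sqrt (sobolev_norm_sq k S (\<lambda>x. u i x - u0 x))) \<longlongrightarrow> C * sqrt 0) net"
      by (intro tendsto_intros lim)
    then show "((\<lambda>i. C * sobolev_norm k S (\<lambda>x. u i x - u0 x)) \<longlongrightarrow> 0) net"
      by (simp add: sobolev_norm_def)
  qed
  then show "((\<lambda>i. F (u i)) \<longlongrightarrow> F u0) net"
    using LIM_zero_iff by blast
qed

text \<open>The functionals with which the lower bound tests weak convergence. Linearity holds since
  weak derivatives are linear up to null sets; boundedness is Cauchy-Schwarz, as the norm contains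
  the derivative in question.\<close>

lemma sobolev_dual_weak_partial:
  fixes \<eta> :: "'a::euclidean_space \<Rightarrow> 'b::euclidean_space"
  assumes "open S" "b \<in> Basis" "\<eta> \<in> L2 S"
  shows "(\<lambda>f. LINT x|lebesgue_on S. \<eta> x \<bullet> weak_partial S b f x) \<in> sobolev_dual 1 S"
proof -
  have meas: "S \<in> sets lebesgue" using assms(1) by simp
  have D: "weak_partial S b f \<in> L2 S" "has_weak_partial S b f (weak_partial S b f)" if "f \<in> sobolev 1 S" for f :: "'a \<Rightarrow> 'b"
    using sobolev_Suc_weak_partial[of f 0 S b] that assms by auto
  have int: "integrable (lebesgue_on S) (\<lambda>x. \<eta> x \<bullet> weak_partial S b f x)" if "f \<in> sobolev 1 S" for f
    using integrable_inner_L2[OF assms(3) D(1)[OF that]] .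
  have "(LINT x|lebesgue_on S. \<eta> x \<bullet> weak_partial S b (\<lambda>x. f x + g x) x) =
      (LINT x|lebesgue_on S. \<eta> x \<bullet> weak_partial S b f x) + (LINT x|lebesgue_on S. \<eta> x \<bullet> weak_partial S b g x)"
    if "f \<in> sobolev 1 S" "g \<in> sobolev 1 S" for f g
  proof -
    have "AE x in lebesgue_on S. \<eta> x \<bullet> weak_partial S b (\<lambda>x. f x + g x) x =
        \<eta> x \<bullet> weak_partial S b f x + \<eta> x \<bullet> weak_partial S b g x"
      using weak_partial_eq_AE[OF assms(1) has_weak_partial_add[OF D(2)[OF that(1)] D(2)[OF that(2)] meas]]
      by eventually_elim (simp add: inner_add_right)
    then have "(LINT x|lebesgue_on S. \<eta> x \<bullet> weak_partial S b (\<lambda>x. f x + g x) x) =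
        (LINT x|lebesgue_on S. \<eta> x \<bullet> weak_partial S b f x + \<eta> x \<bullet> weak_partial S b g x)"
      by (rule integral_lebesgue_on_cong_AE[OF _ meas])
    then show ?thesis using int that by simp
  qed
  moreover have "(LINT x|lebesgue_on S. \<eta> x \<bullet> weak_partial S b (\<lambda>x. c *\<^sub>R f x) x) =
      c * (LINT x|lebesgue_on S. \<eta> x \<bullet> weak_partial S b f x)"
    if "f \<in> sobolev 1 S" for f c
  proof -
    have "AE x in lebesgue_on S. \<eta> x \<bullet> weak_partial S b (\<lambda>x. c *\<^sub>R f x) x = c * (\<eta> x \<bullet> weak_partial S b f x)"
      using weak_partial_eq_AE[OF assms(1)
          has_weak_partial_bounded_linear[OF bounded_linear_scaleR_right D(2)[OF that] meas, of c]]
      by eventually_elim simp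
    then have "(LINT x|lebesgue_on S. \<eta> x \<bullet> weak_partial S b (\<lambda>x. c *\<^sub>R f x) x) =
        (LINT x|lebesgue_on S. c * (\<eta> x \<bullet> weak_partial S b f x))"
      by (rule integral_lebesgue_on_cong_AE[OF _ meas])
    then show ?thesis by simp
  qed
  moreover have "\<bar>LINT x|lebesgue_on S. \<eta> x \<bullet> weak_partial S b f x\<bar> \<le>
      sqrt (LINT x|lebesgue_on S. (norm (\<eta> x))\<^sup>2) * sobolev_norm 1 S f" if "f \<in> sobolev 1 S" for f
  proof -
    have "sobolev_norm_sq 0 S (weak_partial S b f) \<le> sobolev_norm_sq 1 S f"
      using member_le_sum[OF assms(2), of "\<lambda>b. sobolev_norm_sq 0 S (weak_partial S b f)"]
      by (auto intro: add_increasing)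
    then have "sqrt (LINT x|lebesgue_on S. (norm (weak_partial S b f x))\<^sup>2) \<le> sobolev_norm 1 S f"
      by (simp add: sobolev_norm_def)
    then show ?thesis
      by (intro order_trans[OF Cauchy_Schwarz_L2[OF assms(3) D(1)[OF that]]] mult_left_mono) simp_all
  qed
  ultimately show ?thesis
    unfolding sobolev_dual_def mem_Collect_eq by blast
qed

section \<open>Reduction of the quadratic form\<close>

abbreviation sym_mat :: "real \<Rightarrow> real \<Rightarrow> real \<Rightarrow> real^2^2" where
  "sym_mat \<kappa> \<tau> \<gamma> \<equiv> vector [vector [\<kappa>, \<tau>], vector [\<tau>, \<gamma>]]"

text \<open>The coefficient \<open>c\<close> of \<open>\<gamma>^2\<close> is the value of
  \<open>Q2\<close> at the nonzero symmetric matrix \<open>E3\<close>, hence positive. The remaining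
  form is nonnegative because it is the value of \<open>Q2\<close> at the minimiser.\<close>

lemma quadratic_form_reduction:
  assumes "positive_definite_quadratic_form_on symmetric_matrices Q2"
  obtains A B D c p q where "c > 0"
    "\<And>\<kappa> \<tau> \<gamma>. Q2 (sym_mat \<kappa> \<tau> \<gamma>) = A * \<kappa>\<^sup>2 + B * \<tau>\<^sup>2 + D * (\<kappa> * \<tau>) + c * (\<gamma> - (p * \<kappa> + q * \<tau>))\<^sup>2"
    "\<And>\<kappa> \<tau>. Q1 Q2 \<kappa> \<tau> = A * \<kappa>\<^sup>2 + B * \<tau>\<^sup>2 + D * (\<kappa> * \<tau>)"
    "\<And>\<kappa> \<tau>. A * \<kappa>\<^sup>2 + B * \<tau>\<^sup>2 + D * (\<kappa> * \<tau>) \<ge> 0"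
proof -
  obtain F where F: "bilinear F" "\<And>X. X \<in> symmetric_matrices \<Longrightarrow> Q2 X = F X X"
      and pos: "\<And>X. X \<in> symmetric_matrices \<Longrightarrow> X \<noteq> 0 \<Longrightarrow> Q2 X > 0"
    using assms by (auto simp: positive_definite_quadratic_form_on_def)
  have sym: "sym_mat \<kappa> \<tau> \<gamma> \<in> symmetric_matrices" for \<kappa> \<tau> \<gamma>
    by (simp add: symmetric_matrices_def transpose_def vec_eq_iff forall_2)
  define E1 where "E1 = sym_mat 1 0 0"
  define E2 where "E2 = sym_mat 0 1 0"
  define E3 where "E3 = sym_mat 0 0 1"
  have decomp: "sym_mat \<kappa> \<tau> \<gamma> = \<kappa> *\<^sub>R E1 + \<tau> *\<^sub>R E2 + \<gamma> *\<^sub>R E3" for \<kappa> \<tau> \<gamma>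
    by (simp add: E1_def E2_def E3_def vec_eq_iff forall_2)
  define c where "c = F E3 E3"
  \<comment> \<open>The bilinear form \<open>F\<close> may be nonsymmetric, so each mixed
    coefficient collects both orders of the arguments.\<close>
  define e where "e = F E1 E3 + F E3 E1"
  define f where "f = F E2 E3 + F E3 E2"
  define d where "d = F E1 E2 + F E2 E1"
  have Q: "Q2 (sym_mat \<kappa> \<tau> \<gamma>) = F E1 E1 * \<kappa>\<^sup>2 + F E2 E2 * \<tau>\<^sup>2 + c * \<gamma>\<^sup>2 + d * (\<kappa> * \<tau>) + e * (\<kappa> * \<gamma>) + f * (\<tau> * \<gamma>)"
    for \<kappa> \<tau> \<gamma>
    unfolding trans[OF F(2)[OF sym] arg_cong2[where f=F, OF decomp decomp]] c_def d_def e_def f_def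
    by (simp add: bilinear_ladd[OF F(1)] bilinear_radd[OF F(1)] bilinear_lmul[OF F(1)]
        bilinear_rmul[OF F(1)] power2_eq_square algebra_simps)
  have "sym_mat 0 0 1 \<noteq> 0"
    by (metis vector_2(2) zero_index zero_neq_one)
  then have c: "c > 0" using pos[OF sym, of 0 0 1] Q[of 0 0 1] by simp
  \<comment> \<open>Completing the square in
    \<open>c * \<gamma>^2 + (e * \<kappa> + f * \<tau>) * \<gamma>\<close> puts the minimum at
    \<open>- (e * \<kappa> + f * \<tau>) / (2 * c)\<close> and subtracts
    \<open>(e * \<kappa> + f * \<tau>)^2 / (4 * c)\<close> from the other terms.\<close>
  define A where "A = F E1 E1 - e\<^sup>2 / (4 * c)"
  define B where "B = F E2 E2 - f\<^sup>2 / (4 * c)"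
  define D where "D = d - e * f / (2 * c)"
  define p where "p = - e / (2 * c)"
  define q where "q = - f / (2 * c)"
  have Q': "Q2 (sym_mat \<kappa> \<tau> \<gamma>) = A * \<kappa>\<^sup>2 + B * \<tau>\<^sup>2 + D * (\<kappa> * \<tau>) + c * (\<gamma> - (p * \<kappa> + q * \<tau>))\<^sup>2" for \<kappa> \<tau> \<gamma>
    unfolding Q A_def B_def D_def p_def q_def using c
    by (simp add: power2_eq_square field_simps)
  have Q0: "Q2 X \<ge> 0" if "X \<in> symmetric_matrices" for X
    using pos[OF that] F(2)[OF that] bilinear_lzero[OF F(1)] by (cases "X = 0") auto
  have Q1: "Q1 Q2 \<kappa> \<tau> = A * \<kappa>\<^sup>2 + B * \<tau>\<^sup>2 + D * (\<kappa> * \<tau>)" for \<kappa> \<tau>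
    unfolding Q1_def
  proof (rule Least_equality)
    show "\<exists>\<gamma>. A * \<kappa>\<^sup>2 + B * \<tau>\<^sup>2 + D * (\<kappa> * \<tau>) = Q2 (sym_mat \<kappa> \<tau> \<gamma>)"
      by (rule exI[of _ "p * \<kappa> + q * \<tau>"]) (simp add: Q')
  next
    fix y assume "\<exists>\<gamma>. y = Q2 (sym_mat \<kappa> \<tau> \<gamma>)"
    then show "A * \<kappa>\<^sup>2 + B * \<tau>\<^sup>2 + D * (\<kappa> * \<tau>) \<le> y"
      using c by (auto simp: Q')
  qed
  have "A * \<kappa>\<^sup>2 + B * \<tau>\<^sup>2 + D * (\<kappa> * \<tau>) \<ge> 0" for \<kappa> \<tau>
    using Q0[OF sym, of \<kappa> \<tau> "p * \<kappa> + q * \<tau>"] by (simp add: Q')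
  then show ?thesis using that c Q' Q1 by blast
qed

section \<open>Symmetry of second derivatives\<close>

lemma partial_derivatives:
  assumes "\<And>k. Ck k (\<phi> :: real \<times> real \<Rightarrow> real)"
  shows "((\<lambda>s. \<phi> (s, t)) has_real_derivative frechet_derivative \<phi> (at (s, t)) e1) (at s within A)"
    and "((\<lambda>t. \<phi> (s, t)) has_real_derivative frechet_derivative \<phi> (at (s, t)) e2) (at t within A)"
proof -
  have D: "(\<phi> has_derivative frechet_derivative \<phi> (at x)) (at x)" for x
    using Ck_has_derivative assms by blast
  interpret L: bounded_linear "frechet_derivative \<phi> (at x)" for x
    using D has_derivative_bounded_linear by blast
  have "((\<lambda>s. \<phi> (s, t)) has_derivative (\<lambda>h. frechet_derivative \<phi> (at (s, t)) (h, 0))) (at s within A)"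
    by (rule has_derivative_compose[OF has_derivative_Pair[OF has_derivative_ident has_derivative_const] D])
  moreover have "(\<lambda>h. frechet_derivative \<phi> (at (s, t)) (h, 0)) = (*) (frechet_derivative \<phi> (at (s, t)) e1)"
  proof
    fix h :: real
    have "(h, 0) = h *\<^sub>R e1" by simp
    then show "frechet_derivative \<phi> (at (s, t)) (h, 0) = frechet_derivative \<phi> (at (s, t)) e1 * h"
      using L.scaleR[of "(s, t)" h e1] by (simp only: real_scaleR_def mult.commute)
  qed
  ultimately show "((\<lambda>s. \<phi> (s, t)) has_real_derivative frechet_derivative \<phi> (at (s, t)) e1) (at s within A)"
    by (simp add: has_field_derivative_def)
  have "((\<lambda>t. \<phi> (s, t)) has_derivative (\<lambda>h. frechet_derivative \<phi> (at (s, t)) (0, h))) (at t within A)"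
    by (rule has_derivative_compose[OF has_derivative_Pair[OF has_derivative_const has_derivative_ident] D])
  moreover have "(\<lambda>h. frechet_derivative \<phi> (at (s, t)) (0, h)) = (*) (frechet_derivative \<phi> (at (s, t)) e2)"
  proof
    fix h :: real
    have "(0, h) = h *\<^sub>R e2" by simp
    then show "frechet_derivative \<phi> (at (s, t)) (0, h) = frechet_derivative \<phi> (at (s, t)) e2 * h"
      using L.scaleR[of "(s, t)" h e2] by (simp only: real_scaleR_def mult.commute)
  qed
  ultimately show "((\<lambda>t. \<phi> (s, t)) has_real_derivative frechet_derivative \<phi> (at (s, t)) e2) (at t within A)"
    by (simp add: has_field_derivative_def)
qed

lemma has_real_derivative_imp_frechet:
  "(f has_real_derivative f') (at x) \<Longrightarrow> frechet_derivative f (at x) 1 = f'"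
  using frechet_derivative_at[of f "(*) f'" x, symmetric] by (simp add: has_field_derivative_def)

text \<open>Proof by integration: \<open>\<phi>\<close> is recovered from its partial derivative
  along \<open>e2\<close> by the fundamental theorem; differentiation under the integral sign along
  \<open>e1\<close> brings in \<open>p12\<close>, and differentiating the integral in its upper
  limit gives \<open>p21 = p12\<close>.\<close>

lemma symmetric_second_derivative:
  assumes Ck: "\<And>k. Ck k (\<phi> :: real \<times> real \<Rightarrow> real)"
  shows "frechet_derivative (\<lambda>x. frechet_derivative \<phi> (at x) e1) (at x) e2 =
         frechet_derivative (\<lambda>x. frechet_derivative \<phi> (at x) e2) (at x) e1"
proof -
  define p1 where "p1 x = frechet_derivative \<phi> (at x) e1" for x
  define p2 where "p2 x = frechet_derivative \<phi> (at x) e2" for x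
  define p12 where "p12 x = frechet_derivative p2 (at x) e1" for x
  define p21 where "p21 x = frechet_derivative p1 (at x) e2" for x
  have C1: "Ck k p1" and C2: "Ck k p2" for k
    using Ck[of "Suc k"] by (auto simp: p1_def[abs_def] p2_def[abs_def])
  have C12: "Ck k p12" for k
    using C2[of "Suc k"] by (auto simp: p12_def[abs_def])
  have cont: "continuous_on A p2" "continuous_on A p12" for A
    using C2[of 0] C12[of 0] by (auto intro: continuous_on_subset)
  obtain s0 t0 where x: "x = (s0, t0)" by fastforce
  \<comment> \<open>A window with \<open>t0\<close> in its interior, so that the derivative within
    the window is the full derivative at \<open>t0\<close>.\<close>
  define a where "a = t0 - 1"
  define b where "b = t0 + 1"
  have eq: "\<phi> (s, t) = \<phi> (s, a) + integral {a..t} (\<lambda>\<tau>. p2 (s, \<tau>))" if "t \<in> {a..b}" for s t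
  proof -
    have "((\<lambda>\<tau>. p2 (s, \<tau>)) has_integral \<phi> (s, t) - \<phi> (s, a)) {a..t}"
      by (rule fundamental_theorem_of_calculus)
        (use that partial_derivatives(2)[OF Ck] in
          \<open>auto simp: p2_def has_real_derivative_iff_has_vector_derivative[symmetric]\<close>)
    then show ?thesis by (simp add: integral_unique)
  qed
  have p1_eq: "p1 (s0, t) = p1 (s0, a) + integral {a..t} (\<lambda>\<tau>. p12 (s0, \<tau>))" if t: "t \<in> {a..b}" for t
  proof -
    have "((\<lambda>s. integral (cbox a t) (\<lambda>\<tau>. p2 (s, \<tau>))) has_field_derivative
        integral (cbox a t) (\<lambda>\<tau>. p12 (s0, \<tau>))) (at s0 within UNIV)"
    proof (rule leibniz_rule_field_derivative)
      show "((\<lambda>s. p2 (s, \<tau>)) has_field_derivative p12 (s, \<tau>)) (at s within UNIV)" for s \<tau>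
        using partial_derivatives(1)[OF C2] by (simp add: p12_def)
      show "(\<lambda>\<tau>. p2 (s, \<tau>)) integrable_on cbox a t" for s
        by (intro integrable_continuous continuous_on_compose2[OF cont(1)] continuous_intros) auto
      show "continuous_on (UNIV \<times> cbox a t) (\<lambda>(s, \<tau>). p12 (s, \<tau>))"
        using cont(2) by simp
    qed auto
    then have "((\<lambda>s. \<phi> (s, a) + integral {a..t} (\<lambda>\<tau>. p2 (s, \<tau>))) has_real_derivative
        p1 (s0, a) + integral {a..t} (\<lambda>\<tau>. p12 (s0, \<tau>))) (at s0)"
      using DERIV_add[OF partial_derivatives(1)[OF Ck, of a s0 UNIV]] by (simp add: p1_def)
    then have "((\<lambda>s. \<phi> (s, t)) has_real_derivative
        p1 (s0, a) + integral {a..t} (\<lambda>\<tau>. p12 (s0, \<tau>))) (at s0)"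
      using eq[OF t] by simp
    then show ?thesis
      using DERIV_unique partial_derivatives(1)[OF Ck, of t s0 UNIV] by (auto simp: p1_def)
  qed
  have "((\<lambda>t. integral {a..t} (\<lambda>\<tau>. p12 (s0, \<tau>))) has_real_derivative p12 (s0, t0)) (at t0 within {a..b})"
    by (rule integral_has_real_derivative)
      (auto simp: a_def b_def intro!: continuous_on_compose2[OF cont(2)] continuous_intros)
  then have "((\<lambda>t. p1 (s0, a) + integral {a..t} (\<lambda>\<tau>. p12 (s0, \<tau>))) has_real_derivative p12 (s0, t0))
      (at t0 within {a..b})"
    by (auto intro!: derivative_eq_intros)
  then have "((\<lambda>t. p1 (s0, t)) has_real_derivative p12 (s0, t0)) (at t0 within {a..b})"
    by (rule has_field_derivative_transform_within[OF _ zero_less_one])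
      (simp add: a_def b_def, rule p1_eq[symmetric])
  moreover have "at t0 within {a..b} = at t0"
    by (rule at_within_interior) (auto simp: a_def b_def)
  ultimately have "((\<lambda>t. p1 (s0, t)) has_real_derivative p12 (s0, t0)) (at t0)" by simp
  moreover have "((\<lambda>t. p1 (s0, t)) has_real_derivative p21 (s0, t0)) (at t0)"
    using partial_derivatives(2)[OF C1] by (simp add: p21_def)
  ultimately show ?thesis
    using DERIV_unique by (auto simp: x p12_def p21_def p1_def[abs_def] p2_def[abs_def])
qed

text \<open>Both derivatives are moved onto the test function, where classical symmetry applies.
  Existence of the derivative of \<open>g1\<close> along \<open>e2\<close> is part of the
  conclusion. This is why the off-diagonal entries of \<open>scaled_hessian\<close> agree almost
  everywhere.\<close>

lemma has_weak_partial_swap: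
  fixes w :: "real \<times> real \<Rightarrow> 'b::euclidean_space"
  assumes "has_weak_partial S e1 w g1" "has_weak_partial S e2 w g2" "has_weak_partial S e1 g2 g12"
  shows "has_weak_partial S e2 g1 g12"
  unfolding has_weak_partial_def
proof (intro conjI ballI)
  fix \<phi> assume \<phi>: "\<phi> \<in> test_functions S"
  define d where "d v x = frechet_derivative \<phi> (at x) v" for v x
  have d: "d v \<in> test_functions S" for v
    using test_functions_frechet_derivative[OF \<phi>] by (simp add: d_def[abs_def])
  have "(LINT x|lebesgue_on S. d e2 x *\<^sub>R g1 x) = - (LINT x|lebesgue_on S. frechet_derivative (d e2) (at x) e1 *\<^sub>R w x)"
    using assms(1) d[of e2] by (simp add: has_weak_partial_def)
  also have "(\<lambda>x. frechet_derivative (d e2) (at x) e1 *\<^sub>R w x) = (\<lambda>x. frechet_derivative (d e1) (at x) e2 *\<^sub>R w x)"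
    using symmetric_second_derivative[OF test_functionsD(1)[OF \<phi>]] by (simp add: d_def[abs_def])
  also have "- (LINT x|lebesgue_on S. frechet_derivative (d e1) (at x) e2 *\<^sub>R w x) = (LINT x|lebesgue_on S. d e1 x *\<^sub>R g2 x)"
    using assms(2) d[of e1] by (simp add: has_weak_partial_def)
  also have "\<dots> = - (LINT x|lebesgue_on S. \<phi> x *\<^sub>R g12 x)"
    using assms(3) \<phi> by (simp add: has_weak_partial_def d_def)
  finally show "(LINT x|lebesgue_on S. frechet_derivative \<phi> (at x) e2 *\<^sub>R g1 x) =
      - (LINT x|lebesgue_on S. \<phi> x *\<^sub>R g12 x)"
    by (simp add: d_def)
qed (use assms in \<open>auto simp: has_weak_partial_def\<close>)

section \<open>Functions of product form on the strip\<close>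

abbreviation cross_section :: "real set" where
  "cross_section \<equiv> {- 1 / 2 <..< 1 / 2}"

lemma open_rod_interval: "open (rod_interval l)"
  by (simp add: rod_interval_def)

lemma open_rod_strip: "open (rod_strip l)"
  by (simp add: rod_strip_def open_Times open_rod_interval)

lemma lmeasurable_rod_interval: "rod_interval l \<in> lmeasurable"
  unfolding rod_interval_def box_real[symmetric] by (rule lmeasurable_box)

lemma rod_strip_eq_box: "rod_strip l = box (- l / 2, - 1 / 2) (l / 2, 1 / 2)"
  by (auto simp: rod_strip_def rod_interval_def mem_box Basis_prod_def)

lemma lmeasurable_rod_strip: "rod_strip l \<in> lmeasurable"
  unfolding rod_strip_eq_box by (rule lmeasurable_box)

lemma AE_lborel_fst:
  assumes "AE x in (lborel :: 'a::euclidean_space measure). P x"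
  shows "AE z in (lborel :: ('a \<times> 'b::euclidean_space) measure). P (fst z)"
proof -
  obtain N where N: "{x \<in> space (lborel :: 'a measure). \<not> P x} \<subseteq> N" "N \<in> null_sets (lborel :: 'a measure)"
    using AE_E[OF assms] null_setsI by metis
  have "N \<times> (UNIV :: 'b set) \<in> null_sets lborel"
    using lborel.times_in_null_sets1[OF N(2), of UNIV] by (simp add: lborel_prod)
  then show ?thesis
    by (rule AE_I') (use N(1) in auto)
qed

text \<open>Fubini on the strip. As \<open>f\<close> is only Lebesgue measurable, it is replaced by
  a Borel function \<open>g\<close> that agrees almost everywhere; the product theorem is applied to
  \<open>lborel\<close> and the result is carried back through the completion. Both orders of
  integration are recorded, because derivatives along \<open>e1\<close> and \<open>e2\<close> keep
  different variables fixed.\<close>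

lemma
  fixes c :: "real \<times> real \<Rightarrow> real" and f :: "real \<Rightarrow> real"
  assumes f: "integrable (lebesgue_on (rod_interval l)) f" and c: "continuous_on UNIV c"
    and C: "\<And>x. x \<in> rod_strip l \<Longrightarrow> \<bar>c x\<bar> \<le> C"
  shows integrable_strip: "integrable (lebesgue_on (rod_strip l)) (\<lambda>x. c x * f (fst x))"
    and integral_strip: "(LINT x|lebesgue_on (rod_strip l). c x * f (fst x)) =
      (LINT s|lebesgue_on (rod_interval l). (LINT t|lebesgue_on cross_section. c (s, t)) * f s)"
    and integral_strip': "(LINT x|lebesgue_on (rod_strip l). c x * f (fst x)) =
      (LINT t|lebesgue_on cross_section. LINT s|lebesgue_on (rod_interval l). c (s, t) * f s)"
proof -
  let ?I = "rod_interval l" and ?K = cross_section and ?S = "rod_strip l"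
  let ?L = "lebesgue_on ?I"
  let ?M = "lebesgue_on ?S"
  have [measurable]: "?I \<in> sets borel" "?K \<in> sets borel" "?S \<in> sets borel"
    using open_rod_interval open_rod_strip by (auto intro: borel_open)
  have [measurable]: "c \<in> borel_measurable borel"
    using c by (rule borel_measurable_continuous_onI)
  have "(\<lambda>x. if x \<in> ?I then f x else 0) \<in> borel_measurable lebesgue"
    using borel_measurable_integrable[OF f] by (subst borel_measurable_if) auto
  then obtain g where g[measurable]: "g \<in> borel_measurable lborel"
      and g_eq: "AE x in lborel. (if x \<in> ?I then f x else 0) = g x"
    using completion_ex_borel_measurable_real by blast
  have g_eq': "AE x in lebesgue_on UNIV. (if x \<in> ?I then f x else 0) = g x"
    using AE_completion[OF g_eq] by (simp only: lebesgue_on_UNIV_eq)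
  have "integrable lebesgue g"
    using integrable_lebesgue_on_cong_AE[OF g_eq'] f
      Lebesgue_Measure.integrable_restrict_UNIV[of ?I f] by (simp add: lebesgue_on_UNIV_eq)
  then have gi: "integrable lborel g"
    using integrable_completion[OF g] by simp
  define h where "h z = indicator ?S z * c z * g (fst z)" for z
  have h_meas[measurable]: "h \<in> borel_measurable (lborel \<Otimes>\<^sub>M lborel)"
  proof -
    have "(\<lambda>z. g (fst z)) \<in> borel_measurable (lborel \<Otimes>\<^sub>M (lborel :: real measure))"
      by measurable
    moreover have "(\<lambda>z. indicator ?S z * c z) \<in> borel_measurable (lborel \<Otimes>\<^sub>M (lborel :: real measure))"
      unfolding lborel_prod by measurable
    ultimately show ?thesis unfolding h_def by (rule borel_measurable_times[rotated])
  qed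
  have ind: "indicator ?S z = (indicator ?I (fst z) * indicator ?K (snd z) :: real)" for z
    by (cases z) (auto simp: rod_strip_def indicator_def)
  \<comment> \<open>An integrable majorant of \<open>h\<close>, with separated variables.\<close>
  have prod: "integrable (lborel \<Otimes>\<^sub>M lborel) (\<lambda>z. C * g (fst z) * indicator ?K (snd z))"
  proof (rule lborel_pair.Fubini_integrable)
    have "integrable lborel (\<lambda>x. \<bar>C\<bar> * \<bar>g x\<bar> * measure lborel ?K)"
      using gi by simp
    then show "integrable lborel (\<lambda>x. \<integral>y. norm (C * g (fst (x, y)) * indicator ?K (snd (x, y))) \<partial>lborel)"
      by (simp add: abs_mult)
    show "AE x in lborel. integrable lborel (\<lambda>y. C * g (fst (x, y)) * indicator ?K (snd (x, y)))"
      by (intro AE_I2) simp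
  qed measurable
  have hi: "integrable (lborel \<Otimes>\<^sub>M lborel) h"
  proof (rule Bochner_Integration.integrable_bound[OF prod])
    have "norm (h z) \<le> norm (C * g (fst z) * indicator ?K (snd z))" for z
      using C[of z] by (auto simp: h_def ind abs_mult indicator_def rod_strip_def mem_Times_iff intro!: mult_right_mono)
    then show "AE z in lborel \<Otimes>\<^sub>M lborel. norm (h z) \<le> norm (C * g (fst z) * indicator ?K (snd z))"
      by simp
  qed measurable
  have hb: "h \<in> borel_measurable lborel" "integrable lborel h"
    using h_meas hi by (simp_all add: lborel_prod)
  have "AE z in lborel. (if z \<in> ?S then c z * f (fst z) else 0) = h z"
    using AE_lborel_fst[OF g_eq] by eventually_elim (auto simp: h_def rod_strip_def indicator_def)
  then have h_eq: "AE z in lebesgue_on UNIV. (if z \<in> ?S then c z * f (fst z) else 0) = h z"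
    using AE_completion by (simp only: lebesgue_on_UNIV_eq)
  have "integrable lebesgue h"
    using integrable_completion[OF hb(1)] hb(2) by simp
  then have "integrable lebesgue (\<lambda>z. if z \<in> ?S then c z * f (fst z) else 0)"
    using integrable_lebesgue_on_cong_AE[OF h_eq] by (simp add: lebesgue_on_UNIV_eq)
  then show "integrable ?M (\<lambda>x. c x * f (fst x))"
    by (subst (asm) Lebesgue_Measure.integrable_restrict_UNIV) auto
  have "(LINT x|?M. c x * f (fst x)) = (LINT z|lebesgue. (if z \<in> ?S then c z * f (fst z) else 0))"
    by (rule Lebesgue_Measure.integral_restrict_UNIV[symmetric]) simp
  also have "\<dots> = integral\<^sup>L lebesgue h"
    using integral_lebesgue_on_cong_AE[OF h_eq] by (simp add: lebesgue_on_UNIV_eq)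
  also have "\<dots> = integral\<^sup>L lborel h"
    by (rule integral_completion[OF hb(1)])
  finally have main: "(LINT x|?M. c x * f (fst x)) = integral\<^sup>L (lborel \<Otimes>\<^sub>M lborel) h"
    by (simp add: lborel_prod)
  have restr: "(LINT x|lborel. indicator A x * u x) = (LINT x|lebesgue_on A. u x)"
    if "A \<in> sets borel" "u \<in> borel_measurable borel" for A and u :: "real \<Rightarrow> real"
    using that by (simp add: integral_restrict_space integral_completion[symmetric])
  have rg: "(LINT s|lborel. u s * indicator ?I s * g s) = (LINT s|?L. u s * f s)"
    if "u \<in> borel_measurable borel" for u
  proof -
    have "AE x in lebesgue_on UNIV. (if x \<in> ?I then u x * f x else 0) = u x * indicator ?I x * g x"
      using g_eq' by eventually_elim (auto simp: indicator_def)
    then have "(LINT s|lebesgue. (if s \<in> ?I then u s * f s else 0)) = (LINT s|lebesgue. u s * indicator ?I s * g s)"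
      using integral_lebesgue_on_cong_AE by (fastforce simp: lebesgue_on_UNIV_eq)
    moreover have "(LINT s|lebesgue. (if s \<in> ?I then u s * f s else 0)) = (LINT s|?L. u s * f s)"
      by (rule Lebesgue_Measure.integral_restrict_UNIV) simp
    moreover have "(LINT s|lebesgue. u s * indicator ?I s * g s) = (LINT s|lborel. u s * indicator ?I s * g s)"
      by (rule integral_completion) (use that in measurable)
    ultimately show ?thesis by simp
  qed
  have cs: "(\<lambda>t. c (s, t)) \<in> borel_measurable borel" "(\<lambda>s. c (s, t)) \<in> borel_measurable borel" for s t
    by measurable
  have "integral\<^sup>L (lborel \<Otimes>\<^sub>M lborel) h = (LINT s|lborel. LINT t|lborel. h (s, t))"
    by (rule lborel_pair.integral_fst'[OF hi, symmetric])
  also have "(\<lambda>s. LINT t|lborel. h (s, t)) =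
      (\<lambda>s. (LINT t|lborel. indicator ?K t * c (s, t)) * indicator ?I s * g s)"
  proof
    fix s
    have "(LINT t|lborel. h (s, t)) = (LINT t|lborel. (indicator ?I s * g s) * (indicator ?K t * c (s, t)))"
      by (rule Bochner_Integration.integral_cong) (auto simp: h_def ind)
    then show "(LINT t|lborel. h (s, t)) = (LINT t|lborel. indicator ?K t * c (s, t)) * indicator ?I s * g s"
      by simp
  qed
  also have "integral\<^sup>L lborel \<dots> = (LINT s|?L. (LINT t|lborel. indicator ?K t * c (s, t)) * f s)"
    by (rule rg) measurable
  finally show "(LINT x|?M. c x * f (fst x)) =
      (LINT s|?L. (LINT t|lebesgue_on ?K. c (s, t)) * f s)"
    using main restr[OF _ cs(1), of ?K] by simp
  have "integral\<^sup>L (lborel \<Otimes>\<^sub>M lborel) h = (LINT t|lborel. LINT s|lborel. h (s, t))"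
    using lborel_pair.integral_snd[of "\<lambda>s t. h (s, t)"] hi by simp
  also have "(\<lambda>t. LINT s|lborel. h (s, t)) =
      (\<lambda>t. indicator ?K t * (LINT s|lborel. c (s, t) * indicator ?I s * g s))"
  proof
    fix t
    have "(LINT s|lborel. h (s, t)) = (LINT s|lborel. indicator ?K t * (c (s, t) * indicator ?I s * g s))"
      by (rule Bochner_Integration.integral_cong) (auto simp: h_def ind)
    then show "(LINT s|lborel. h (s, t)) = indicator ?K t * (LINT s|lborel. c (s, t) * indicator ?I s * g s)"
      by simp
  qed
  also have "integral\<^sup>L lborel \<dots> = (LINT t|lebesgue_on ?K. LINT s|lborel. c (s, t) * indicator ?I s * g s)"
    by (rule restr) measurable
  finally show "(LINT x|?M. c x * f (fst x)) =
      (LINT t|lebesgue_on ?K. LINT s|?L. c (s, t) * f s)"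
    using main rg[OF cs(2)] by simp
qed

section \<open>Slices of test functions and weak derivatives of products\<close>

lemma test_function_slice:
  assumes "\<phi> \<in> test_functions (A \<times> B)"
  shows "t \<in> B \<Longrightarrow> (\<lambda>s. \<phi> (s, t)) \<in> test_functions A"
    and "s \<in> A \<Longrightarrow> (\<lambda>t. \<phi> (s, t)) \<in> test_functions B"
proof -
  have bl: "bounded_linear (\<lambda>s. (s, 0))" "bounded_linear (\<lambda>t. (0, t))"
    by (intro bounded_linear_intros)+
  have Ck: "Ck k (\<lambda>s. \<phi> (s, t))" "Ck k (\<lambda>t. \<phi> (s, t))" for k s t
    using Ck_affine[OF test_functionsD(1)[OF assms] bl(1), of k "(0, t)"]
      Ck_affine[OF test_functionsD(1)[OF assms] bl(2), of k "(s, 0)"] by simp_all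
  let ?K = "closure {x. \<phi> x \<noteq> 0}"
  show "(\<lambda>s. \<phi> (s, t)) \<in> test_functions A" if "t \<in> B"
  proof (rule test_functionsI[OF Ck(1)])
    show "compact (fst ` ?K)"
      by (intro compact_continuous_image continuous_intros test_functionsD(2)[OF assms])
    show "fst ` ?K \<subseteq> A" using test_functionsD(3)[OF assms] by auto
    show "s \<in> fst ` ?K" if "\<phi> (s, t) \<noteq> 0" for s
      using test_function_support[of \<phi> "(s, t)"] that by (metis fst_conv image_eqI)
  qed
  show "(\<lambda>t. \<phi> (s, t)) \<in> test_functions B" if "s \<in> A"
  proof (rule test_functionsI[OF Ck(2)])
    show "compact (snd ` ?K)"
      by (intro compact_continuous_image continuous_intros test_functionsD(2)[OF assms])
    show "snd ` ?K \<subseteq> B" using test_functionsD(3)[OF assms] by auto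
    show "t \<in> snd ` ?K" if "\<phi> (s, t) \<noteq> 0" for t
      using test_function_support[of \<phi> "(s, t)"] that by (metis snd_conv image_eqI)
  qed
qed

lemma test_function_bounded:
  assumes "\<phi> \<in> test_functions S" obtains C where "\<And>x. \<bar>\<phi> x\<bar> \<le> C"
proof -
  let ?K = "closure {x. \<phi> x \<noteq> 0}"
  have "bounded (\<phi> ` ?K)"
    using test_functionsD(1)[OF assms, of 0] test_functionsD(2)[OF assms]
    by (intro compact_imp_bounded compact_continuous_image) (auto intro: continuous_on_subset)
  then obtain C where C: "\<And>x. x \<in> ?K \<Longrightarrow> \<bar>\<phi> x\<bar> \<le> C"
    by (auto simp: bounded_iff)
  have "\<bar>\<phi> x\<bar> \<le> \<bar>C\<bar>" for x
    using C[of x] test_function_support[of \<phi> x] by (cases "\<phi> x = 0") auto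
  then show ?thesis using that by blast
qed

lemma continuous_bounded_cross_section:
  fixes q :: "real \<Rightarrow> real"
  assumes "continuous_on UNIV q"
  obtains C where "C \<ge> 0" "\<And>t. t \<in> cross_section \<Longrightarrow> \<bar>q t\<bar> \<le> C"
proof -
  have "bounded (q ` {- 1 / 2..1 / 2})"
    using assms by (intro compact_imp_bounded compact_continuous_image) (auto intro: continuous_on_subset)
  then obtain C where C: "\<forall>y\<in>q ` {- 1 / 2..1 / 2}. norm y \<le> C"
    using bounded_iff by blast
  have "\<bar>q t\<bar> \<le> \<bar>C\<bar>" if "t \<in> cross_section" for t
  proof -
    have "norm (q t) \<le> C"
      using C that by (intro C[rule_format] imageI) auto
    then show ?thesis by simp
  qed
  then show ?thesis using that[of "\<bar>C\<bar>"] by simp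
qed

lemma Ck_has_real_derivative:
  fixes \<phi> :: "real \<Rightarrow> real"
  assumes "Ck (Suc k) \<phi>"
  shows "(\<phi> has_real_derivative frechet_derivative \<phi> (at x) 1) (at x)"
proof -
  have D: "(\<phi> has_derivative frechet_derivative \<phi> (at x)) (at x)"
    using Ck_has_derivative[OF assms] .
  interpret bounded_linear "frechet_derivative \<phi> (at x)"
    using has_derivative_bounded_linear[OF D] .
  have "frechet_derivative \<phi> (at x) h = frechet_derivative \<phi> (at x) 1 * h" for h
    using scaleR[of h 1] by (simp add: mult.commute)
  then have "frechet_derivative \<phi> (at x) = (*) (frechet_derivative \<phi> (at x) 1)"
    by (rule ext)
  then show ?thesis using D by (metis has_field_derivative_def)
qed

text \<open>Provides the continuity and the bound of the weight that the Fubini lemmas on the strip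
  require.\<close>

lemma test_function_times_bounded:
  fixes q :: "real \<Rightarrow> real"
  assumes \<psi>: "\<psi> \<in> test_functions (rod_strip l)" and q: "continuous_on UNIV q"
  obtains B where "continuous_on UNIV (\<lambda>x. \<psi> x * q (snd x))"
    "\<And>x. x \<in> rod_strip l \<Longrightarrow> \<bar>\<psi> x * q (snd x)\<bar> \<le> B"
proof -
  obtain C where C: "C \<ge> 0" "\<And>t. t \<in> cross_section \<Longrightarrow> \<bar>q t\<bar> \<le> C"
    using continuous_bounded_cross_section[OF q] by blast
  obtain C' where C': "\<And>x. \<bar>\<psi> x\<bar> \<le> C'"
    using test_function_bounded[OF \<psi>] by blast
  have cont: "continuous_on UNIV (\<lambda>x. \<psi> x * q (snd x))"
    using test_functionsD(1)[OF \<psi>, of 0]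
    by (auto intro!: continuous_intros continuous_on_compose2[OF q])
  have "\<bar>\<psi> x * q (snd x)\<bar> \<le> C' * C" if "x \<in> rod_strip l" for x
    unfolding abs_mult by (rule mult_mono) (use C C' that in \<open>auto simp: rod_strip_def intro: order_trans[OF abs_ge_zero]\<close>)
  then show ?thesis using that cont by blast
qed

text \<open>Integration by parts; the boundary terms vanish because a test function is
  \<open>0\<close> at both ends.\<close>

lemma has_weak_partial_C1:
  fixes u u' :: "real \<Rightarrow> real"
  assumes u: "\<And>x. (u has_real_derivative u' x) (at x)" and u': "continuous_on UNIV u'"
  shows "has_weak_partial {a<..<b} 1 u u'"
proof -
  have cont_u: "continuous_on UNIV u"
    using u by (intro continuous_at_imp_continuous_on ballI DERIV_isCont) auto
  have li: "locally_integrable {a<..<b} v" if "continuous_on UNIV v" for v :: "real \<Rightarrow> real"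
    by (intro integrable_imp_locally_integrable
        integrable_lebesgue_on_subset[OF continuous_imp_integrable_real[of a b]] continuous_on_subset[OF that])
      auto
  have "(LINT x|lebesgue_on {a<..<b}. frechet_derivative \<phi> (at x) 1 *\<^sub>R u x) =
      - (LINT x|lebesgue_on {a<..<b}. \<phi> x *\<^sub>R u' x)" if \<phi>: "\<phi> \<in> test_functions {a<..<b}" for \<phi>
  proof (cases "a < b")
    case True
    define d where "d x = frechet_derivative \<phi> (at x) 1" for x
    have d: "d \<in> test_functions {a<..<b}"
      using test_functions_frechet_derivative[OF \<phi>] by (simp add: d_def[abs_def])
    have der: "(\<phi> has_real_derivative d x) (at x)" for x
      unfolding d_def by (rule Ck_has_real_derivative[OF test_functionsD(1)[OF \<phi>]])
    have int: "integrable (lebesgue_on {a<..<b}) (\<lambda>x. d x * u x)" "integrable (lebesgue_on {a<..<b}) (\<lambda>x. \<phi> x * u' x)"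
      using integrable_test_function_scaleR[OF d li[OF cont_u]]
        integrable_test_function_scaleR[OF \<phi> li[OF u']] by simp_all
    have "((\<lambda>x. d x * u x + \<phi> x * u' x) has_integral \<phi> b * u b - \<phi> a * u a) {a..b}"
      by (rule fundamental_theorem_of_calculus)
        (use True der u in \<open>auto simp: has_real_derivative_iff_has_vector_derivative[symmetric]
          intro!: derivative_eq_intros DERIV_subset[OF der] DERIV_subset[OF u]\<close>)
    moreover have "\<phi> a = 0" "\<phi> b = 0"
      using test_function_eq_0[OF \<phi>] by auto
    ultimately have "((\<lambda>x. d x * u x + \<phi> x * u' x) has_integral 0) {a<..<b}"
      using has_integral_open_interval[of "\<lambda>x. d x * u x + \<phi> x * u' x" 0 a b] by simp
    moreover have "((\<lambda>x. d x * u x + \<phi> x * u' x) has_integral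
        (LINT x|lebesgue_on {a<..<b}. d x * u x + \<phi> x * u' x)) {a<..<b}"
      by (rule has_integral_integral_lebesgue_on) (use int in auto)
    ultimately have "(LINT x|lebesgue_on {a<..<b}. d x * u x + \<phi> x * u' x) = 0"
      using has_integral_unique by blast
    then show ?thesis using int by (simp add: d_def)
  qed simp
  then show ?thesis using li cont_u u' by (simp add: has_weak_partial_def)
qed

lemma locally_integrable_strip:
  fixes q f :: "real \<Rightarrow> real"
  assumes "integrable (lebesgue_on (rod_interval l)) f" "continuous_on UNIV q"
  shows "locally_integrable (rod_strip l) (\<lambda>x. q (snd x) * f (fst x))"
proof -
  obtain C where C: "\<And>t. t \<in> cross_section \<Longrightarrow> \<bar>q t\<bar> \<le> C"
    using continuous_bounded_cross_section[OF assms(2)] by blast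
  have "integrable (lebesgue_on (rod_strip l)) (\<lambda>x. q (snd x) * f (fst x))"
    by (rule integrable_strip[OF assms(1), where C=C])
      (use C in \<open>auto simp: rod_strip_def intro!: continuous_on_compose2[OF assms(2)] continuous_intros\<close>)
  then show ?thesis
    by (rule integrable_imp_locally_integrable) (simp add: open_rod_strip borel_open)
qed

text \<open>For fixed \<open>t\<close> the slice of \<open>\<phi>\<close> is a test function on the
  interval, so the weak derivative of \<open>f\<close> applies inside the outer integral over the
  cross section.\<close>

lemma has_weak_partial_strip_e1:
  fixes q f f' :: "real \<Rightarrow> real"
  assumes f: "integrable (lebesgue_on (rod_interval l)) f" and f': "integrable (lebesgue_on (rod_interval l)) f'"
    and wp: "has_weak_partial (rod_interval l) 1 f f'" and q: "continuous_on UNIV q"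
  shows "has_weak_partial (rod_strip l) e1 (\<lambda>x. q (snd x) * f (fst x)) (\<lambda>x. q (snd x) * f' (fst x))"
  unfolding has_weak_partial_def
proof (intro conjI ballI locally_integrable_strip f f' q)
  let ?I = "rod_interval l"
  let ?S = "rod_strip l"
  let ?L = "lebesgue_on ?I"
  fix \<phi> assume \<phi>: "\<phi> \<in> test_functions ?S"
  define d where "d x = frechet_derivative \<phi> (at x) e1" for x
  have d: "d \<in> test_functions ?S"
    using test_functions_frechet_derivative[OF \<phi>] by (simp add: d_def[abs_def])
  have eq: "(LINT x|lebesgue_on ?S. (\<psi> x * q (snd x)) * h (fst x)) =
      (LINT t|lebesgue_on cross_section. q t * (LINT s|?L. \<psi> (s, t) * h s))"
    if \<psi>: "\<psi> \<in> test_functions ?S" and h: "integrable ?L h" for \<psi> h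
  proof -
    obtain B where cont: "continuous_on UNIV (\<lambda>x. \<psi> x * q (snd x))"
        and bound: "\<And>x. x \<in> ?S \<Longrightarrow> \<bar>\<psi> x * q (snd x)\<bar> \<le> B"
      using test_function_times_bounded[OF \<psi> q] by metis
    show ?thesis
      by (rule trans[OF integral_strip'[OF h cont bound]]) (simp_all add: mult.assoc mult.left_commute)
  qed
  have "(LINT s|?L. d (s, t) * f s) = - (LINT s|?L. \<phi> (s, t) * f' s)"
    if t: "t \<in> cross_section" for t
  proof -
    have "(LINT s|?L. frechet_derivative (\<lambda>s. \<phi> (s, t)) (at s) 1 *\<^sub>R f s) =
        - (LINT s|?L. \<phi> (s, t) *\<^sub>R f' s)"
      using wp test_function_slice(1)[OF \<phi>[unfolded rod_strip_def] t]
      unfolding has_weak_partial_def by blast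
    then show ?thesis
      by (simp add: d_def has_real_derivative_imp_frechet[OF partial_derivatives(1)[OF test_functionsD(1)[OF \<phi>]]])
  qed
  then have "(LINT t|lebesgue_on cross_section. q t * (LINT s|?L. d (s, t) * f s)) =
      (LINT t|lebesgue_on cross_section. - (q t * (LINT s|?L. \<phi> (s, t) * f' s)))"
    by (intro Bochner_Integration.integral_cong) auto
  then show "(LINT x|lebesgue_on ?S. frechet_derivative \<phi> (at x) e1 *\<^sub>R (q (snd x) * f (fst x))) =
      - (LINT x|lebesgue_on ?S. \<phi> x *\<^sub>R (q (snd x) * f' (fst x)))"
    using eq[OF d f] eq[OF \<phi> f'] by (simp add: d_def mult.assoc)
qed

text \<open>Here \<open>s\<close> is fixed and the slice lives on the cross section: the integration
  by parts concerns \<open>q\<close>, and \<open>f\<close> is a mere factor under the outer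
  integral.\<close>

lemma has_weak_partial_strip_e2:
  fixes q q' f :: "real \<Rightarrow> real"
  assumes f: "integrable (lebesgue_on (rod_interval l)) f"
    and q: "\<And>t. (q has_real_derivative q' t) (at t)" and q': "continuous_on UNIV q'"
  shows "has_weak_partial (rod_strip l) e2 (\<lambda>x. q (snd x) * f (fst x)) (\<lambda>x. q' (snd x) * f (fst x))"
  unfolding has_weak_partial_def
proof (intro conjI ballI locally_integrable_strip f q')
  let ?S = "rod_strip l"
  show cq: "continuous_on UNIV q"
    using q by (intro continuous_at_imp_continuous_on ballI DERIV_isCont) auto
  fix \<phi> assume \<phi>: "\<phi> \<in> test_functions ?S"
  define d where "d x = frechet_derivative \<phi> (at x) e2" for x
  have d: "d \<in> test_functions ?S"
    using test_functions_frechet_derivative[OF \<phi>] by (simp add: d_def[abs_def])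
  have eq: "(LINT x|lebesgue_on ?S. (\<psi> x * h (snd x)) * f (fst x)) =
      (LINT s|lebesgue_on (rod_interval l). (LINT t|lebesgue_on cross_section. \<psi> (s, t) * h t) * f s)"
    if \<psi>: "\<psi> \<in> test_functions ?S" and h: "continuous_on UNIV h" for \<psi> h
  proof -
    obtain B where cont: "continuous_on UNIV (\<lambda>x. \<psi> x * h (snd x))"
        and bound: "\<And>x. x \<in> ?S \<Longrightarrow> \<bar>\<psi> x * h (snd x)\<bar> \<le> B"
      using test_function_times_bounded[OF \<psi> h] by metis
    show ?thesis
      by (rule trans[OF integral_strip[OF f cont bound]]) simp_all
  qed
  have "(LINT t|lebesgue_on cross_section. d (s, t) * q t) = - (LINT t|lebesgue_on cross_section. \<phi> (s, t) * q' t)"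
    if s: "s \<in> rod_interval l" for s
  proof -
    have "(LINT t|lebesgue_on cross_section. frechet_derivative (\<lambda>t. \<phi> (s, t)) (at t) 1 *\<^sub>R q t) =
        - (LINT t|lebesgue_on cross_section. \<phi> (s, t) *\<^sub>R q' t)"
      using has_weak_partial_C1[OF q q', of "- 1 / 2" "1 / 2"]
        test_function_slice(2)[OF \<phi>[unfolded rod_strip_def] s]
      unfolding has_weak_partial_def by blast
    then show ?thesis
      by (simp add: d_def has_real_derivative_imp_frechet[OF partial_derivatives(2)[OF test_functionsD(1)[OF \<phi>]]])
  qed
  then have "(LINT s|lebesgue_on (rod_interval l). (LINT t|lebesgue_on cross_section. d (s, t) * q t) * f s) =
      (LINT s|lebesgue_on (rod_interval l). - ((LINT t|lebesgue_on cross_section. \<phi> (s, t) * q' t) * f s))"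
    by (intro Bochner_Integration.integral_cong) auto
  then show "(LINT x|lebesgue_on ?S. frechet_derivative \<phi> (at x) e2 *\<^sub>R (q (snd x) * f (fst x))) =
      - (LINT x|lebesgue_on ?S. \<phi> x *\<^sub>R (q' (snd x) * f (fst x)))"
    using eq[OF d cq] eq[OF \<phi> q'] by (simp add: d_def mult.assoc)
qed

section \<open>The ansatz\<close>

text \<open>The polynomials \<open>t\<close> and \<open>t\<^sup>2 / 2 - 1 / 24\<close> have mean zero over the cross section, so the mean of
  an ansatz is that of \<open>f\<close>; the family is stable under both partial derivatives.\<close>

definition ansatz :: "(real \<Rightarrow> real) \<Rightarrow> (real \<Rightarrow> real) \<Rightarrow> (real \<Rightarrow> real) \<Rightarrow> real \<times> real \<Rightarrow> real" where
  "ansatz f g h x = f (fst x) + snd x * g (fst x) + ((snd x)\<^sup>2 / 2 - 1 / 24) * h (fst x)"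

lemma ansatz_diff: "ansatz f g h x - ansatz f' g' h' x =
    ansatz (\<lambda>t. f t - f' t) (\<lambda>t. g t - g' t) (\<lambda>t. h t - h' t) x"
  by (simp add: ansatz_def algebra_simps diff_divide_distrib)

lemma ansatz_simple: "ansatz f (\<lambda>_. 0) (\<lambda>_. 0) = (\<lambda>x. f (fst x))"
  by (simp add: ansatz_def fun_eq_iff)

lemma integrable_rod_interval_L2: "f \<in> L2 (rod_interval l) \<Longrightarrow> integrable (lebesgue_on (rod_interval l)) f"
  using integrable_L2 lmeasurable_rod_interval by blast

lemma sets_rod [simp]: "rod_interval l \<in> sets lebesgue" "rod_strip l \<in> sets lebesgue"
  using open_rod_interval open_rod_strip by auto

text \<open>The second moment of the cross section is \<open>1 / 12\<close>, so
  \<open>1 / 24\<close> is the mean of \<open>t\<^sup>2 / 2\<close>. Bounds by \<open>1\<close> keep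
  later estimates free of constants.\<close>

lemma cross_section_polynomials:
  shows "t \<in> cross_section \<Longrightarrow> \<bar>t\<bar> \<le> 1" "t \<in> cross_section \<Longrightarrow> \<bar>t\<^sup>2 / 2 - 1 / 24\<bar> \<le> (1::real)"
    and "(LINT t|lebesgue_on cross_section. (1::real)) = 1"
    and "(LINT t|lebesgue_on cross_section. t) = 0"
    and "(LINT t|lebesgue_on cross_section. t\<^sup>2 / 2 - 1 / 24) = 0"
proof -
  show "\<bar>t\<bar> \<le> 1" if "t \<in> cross_section"
    using that by auto
  show "\<bar>t\<^sup>2 / 2 - 1 / 24\<bar> \<le> 1" if "t \<in> cross_section"
  proof -
    have "\<bar>t\<bar> \<le> 1" using that by auto
    then have "t\<^sup>2 \<le> 1" by (simp add: abs_square_le_1)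
    moreover have "0 \<le> t\<^sup>2" by simp
    ultimately show ?thesis unfolding abs_le_iff by linarith
  qed
  show "(LINT t|lebesgue_on cross_section. (1::real)) = 1"
    by (simp add: measure_restrict_space)
  have *: "(LINT t|lebesgue_on cross_section. q t) = P (1 / 2) - P (- 1 / 2)"
    if "\<And>t. (P has_real_derivative q t) (at t)" "continuous_on UNIV q" for P q
  proof -
    have "(q has_integral P (1 / 2) - P (- 1 / 2)) {- 1 / 2..1 / 2}"
      by (rule fundamental_theorem_of_calculus)
        (use that(1) in \<open>auto simp: has_real_derivative_iff_has_vector_derivative[symmetric] intro: DERIV_subset\<close>)
    then have 1: "(q has_integral P (1 / 2) - P (- 1 / 2)) cross_section"
      using has_integral_open_interval[of q "P (1 / 2) - P (- 1 / 2)" "- 1 / 2" "1 / 2"] by simp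
    have "integrable (lebesgue_on cross_section) q"
      by (rule integrable_lebesgue_on_subset[OF continuous_imp_integrable_real[of "- 1 / 2" "1 / 2"]])
        (auto intro: continuous_on_subset[OF that(2)])
    then have "(q has_integral (LINT t|lebesgue_on cross_section. q t)) cross_section"
      by (rule has_integral_integral_lebesgue_on) simp
    from has_integral_unique[OF this 1] show ?thesis .
  qed
  show "(LINT t|lebesgue_on cross_section. t) = 0"
    by (subst *[of "\<lambda>t. t\<^sup>2 / 2"]) (auto intro!: derivative_eq_intros continuous_intros simp: power2_eq_square)
  show "(LINT t|lebesgue_on cross_section. t\<^sup>2 / 2 - 1 / 24) = 0"
    by (subst *[of "\<lambda>t. t ^ 3 / 6 - t / 24"])
      (auto intro!: derivative_eq_intros continuous_intros simp: power2_eq_square power3_eq_cube)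
qed

text \<open>The cross section has length \<open>1\<close>, so a factor bounded by \<open>1\<close>
  does not enlarge the L2 norm; the mean splits by Fubini.\<close>

lemma strip_product_L2:
  fixes q f :: "real \<Rightarrow> real"
  assumes f: "f \<in> L2 (rod_interval l)" and q: "continuous_on UNIV q"
    and q1: "\<And>t. t \<in> cross_section \<Longrightarrow> \<bar>q t\<bar> \<le> 1"
  shows "(\<lambda>x. q (snd x) * f (fst x)) \<in> L2 (rod_strip l)"
    and "(LINT x|lebesgue_on (rod_strip l). (q (snd x) * f (fst x))\<^sup>2) \<le> (LINT t|lebesgue_on (rod_interval l). (f t)\<^sup>2)"
    and "(LINT x|lebesgue_on (rod_strip l). q (snd x) * f (fst x)) =
      (LINT t|lebesgue_on cross_section. q t) * (LINT t|lebesgue_on (rod_interval l). f t)"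
proof -
  let ?I = "rod_interval l"
  let ?S = "rod_strip l"
  let ?L = "lebesgue_on ?I"
  let ?M = "lebesgue_on ?S"
  have q': "continuous_on UNIV (\<lambda>x::real \<times> real. q (snd x))"
    by (auto intro!: continuous_on_compose2[OF q] continuous_intros)
  have q2: "continuous_on UNIV (\<lambda>x::real \<times> real. (q (snd x))\<^sup>2)"
    by (intro continuous_intros q')
  have b: "\<bar>q (snd x)\<bar> \<le> 1" "\<bar>(q (snd x))\<^sup>2\<bar> \<le> 1" if "x \<in> ?S" for x
    using q1[of "snd x"] that by (auto simp: rod_strip_def abs_square_le_1 simp flip: power_abs)
  have int: "integrable ?L f"
    using f by (rule integrable_rod_interval_L2)
  have int2: "integrable ?L (\<lambda>t. (f t)\<^sup>2)"
    using L2_D(2)[OF f] by simp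
  have int2': "integrable ?M (\<lambda>x. (q (snd x))\<^sup>2 * (f (fst x))\<^sup>2)"
    by (rule integrable_strip[OF int2 q2 b(2)])
  show "(\<lambda>x. q (snd x) * f (fst x)) \<in> L2 ?S"
    using borel_measurable_integrable[OF integrable_strip[OF int q' b(1)]] int2'
    by (simp add: L2_def power_mult_distrib)
  have "(LINT x|?M. (q (snd x))\<^sup>2 * (f (fst x))\<^sup>2) \<le>
      (LINT x|?M. 1 * (f (fst x))\<^sup>2)"
    by (intro integral_mono int2' integrable_strip[OF int2, of _ 1] mult_right_mono) (use b(2) in auto)
  also have "\<dots> = (LINT t|?L. (f t)\<^sup>2)"
    using integral_strip[OF int2, of "\<lambda>_. 1" 1] cross_section_polynomials(3) by simp
  finally show "(LINT x|?M. (q (snd x) * f (fst x))\<^sup>2) \<le> (LINT t|?L. (f t)\<^sup>2)"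
    by (simp add: power_mult_distrib)
  show "(LINT x|?M. q (snd x) * f (fst x)) =
      (LINT t|lebesgue_on cross_section. q t) * (LINT t|?L. f t)"
    using integral_strip[OF int q' b(1)] by simp
qed

lemma
  assumes "f \<in> L2 (rod_interval l)" "g \<in> L2 (rod_interval l)" "h \<in> L2 (rod_interval l)"
  shows ansatz_L2: "ansatz f g h \<in> L2 (rod_strip l)"
    and ansatz_L2_bound: "(LINT x|lebesgue_on (rod_strip l). (ansatz f g h x)\<^sup>2) \<le>
      3 * ((LINT t|lebesgue_on (rod_interval l). (f t)\<^sup>2) + (LINT t|lebesgue_on (rod_interval l). (g t)\<^sup>2) +
        (LINT t|lebesgue_on (rod_interval l). (h t)\<^sup>2))"
    and integral_ansatz: "(LINT x|lebesgue_on (rod_strip l). ansatz f g h x) = (LINT t|lebesgue_on (rod_interval l). f t)"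
proof -
  let ?S = "rod_strip l"
  let ?M = "lebesgue_on ?S"
  have cont: "continuous_on UNIV (\<lambda>t::real. 1::real)" "continuous_on UNIV (\<lambda>t::real. t)"
      "continuous_on UNIV (\<lambda>t::real. t\<^sup>2 / 2 - 1 / 24)"
    by (intro continuous_intros; simp)+
  note P = strip_product_L2[OF assms(1) cont(1)] strip_product_L2[OF assms(2) cont(2) cross_section_polynomials(1)]
    strip_product_L2[OF assms(3) cont(3) cross_section_polynomials(2)]
  let ?F = "\<lambda>x::real \<times> real. 1 * f (fst x)" and ?G = "\<lambda>x. snd x * g (fst x)"
  let ?H = "\<lambda>x. ((snd x)\<^sup>2 / 2 - 1 / 24) * h (fst x)"
  have L: "?F \<in> L2 ?S" "?G \<in> L2 ?S" "?H \<in> L2 ?S"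
    using P by auto
  have eq: "ansatz f g h = (\<lambda>x. ?F x + ?G x + ?H x)"
    by (simp add: ansatz_def fun_eq_iff)
  show A: "ansatz f g h \<in> L2 ?S"
    unfolding eq by (intro L2_add L)
  have int: "integrable ?M ?F" "integrable ?M ?G"
      "integrable ?M ?H"
    using L integrable_L2[OF _ lmeasurable_rod_strip] by blast+
  have "(LINT x|?M. ansatz f g h x) =
      (LINT x|?M. ?F x) + (LINT x|?M. ?G x) + (LINT x|?M. ?H x)"
    unfolding eq using int by (simp only: Bochner_Integration.integral_add Bochner_Integration.integrable_add)
  then show "(LINT x|?M. ansatz f g h x) = (LINT t|lebesgue_on (rod_interval l). f t)"
    using P(3) P(6) P(9) cross_section_polynomials(3-5) by simp
  have int2: "integrable ?M (\<lambda>x. (?F x)\<^sup>2)" "integrable ?M (\<lambda>x. (?G x)\<^sup>2)"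
      "integrable ?M (\<lambda>x. (?H x)\<^sup>2)"
    using L2_D(2)[OF L(1)] L2_D(2)[OF L(2)] L2_D(2)[OF L(3)] by simp_all
  \<comment> \<open>The gap between the two sides is the sum of the squares of the three
    differences.\<close>
  have "(a + b + c)\<^sup>2 \<le> 3 * (a\<^sup>2 + b\<^sup>2 + c\<^sup>2)" for a b c :: real
    using zero_le_power2[of "a - b"] zero_le_power2[of "a - c"] zero_le_power2[of "b - c"]
    by (simp add: power2_eq_square algebra_simps)
  then have "(LINT x|?M. (ansatz f g h x)\<^sup>2) \<le>
      (LINT x|?M. 3 * ((?F x)\<^sup>2 + (?G x)\<^sup>2 + (?H x)\<^sup>2))"
    using L2_D(2)[OF A] int2 by (intro integral_mono) (auto simp: eq)
  also have "\<dots> = 3 * ((LINT x|?M. (?F x)\<^sup>2) + (LINT x|?M. (?G x)\<^sup>2) +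
      (LINT x|?M. (?H x)\<^sup>2))"
    using int2 by (simp only: Bochner_Integration.integral_add Bochner_Integration.integrable_add
        Bochner_Integration.integral_mult_right_zero)
  also have "\<dots> \<le> 3 * ((LINT t|lebesgue_on (rod_interval l). (f t)\<^sup>2) + (LINT t|lebesgue_on (rod_interval l). (g t)\<^sup>2) +
        (LINT t|lebesgue_on (rod_interval l). (h t)\<^sup>2))"
    by (intro mult_left_mono add_mono P(2) P(5) P(8)) auto
  finally show "(LINT x|?M. (ansatz f g h x)\<^sup>2) \<le> \<dots>" .
qed

lemma has_weak_partial_ansatz_e1:
  assumes L: "f \<in> L2 (rod_interval l)" "g \<in> L2 (rod_interval l)" "h \<in> L2 (rod_interval l)"
      "f' \<in> L2 (rod_interval l)" "g' \<in> L2 (rod_interval l)" "h' \<in> L2 (rod_interval l)"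
    and D: "has_weak_partial (rod_interval l) 1 f f'" "has_weak_partial (rod_interval l) 1 g g'"
      "has_weak_partial (rod_interval l) 1 h h'"
  shows "has_weak_partial (rod_strip l) e1 (ansatz f g h) (ansatz f' g' h')"
proof -
  have cont: "continuous_on UNIV (\<lambda>t::real. 1::real)" "continuous_on UNIV (\<lambda>t::real. t)"
      "continuous_on UNIV (\<lambda>t::real. t\<^sup>2 / 2 - 1 / 24)"
    by (intro continuous_intros; simp)+
  note I = L[THEN integrable_rod_interval_L2]
  show ?thesis
    using has_weak_partial_add[OF has_weak_partial_add[OF has_weak_partial_strip_e1[OF I(1,4) D(1) cont(1)]
          has_weak_partial_strip_e1[OF I(2,5) D(2) cont(2)]]
        has_weak_partial_strip_e1[OF I(3,6) D(3) cont(3)]]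
    by (simp add: ansatz_def[abs_def])
qed

text \<open>In the list \<open>1\<close>, \<open>t\<close>, \<open>t\<^sup>2 / 2 - 1 / 24\<close>
  each polynomial is the derivative of the next, so differentiation along \<open>e2\<close> shifts
  the coefficients by one place.\<close>

lemma has_weak_partial_ansatz_e2:
  assumes "f \<in> L2 (rod_interval l)" "g \<in> L2 (rod_interval l)" "h \<in> L2 (rod_interval l)"
  shows "has_weak_partial (rod_strip l) e2 (ansatz f g h) (ansatz g h (\<lambda>_. 0))"
proof -
  note I = assms[THEN integrable_rod_interval_L2]
  have "has_weak_partial (rod_strip l) e2 (\<lambda>x. 1 * f (fst x)) (\<lambda>x. 0 * f (fst x))"
    by (rule has_weak_partial_strip_e2[OF I(1)]) (auto intro!: derivative_eq_intros)
  moreover have "has_weak_partial (rod_strip l) e2 (\<lambda>x. snd x * g (fst x)) (\<lambda>x. 1 * g (fst x))"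
    by (rule has_weak_partial_strip_e2[OF I(2)]) (auto intro!: derivative_eq_intros)
  moreover have "has_weak_partial (rod_strip l) e2 (\<lambda>x. ((snd x)\<^sup>2 / 2 - 1 / 24) * h (fst x)) (\<lambda>x. snd x * h (fst x))"
    by (rule has_weak_partial_strip_e2[OF I(3), where q="\<lambda>t. t\<^sup>2 / 2 - 1 / 24" and q'="\<lambda>t. t"])
      (auto intro!: derivative_eq_intros continuous_intros)
  ultimately show ?thesis
    using has_weak_partial_add[OF has_weak_partial_add] by (fastforce simp: ansatz_def[abs_def])
qed

section \<open>The bending energy and the lower bound\<close>

lemma e1_in_Basis [simp]: "e1 \<in> Basis" and e2_in_Basis [simp]: "e2 \<in> Basis"
  by (auto simp: Basis_prod_def)

text \<open>A pair is the sum of two linear embeddings, so the linear rules suffice.\<close>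

lemma has_weak_partial_Pair:
  fixes f g :: "'a::euclidean_space \<Rightarrow> real"
  assumes "has_weak_partial S b f f'" "has_weak_partial S b g g'" "S \<in> sets lebesgue"
  shows "has_weak_partial S b (\<lambda>x. (f x, g x)) (\<lambda>x. (f' x, g' x))"
proof -
  have "bounded_linear (\<lambda>s::real. (s, 0::real))" "bounded_linear (\<lambda>t::real. (0::real, t))"
    by (intro bounded_linear_intros)+
  from has_weak_partial_add[OF has_weak_partial_bounded_linear[OF this(1) assms(1,3)]
      has_weak_partial_bounded_linear[OF this(2) assms(2,3)] assms(3)]
  show ?thesis by simp
qed

lemma L2_Pair:
  fixes f g :: "'a::euclidean_space \<Rightarrow> real"
  assumes "f \<in> L2 S" "g \<in> L2 S" shows "(\<lambda>x. (f x, g x)) \<in> L2 S"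
proof -
  have "bounded_linear (\<lambda>s::real. (s, 0::real))" "bounded_linear (\<lambda>t::real. (0::real, t))"
    by (intro bounded_linear_intros)+
  from L2_add[OF L2_bounded_linear[OF assms(1) this(1)] L2_bounded_linear[OF assms(2) this(2)]]
  show ?thesis by simp
qed

lemma L2_cmult: "f \<in> L2 S \<Longrightarrow> (\<lambda>x. c * f x :: real) \<in> L2 S"
  using L2_bounded_linear[OF _ bounded_linear_mult_right] .

lemma integrable_mult_L2:
  fixes f g :: "'a::euclidean_space \<Rightarrow> real"
  shows "f \<in> L2 S \<Longrightarrow> g \<in> L2 S \<Longrightarrow> integrable (lebesgue_on S) (\<lambda>x. f x * g x)"
  using integrable_inner_L2[of f S g] by simp

text \<open>The derivatives in \<open>scaled_hessian\<close> are arbitrary representatives. They are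
  replaced by known ones, and \<open>has_weak_partial_swap\<close> turns both off-diagonal entries
  into \<open>w12\<close>; so \<open>Q2\<close> is evaluated at a symmetric matrix, where
  \<open>R\<close> describes it.\<close>

lemma J_ben_eq:
  assumes w: "has_weak_partial (rod_strip l) e1 w w1" "has_weak_partial (rod_strip l) e2 w w2"
      "has_weak_partial (rod_strip l) e1 w1 w11" "has_weak_partial (rod_strip l) e1 w2 w12"
      "has_weak_partial (rod_strip l) e2 w2 w22"
    and R: "\<And>\<kappa> \<tau> \<gamma>. Q2 (sym_mat \<kappa> \<tau> \<gamma>) = R \<kappa> \<tau> \<gamma>"
  shows "J_ben Q2 l e w = 1 / 24 * (LINT x|lebesgue_on (rod_strip l). R (w11 x) (1 / e * w12 x) (1 / e\<^sup>2 * w22 x))"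
proof -
  let ?S = "rod_strip l"
  let ?M = "lebesgue_on ?S"
  let ?D = "weak_partial ?S"
  have 1: "AE x in ?M. ?D e1 w x = w1 x" "AE x in ?M. ?D e2 w x = w2 x"
    using w(1,2) weak_partial_eq_AE[OF open_rod_strip] by blast+
  have eq: "?D b (?D e1 w) = ?D b w1" "?D b (?D e2 w) = ?D b w2" for b
    using weak_partial_cong_AE[OF 1(1)] weak_partial_cong_AE[OF 1(2)] by simp_all
  have "AE x in ?M. ?D e1 w1 x = w11 x" "AE x in ?M. ?D e1 w2 x = w12 x"
      "AE x in ?M. ?D e2 w1 x = w12 x" "AE x in ?M. ?D e2 w2 x = w22 x"
    using w(3-5) has_weak_partial_swap[OF w(1,2,4)] weak_partial_eq_AE[OF open_rod_strip] by blast+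
  then have "AE x in ?M. Q2 (scaled_hessian l e w x) = R (w11 x) (1 / e * w12 x) (1 / e\<^sup>2 * w22 x)"
    by eventually_elim (simp add: scaled_hessian_def Let_def eq R)
  then show ?thesis
    unfolding J_ben_def by (subst integral_lebesgue_on_cong_AE) auto
qed

text \<open>Because the cross section has length \<open>1\<close>, the limit energy is also an
  integral over the strip, and both energies can be compared under one integral.\<close>

lemma J_LvK_eq:
  assumes "\<And>\<kappa> \<tau>. Q1 Q2 \<kappa> \<tau> = A * \<kappa>\<^sup>2 + B * \<tau>\<^sup>2 + D * (\<kappa> * \<tau>)"
    and "weak_partial (rod_interval l) 1 (weak_partial (rod_interval l) 1 w) = \<kappa>"
      "weak_partial (rod_interval l) 1 \<theta> = \<tau>" "\<kappa> \<in> L2 (rod_interval l)" "\<tau> \<in> L2 (rod_interval l)"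
  shows "J_LvK Q2 l w \<theta> = 1 / 24 *
    (LINT x|lebesgue_on (rod_strip l). A * (\<kappa> (fst x))\<^sup>2 + B * (\<tau> (fst x))\<^sup>2 + D * (\<kappa> (fst x) * \<tau> (fst x)))"
proof -
  have int: "integrable (lebesgue_on (rod_interval l)) (\<lambda>t. A * (\<kappa> t)\<^sup>2 + B * (\<tau> t)\<^sup>2 + D * (\<kappa> t * \<tau> t))"
    using integrable_mult_L2[OF assms(4,4)] integrable_mult_L2[OF assms(5,5)] integrable_mult_L2[OF assms(4,5)]
    by (simp add: power2_eq_square)
  show ?thesis
    using integral_strip[OF int, of "\<lambda>_. 1" 1] cross_section_polynomials(3)
    unfolding J_LvK_def Let_def assms(1-3) by simp
qed

lemma W22_0_D:
  assumes "w \<in> W22_0 (rod_interval l)"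
  defines "w1 \<equiv> weak_partial (rod_interval l) 1 w"
  defines "w2 \<equiv> weak_partial (rod_interval l) 1 w1"
  shows "w \<in> L2 (rod_interval l)" "w1 \<in> L2 (rod_interval l)" "w2 \<in> L2 (rod_interval l)"
    "has_weak_partial (rod_interval l) 1 w w1" "has_weak_partial (rod_interval l) 1 w1 w2"
    "(LINT t|lebesgue_on (rod_interval l). w t) = 0" "(LINT t|lebesgue_on (rod_interval l). w1 t) = 0"
proof -
  let ?I = "rod_interval l"
  have w: "w \<in> sobolev (Suc (Suc 0)) ?I"
    using assms(1) by (simp add: W22_0_def numeral_2_eq_2)
  note 1 = sobolev_Suc_weak_partial[OF w _ open_rod_interval, of 1, folded w1_def, simplified]
  note 2 = sobolev_Suc_weak_partial[of w1 0 "?I" 1, OF _ _ open_rod_interval, folded w2_def, simplified]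
  show "w \<in> L2 ?I" "w1 \<in> L2 ?I"
    using w 1 by auto
  show "has_weak_partial ?I 1 w w1" using 1 by simp
  show "w2 \<in> L2 ?I" "has_weak_partial ?I 1 w1 w2"
    using 1 2 by auto
  show "(LINT t|lebesgue_on ?I. w t) = 0" "(LINT t|lebesgue_on ?I. w1 t) = 0"
    using assms(1) by (auto simp: W22_0_def weak_gradient_def w1_def)
qed

lemma W12_0_D:
  assumes "\<theta> \<in> W12_0 (rod_interval l)"
  shows "\<theta> \<in> L2 (rod_interval l)" "weak_partial (rod_interval l) 1 \<theta> \<in> L2 (rod_interval l)"
    "has_weak_partial (rod_interval l) 1 \<theta> (weak_partial (rod_interval l) 1 \<theta>)"
    "(LINT t|lebesgue_on (rod_interval l). \<theta> t) = 0"
  using assms sobolev_Suc_weak_partial[of \<theta> 0 "rod_interval l" 1] sobolev_subset_L2[of \<theta> 1]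
  by (auto simp: W12_0_def open_rod_interval)

lemma liminf_inequality:
  assumes Q2: "positive_definite_quadratic_form_on symmetric_matrices Q2"
    and w: "\<And>e. e > 0 \<Longrightarrow> w e \<in> sobolev 2 (rod_strip l)"
    and w0: "w0 \<in> W22_0 (rod_interval l)" and \<theta>: "\<theta> \<in> W12_0 (rod_interval l)"
    and conv: "rod_converges l w w0 \<theta>"
  shows "Liminf (at_right 0) (\<lambda>e. ereal (J_ben Q2 l e (w e))) \<ge> ereal (J_LvK Q2 l w0 \<theta>)"
proof -
  let ?I = "rod_interval l"
  let ?S = "rod_strip l"
  obtain A B D c p q where c: "c > 0"
    and R: "\<And>\<kappa> \<tau> \<gamma>. Q2 (sym_mat \<kappa> \<tau> \<gamma>) = A * \<kappa>\<^sup>2 + B * \<tau>\<^sup>2 + D * (\<kappa> * \<tau>) + c * (\<gamma> - (p * \<kappa> + q * \<tau>))\<^sup>2"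
    and Q1: "\<And>\<kappa> \<tau>. Q1 Q2 \<kappa> \<tau> = A * \<kappa>\<^sup>2 + B * \<tau>\<^sup>2 + D * (\<kappa> * \<tau>)"
    and nonneg: "\<And>\<kappa> \<tau>. A * \<kappa>\<^sup>2 + B * \<tau>\<^sup>2 + D * (\<kappa> * \<tau>) \<ge> 0"
    by (rule quadratic_form_reduction[OF Q2]) (rule that; assumption)
  let ?M = "lebesgue_on ?S"
  define k where "k = (\<lambda>x::real\<times>real. weak_partial ?I 1 (weak_partial ?I 1 w0) (fst x))"
  define t where "t = (\<lambda>x::real\<times>real. weak_partial ?I 1 \<theta> (fst x))"
  note W = W22_0_D[OF w0] note T = W12_0_D[OF \<theta>]
  have zero: "(\<lambda>_. 0::real) \<in> L2 ?I" by (simp add: L2_const lmeasurable_rod_interval)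
  have zero': "has_weak_partial ?I 1 (\<lambda>_. 0::real) (\<lambda>_. 0)"
    using has_weak_partial_bounded_linear[OF bounded_linear_zero W(4)] by simp
  have kt: "k \<in> L2 ?S" "t \<in> L2 ?S"
    using ansatz_L2[OF W(3) zero zero] ansatz_L2[OF T(2) zero zero] by (simp_all add: k_def t_def ansatz_simple)
  \<comment> \<open>The gradient of the form \<open>Q1\<close> at the limit \<open>(k, t)\<close>.
    It does not depend on \<open>e\<close>, which is what lets weak convergence act.\<close>
  define \<eta> where "\<eta> = (\<lambda>x. (2 * A * k x + D * t x, 2 * B * t x + D * k x))"
  have \<eta>: "\<eta> \<in> L2 ?S"
    unfolding \<eta>_def by (intro L2_Pair L2_add L2_cmult kt)
  define F where "F f = (LINT x|?M. \<eta> x \<bullet> weak_partial ?S e1 f x)" for f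
  define u0 where "u0 = (\<lambda>x::real\<times>real. (weak_partial ?I 1 w0 (fst x), \<theta> (fst x)))"
  have "F \<in> sobolev_dual 1 ?S"
    using sobolev_dual_weak_partial[OF open_rod_strip e1_in_Basis \<eta>] by (simp add: F_def[abs_def])
  then have lim: "((\<lambda>e. F (scaled_gradient l e (w e))) \<longlongrightarrow> F u0) (at_right 0)"
    using conv by (auto simp: rod_converges_def sobolev_weakly_converges_def u0_def)
  have "has_weak_partial ?S e1 u0 (\<lambda>x. (k x, t x))"
    using has_weak_partial_Pair[OF has_weak_partial_ansatz_e1[OF W(2) zero zero W(3) zero zero W(5) zero' zero']
        has_weak_partial_ansatz_e1[OF T(1) zero zero T(2) zero zero T(3) zero' zero']]
    by (simp add: ansatz_simple u0_def k_def t_def)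
  from weak_partial_eq_AE[OF open_rod_strip this]
  have "AE x in ?M. \<eta> x \<bullet> weak_partial ?S e1 u0 x = \<eta> x \<bullet> (k x, t x)"
    by eventually_elim simp
  then have Fu0: "F u0 = (LINT x|?M. \<eta> x \<bullet> (k x, t x))"
    unfolding F_def by (rule integral_lebesgue_on_cong_AE) simp
  let ?F = "\<lambda>e. F (scaled_gradient l e (w e))"
  \<comment> \<open>A bound for each single \<open>e\<close>; only its linear term is left for the
    passage to the limit.\<close>
  have lower: "J_LvK Q2 l w0 \<theta> + 1 / 24 * (?F e - F u0) \<le> J_ben Q2 l e (w e)"
    if "e > 0" for e
  proof -
    have w2: "w e \<in> sobolev (Suc (Suc 0)) ?S"
      using w[OF that] by (simp add: numeral_2_eq_2)
    define g where "g b = weak_partial ?S b (w e)" for b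
    define h where "h a b = weak_partial ?S a (g b)" for a b
    have g: "g b \<in> sobolev (Suc 0) ?S" "has_weak_partial ?S b (w e) (g b)" if "b \<in> Basis" for b
      using sobolev_Suc_weak_partial[OF w2 that open_rod_strip] by (simp_all add: g_def)
    have h: "h a b \<in> L2 ?S" "has_weak_partial ?S a (g b) (h a b)"
      if "a \<in> Basis" "b \<in> Basis" for a b
      using sobolev_Suc_weak_partial[OF g(1)[OF that(2)] that(1) open_rod_strip] by (simp_all add: h_def)
    define k' where "k' = h e1 e1"
    define t' where "t' x = 1 / e * h e1 e2 x" for x
    \<comment> \<open>The deviation of the scaled second derivative along \<open>e2\<close> from the
      minimiser; its square is the term that is dropped.\<close>
    define r where "r x = 1 / e\<^sup>2 * h e2 e2 x - (p * k' x + q * t' x)" for x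
    have L: "k' \<in> L2 ?S" "t' \<in> L2 ?S" "r \<in> L2 ?S"
      unfolding r_def[abs_def] k'_def t'_def[abs_def]
      by (intro h L2_cmult L2_diff L2_add e1_in_Basis e2_in_Basis)+
    have "has_weak_partial ?S e1 (scaled_gradient l e (w e)) (\<lambda>x. (k' x, t' x))"
      using has_weak_partial_Pair[OF h(2)[OF e1_in_Basis e1_in_Basis]
          has_weak_partial_bounded_linear[OF bounded_linear_mult_right[of "1 / e"]
            h(2)[OF e1_in_Basis e2_in_Basis] sets_rod(2)] sets_rod(2)]
      by (simp add: scaled_gradient_def[abs_def] g_def k'_def t'_def)
    from weak_partial_eq_AE[OF open_rod_strip this]
    have "AE x in ?M. \<eta> x \<bullet> weak_partial ?S e1 (scaled_gradient l e (w e)) x = \<eta> x \<bullet> (k' x, t' x)"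
      by eventually_elim simp
    then have Fu: "?F e = (LINT x|?M. \<eta> x \<bullet> (k' x, t' x))"
      unfolding F_def by (rule integral_lebesgue_on_cong_AE) simp
    have i1: "integrable ?M (\<lambda>x. \<eta> x \<bullet> (k x, t x))" "integrable ?M (\<lambda>x. \<eta> x \<bullet> (k' x, t' x))"
      using integrable_inner_L2[OF \<eta> L2_Pair] kt L by blast+
    have i2: "integrable ?M (\<lambda>x. A * (f x)\<^sup>2 + B * (f' x)\<^sup>2 + D * (f x * f' x))"
      if "f \<in> L2 ?S" "f' \<in> L2 ?S" for f f'
      using integrable_mult_L2[OF that(1,1)] integrable_mult_L2[OF that(2,2)] integrable_mult_L2[OF that]
      by (simp add: power2_eq_square)
    have i3: "integrable ?M (\<lambda>x. (r x)\<^sup>2)"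
      using integrable_mult_L2[OF L(3,3)] by (simp add: power2_eq_square)
    let ?q = "\<lambda>a b. A * a\<^sup>2 + B * b\<^sup>2 + D * (a * b)"
    have "24 * J_LvK Q2 l w0 \<theta> + (?F e - F u0) =
        (LINT x|?M. ?q (k x) (t x) + (\<eta> x \<bullet> (k' x, t' x) - \<eta> x \<bullet> (k x, t x)))"
      using i1 i2[OF kt] J_LvK_eq[OF Q1 refl refl W(3) T(2)]
      by (simp add: Fu Fu0 k_def t_def)
    also have "\<dots> \<le> (LINT x|?M. ?q (k' x) (t' x) + c * (r x)\<^sup>2)"
    proof (rule integral_mono)
      fix x
      \<comment> \<open>The form at the difference of the arguments equals its value at
        \<open>(k', t')\<close> minus its tangent at \<open>(k, t)\<close>.\<close>
      have "0 \<le> A * (k' x - k x)\<^sup>2 + B * (t' x - t x)\<^sup>2 + D * ((k' x - k x) * (t' x - t x))"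
        by (rule nonneg)
      also have "\<dots> = ?q (k' x) (t' x) -
          (?q (k x) (t x) + (\<eta> x \<bullet> (k' x, t' x) - \<eta> x \<bullet> (k x, t x)))"
        by (simp add: \<eta>_def power2_eq_square algebra_simps)
      moreover have "0 \<le> c * (r x)\<^sup>2" using c by simp
      ultimately show "?q (k x) (t x) + (\<eta> x \<bullet> (k' x, t' x) - \<eta> x \<bullet> (k x, t x)) \<le>
          ?q (k' x) (t' x) + c * (r x)\<^sup>2"
        by linarith
    qed (use i1 i2[OF kt] i2[OF L(1,2)] i3 in auto)
    also have "\<dots> = 24 * J_ben Q2 l e (w e)"
      using J_ben_eq[OF g(2)[OF e1_in_Basis] g(2)[OF e2_in_Basis] h(2)[OF e1_in_Basis e1_in_Basis]
          h(2)[OF e1_in_Basis e2_in_Basis] h(2)[OF e2_in_Basis e2_in_Basis],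
          of Q2 "\<lambda>\<kappa> \<tau> \<gamma>. A * \<kappa>\<^sup>2 + B * \<tau>\<^sup>2 + D * (\<kappa> * \<tau>) + c * (\<gamma> - (p * \<kappa> + q * \<tau>))\<^sup>2" e] R
      by (simp add: r_def t'_def k'_def)
    finally show ?thesis by (simp add: field_simps)
  qed
  have "((\<lambda>e. J_LvK Q2 l w0 \<theta> + 1 / 24 * (?F e - F u0)) \<longlongrightarrow>
      J_LvK Q2 l w0 \<theta> + 1 / 24 * (F u0 - F u0)) (at_right 0)"
    by (intro tendsto_intros lim)
  then have "((\<lambda>e. ereal (J_LvK Q2 l w0 \<theta> + 1 / 24 * (?F e - F u0))) \<longlongrightarrow>
      ereal (J_LvK Q2 l w0 \<theta>)) (at_right 0)"
    by simp
  then have "ereal (J_LvK Q2 l w0 \<theta>) =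
      Liminf (at_right 0) (\<lambda>e. ereal (J_LvK Q2 l w0 \<theta> + 1 / 24 * (?F e - F u0)))"
    by (intro lim_imp_Liminf[symmetric]) simp_all
  also have "\<dots> \<le> Liminf (at_right 0) (\<lambda>e. ereal (J_ben Q2 l e (w e)))"
    by (rule Liminf_mono) (use lower in \<open>auto simp: eventually_at_right_less intro: eventually_mono[OF eventually_at_right_less]\<close>)
  finally show ?thesis .
qed

section \<open>Smooth approximation in one variable\<close>

text \<open>Truncation comes first because \<open>ex_test_functions_tendsto_AE\<close> wants a
  bounded target. Both errors are below \<open>\<delta> / 4\<close>, and the square of a sum is at
  most twice the sum of the squares.\<close>

lemma ex_test_function_L2_close:
  fixes f :: "'a::euclidean_space \<Rightarrow> real"
  assumes f: "f \<in> L2 (box a c)" and "\<delta> > 0"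
  shows "\<exists>\<phi>\<in>test_functions (box a c). (LINT x|lebesgue_on (box a c). (\<phi> x - f x)\<^sup>2) < \<delta>"
proof -
  let ?M = "lebesgue_on (box a c)"
  have fin: "finite_measure ?M"
    by (rule finite_measure_lebesgue_on) (rule lmeasurable_box)
  have [measurable]: "f \<in> borel_measurable ?M" using f by (rule L2_D)
  have f2: "integrable ?M (\<lambda>x. (f x)\<^sup>2)" using L2_D(2)[OF f] by simp
  define g where "g m x = max (- real m) (min (real m) (f x))" for m x
  have g_meas[measurable]: "g m \<in> borel_measurable ?M" for m unfolding g_def by measurable
  have bound_g: "\<bar>g m x\<bar> \<le> real m" "\<bar>g m x - f x\<bar> \<le> \<bar>f x\<bar>" for m x
    by (auto simp: g_def max_def min_def)
  have sq_g: "(g m x - f x)\<^sup>2 \<le> (f x)\<^sup>2" for m x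
    using bound_g(2) abs_le_square_iff by blast
  have "(\<lambda>m. LINT x|?M. (g m x - f x)\<^sup>2) \<longlonglongrightarrow> (LINT x|?M. 0)"
  proof (rule integral_dominated_convergence[where w="\<lambda>x. (f x)\<^sup>2"])
    \<comment> \<open>At each point the truncation is exact from some \<open>m\<close> on.\<close>
    have "(\<lambda>m. (g m x - f x)\<^sup>2) \<longlonglongrightarrow> 0" for x
    proof (rule tendsto_eventually, rule eventually_sequentiallyI)
      fix m assume "nat \<lceil>\<bar>f x\<bar>\<rceil> \<le> m"
      then have "\<bar>f x\<bar> \<le> real m" by linarith
      then show "(g m x - f x)\<^sup>2 = 0" by (auto simp: g_def)
    qed
    then show "AE x in ?M. (\<lambda>m. (g m x - f x)\<^sup>2) \<longlonglongrightarrow> 0" by simp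
  qed (use f2 sq_g in auto)
  then have "\<forall>\<^sub>F m in sequentially. (LINT x|?M. (g m x - f x)\<^sup>2) < \<delta> / 4"
    using assms(2) by (intro order_tendstoD(2)) auto
  then obtain m where m: "(LINT x|?M. (g m x - f x)\<^sup>2) < \<delta> / 4"
    using eventually_happens by force
  obtain \<phi> where \<phi>: "\<And>n::nat. \<phi> n \<in> test_functions (box a c)" "\<And>n x. \<bar>\<phi> n x\<bar> \<le> \<bar>real m\<bar> + 1"
      "AE x in ?M. (\<lambda>n. \<phi> n x) \<longlonglongrightarrow> g m x"
    using ex_test_functions_tendsto_AE[OF g_meas[of m] bound_g(1)[of m]] by blast
  have \<phi>_meas[measurable]: "\<phi> n \<in> borel_measurable ?M" for n
    using test_functionsD(1)[OF \<phi>(1)[of n], of 0]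
    by (intro continuous_imp_measurable_on_sets_lebesgue) (auto intro: continuous_on_subset)
  have bd: "(\<phi> n x - g m x)\<^sup>2 \<le> (2 * real m + 1)\<^sup>2" for n x
  proof -
    have "\<bar>\<phi> n x - g m x\<bar> \<le> 2 * real m + 1"
      using \<phi>(2)[of n x] bound_g(1)[of m x] by linarith
    then show ?thesis by (metis abs_le_square_iff abs_of_nonneg abs_ge_zero order_trans)
  qed
  have const: "integrable ?M (\<lambda>x. (2 * real m + 1)\<^sup>2)"
    by (rule finite_measure.integrable_const[OF fin])
  have "(\<lambda>n. LINT x|?M. (\<phi> n x - g m x)\<^sup>2) \<longlonglongrightarrow> (LINT x|?M. 0)"
  proof (rule integral_dominated_convergence[where w="\<lambda>x. (2 * real m + 1)\<^sup>2"])
    show "AE x in ?M. (\<lambda>n. (\<phi> n x - g m x)\<^sup>2) \<longlonglongrightarrow> 0"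
      using \<phi>(3)
    proof eventually_elim
      case (elim x)
      then have "(\<lambda>n. (\<phi> n x - g m x)\<^sup>2) \<longlonglongrightarrow> (g m x - g m x)\<^sup>2" by (intro tendsto_intros)
      then show ?case by simp
    qed
  qed (use const bd in auto)
  then have "\<forall>\<^sub>F n in sequentially. (LINT x|?M. (\<phi> n x - g m x)\<^sup>2) < \<delta> / 4"
    using assms(2) by (intro order_tendstoD(2)) auto
  then obtain n where n: "(LINT x|?M. (\<phi> n x - g m x)\<^sup>2) < \<delta> / 4"
    using eventually_happens by force
  have i1: "integrable ?M (\<lambda>x. (\<phi> n x - g m x)\<^sup>2)"
    by (rule Bochner_Integration.integrable_bound[OF const]) (use bd in auto)
  have i2: "integrable ?M (\<lambda>x. (g m x - f x)\<^sup>2)"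
    by (rule Bochner_Integration.integrable_bound[OF f2]) (use sq_g in auto)
  have ineq: "(\<phi> n x - f x)\<^sup>2 \<le> 2 * (\<phi> n x - g m x)\<^sup>2 + 2 * (g m x - f x)\<^sup>2" for x
    using zero_le_power2[of "(\<phi> n x - g m x) - (g m x - f x)"] by (simp add: power2_eq_square algebra_simps)
  have "(LINT x|?M. (\<phi> n x - f x)\<^sup>2) \<le> (LINT x|?M. 2 * (\<phi> n x - g m x)\<^sup>2 + 2 * (g m x - f x)\<^sup>2)"
  proof (rule integral_mono)
    show "integrable ?M (\<lambda>x. (\<phi> n x - f x)\<^sup>2)"
      by (rule Bochner_Integration.integrable_bound[of _ "\<lambda>x. 2 * (\<phi> n x - g m x)\<^sup>2 + 2 * (g m x - f x)\<^sup>2"])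
        (use i1 i2 ineq in auto)
  qed (use i1 i2 ineq in auto)
  also have "\<dots> < \<delta>"
    using i1 i2 m n by simp
  finally show ?thesis using \<phi>(1) by blast
qed

lemma ex_test_functions_L2_tendsto:
  fixes f :: "'a::euclidean_space \<Rightarrow> real"
  assumes "f \<in> L2 (box a c)"
  obtains \<phi> where "\<And>n::nat. \<phi> n \<in> test_functions (box a c)"
    "(\<lambda>n. LINT x|lebesgue_on (box a c). (\<phi> n x - f x)\<^sup>2) \<longlonglongrightarrow> 0"
proof -
  have "\<exists>\<phi>. \<phi> \<in> test_functions (box a c) \<and> (LINT x|lebesgue_on (box a c). (\<phi> x - f x)\<^sup>2) < 1 / Suc n" for n
    using ex_test_function_L2_close[OF assms, of "1 / Suc n"] by auto
  then obtain \<phi> where \<phi>: "\<And>n. \<phi> n \<in> test_functions (box a c)"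
      "\<And>n. (LINT x|lebesgue_on (box a c). (\<phi> n x - f x)\<^sup>2) < 1 / Suc n"
    by metis
  have "(\<lambda>n. LINT x|lebesgue_on (box a c). (\<phi> n x - f x)\<^sup>2) \<longlonglongrightarrow> 0"
  proof (rule Lim_null_comparison)
    show "\<forall>\<^sub>F n in sequentially. norm (LINT x|lebesgue_on (box a c). (\<phi> n x - f x)\<^sup>2) \<le> 1 / real (Suc n)"
      using \<phi>(2) by (intro always_eventually allI) (simp add: less_imp_le)
    show "(\<lambda>n. 1 / real (Suc n)) \<longlonglongrightarrow> 0"
      using LIMSEQ_inverse_real_of_nat by (simp add: field_simps)
  qed
  then show ?thesis using that \<phi>(1) by blast
qed

section \<open>Test functions as Sobolev functions, and their primitives\<close>

lemma test_function_L2: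
  fixes \<phi> :: "'a::euclidean_space \<Rightarrow> real"
  assumes "\<phi> \<in> test_functions S" "S \<in> lmeasurable"
  shows "\<phi> \<in> L2 S"
proof -
  obtain C where C: "\<And>x. \<bar>\<phi> x\<bar> \<le> C" using test_function_bounded[OF assms(1)] by blast
  have "continuous_on UNIV \<phi>" using test_functionsD(1)[OF assms(1), of 0] by simp
  then have "\<phi> \<in> borel_measurable (lebesgue_on S)"
    using assms(2) by (intro continuous_imp_measurable_on_sets_lebesgue) (auto intro: continuous_on_subset)
  then show ?thesis
    by (intro L2_bound[OF L2_const[OF assms(2), of "1::real"], of _ C]) (use C in auto)
qed

lemma test_function_has_weak_partial:
  fixes \<phi> :: "real \<Rightarrow> real"
  assumes "\<phi> \<in> test_functions {a<..<b}"
  shows "has_weak_partial {a<..<b} 1 \<phi> (\<lambda>x. frechet_derivative \<phi> (at x) 1)"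
proof (rule has_weak_partial_C1)
  show "(\<phi> has_real_derivative frechet_derivative \<phi> (at x) 1) (at x)" for x
    by (rule Ck_has_real_derivative[OF test_functionsD(1)[OF assms]])
  show "continuous_on UNIV (\<lambda>x. frechet_derivative \<phi> (at x) 1)"
    using test_functionsD(1)[OF test_functions_frechet_derivative[OF assms], of 0] by simp
qed

text \<open>The primitive is an integral over the whole interval with an indicator, a formula that
  also makes sense for merely integrable functions, such as \<open>\<theta>'\<close> in
  \<open>ex_smooth_approximation\<close>.\<close>

lemma has_real_derivative_integral_test_function:
  fixes \<eta> :: "real \<Rightarrow> real"
  assumes \<eta>: "\<eta> \<in> test_functions {a<..<b}"
  defines "U \<equiv> \<lambda>x. LINT t|lebesgue_on {a<..<b}. indicator {..x} t * \<eta> t"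
  shows "(U has_real_derivative \<eta> x) (at x)"
proof -
  have cont: "continuous_on A \<eta>" for A
    using test_functionsD(1)[OF \<eta>, of 0] by (auto intro: continuous_on_subset)
  have zero: "\<eta> t = 0" if "t \<le> a" for t
    using test_function_eq_0[OF \<eta>, of t] that by auto
  have zero': "\<eta> t = 0" if "t \<notin> {a<..<b}" for t
    using test_function_eq_0[OF \<eta> that] .
  \<comment> \<open>Starting at \<open>a - 1\<close> leaves room on the left, so that every
    \<open>x\<close> from \<open>a\<close> on is interior to the domain of the integral
    function.\<close>
  have U: "U x = integral {a - 1..x} \<eta>" for x
  proof -
    have "U x = (LINT t|lebesgue. (if t \<in> {a<..<b} then indicator {..x} t * \<eta> t else 0))"
      unfolding U_def by (rule Lebesgue_Measure.integral_restrict_UNIV[symmetric]) simp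
    also have "(\<lambda>t. if t \<in> {a<..<b} then indicator {..x} t * \<eta> t else 0) = (\<lambda>t. if t \<in> {a - 1..x} then \<eta> t else 0)"
      using zero zero' by (auto simp: fun_eq_iff indicator_def)
    also have "(LINT t|lebesgue. (if t \<in> {a - 1..x} then \<eta> t else 0)) = (LINT t|lebesgue_on {a - 1..x}. \<eta> t)"
      by (rule Lebesgue_Measure.integral_restrict_UNIV) simp
    also have "\<dots> = integral {a - 1..x} \<eta>"
      by (rule lebesgue_integral_eq_integral) (simp_all add: continuous_imp_integrable_real cont)
    finally show ?thesis .
  qed
  show ?thesis
  proof (cases "x < a")
    case True
    have U0: "0 = U y" if "y \<in> {..<a}" for y
    proof -
      have "integral {a - 1..y} \<eta> = integral {a - 1..y} (\<lambda>_. 0)"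
        by (rule integral_cong) (use zero that in auto)
      then show ?thesis by (simp add: U)
    qed
    have "(U has_real_derivative 0) (at x)"
      by (rule has_field_derivative_transform_within_open[OF DERIV_const open_lessThan _ U0]) (use True in auto)
    then show ?thesis using zero[of x] True by simp
  next
    case False
    have "((\<lambda>x. integral {a - 1..x} \<eta>) has_real_derivative \<eta> x) (at x within {a - 1..x + 1})"
      by (rule integral_has_real_derivative) (use False cont in auto)
    moreover have "at x within {a - 1..x + 1} = at x"
      by (rule at_within_interior) (use False in auto)
    moreover have "U = (\<lambda>x. integral {a - 1..x} \<eta>)"
      by (rule ext) (rule U)
    ultimately show ?thesis by simp
  qed
qed

text \<open>The primitive is \<open>0\<close> to the left of the support and equals the total
  integral to its right; mean zero is exactly what makes it compactly supported.\<close>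

lemma ex_test_primitive:
  fixes \<eta> :: "real \<Rightarrow> real"
  assumes \<eta>: "\<eta> \<in> test_functions {a<..<b}" and int0: "(LINT t|lebesgue_on {a<..<b}. \<eta> t) = 0"
  obtains \<Phi> where "\<Phi> \<in> test_functions {a<..<b}" "\<And>x. frechet_derivative \<Phi> (at x) 1 = \<eta> x"
proof -
  define U where "U = (\<lambda>x. LINT t|lebesgue_on {a<..<b}. indicator {..x} t * \<eta> t)"
  have D: "(U has_real_derivative \<eta> x) (at x)" for x
    unfolding U_def by (rule has_real_derivative_integral_test_function[OF \<eta>])
  have Ck: "Ck k U" for k
  proof -
    have "Ck (Suc k) U"
      by (rule Ck_SucI[OF D[THEN has_field_derivative_imp_has_derivative]])
        (intro Ck_mult Ck_const test_functionsD(1)[OF \<eta>])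
    then show ?thesis by (rule Ck_SucD)
  qed
  let ?K = "closure {x. \<eta> x \<noteq> 0}"
  have K: "compact ?K" "?K \<subseteq> {a<..<b}" using test_functionsD[OF \<eta>] by auto
  \<comment> \<open>A compact interval inside the open one that contains the support. If the support
    is empty, any end points with these strict inequalities serve.\<close>
  obtain a' b' where ab: "a < a'" "b' < b" "?K \<subseteq> {a'..b'}"
  proof (cases "?K = {}")
    case True
    then show ?thesis using that[of "a + 1" "b - 1"] by simp
  next
    case False
    obtain a' where "a' \<in> ?K" "\<And>x. x \<in> ?K \<Longrightarrow> a' \<le> x" using compact_attains_inf[OF K(1) False] by blast
    moreover obtain b' where "b' \<in> ?K" "\<And>x. x \<in> ?K \<Longrightarrow> x \<le> b'" using compact_attains_sup[OF K(1) False] by blast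
    ultimately show ?thesis using that[of a' b'] K(2) by (auto simp: subset_iff)
  qed
  have supp: "\<eta> t = 0" if "t \<notin> {a'..b'}" for t
    using test_function_support[of \<eta> t] ab(3) that by blast
  have "U \<in> test_functions {a<..<b}"
  proof (rule test_functionsI[OF Ck])
    show "compact {a'..b'}" by simp
    show "{a'..b'} \<subseteq> {a<..<b}" using ab by auto
    show "x \<in> {a'..b'}" if "U x \<noteq> 0" for x
    proof (rule ccontr)
      assume "x \<notin> {a'..b'}"
      then consider "x < a'" | "x > b'" by fastforce
      then have "U x = 0"
      proof cases
        case 1
        then have "(\<lambda>t. indicator {..x} t * \<eta> t) = (\<lambda>t. 0)"
          using supp by (auto simp: indicator_def fun_eq_iff)
        then show ?thesis by (simp add: U_def)
      next
        case 2
        then have "(\<lambda>t. indicator {..x} t * \<eta> t) = \<eta>"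
          using supp by (auto simp: indicator_def fun_eq_iff)
        then show ?thesis using int0 by (simp add: U_def)
      qed
      then show False using that by simp
    qed
  qed
  moreover have "frechet_derivative U (at x) 1 = \<eta> x" for x
    by (rule has_real_derivative_imp_frechet[OF D])
  ultimately show ?thesis using that by blast
qed

text \<open>The lemma of du Bois-Reymond. Subtract from \<open>\<phi>\<close> its integral times a
  fixed \<open>\<zeta>\<close> of integral \<open>1\<close>: the result is the derivative of a test
  function, so \<open>h\<close> integrates to \<open>0\<close> against it. With \<open>c\<close> the
  integral of \<open>\<zeta> x * h x\<close>, this says that \<open>h - c\<close> integrates to
  \<open>0\<close> against \<open>\<phi>\<close>.\<close>

lemma weak_partial_0_imp_const:
  fixes h :: "real \<Rightarrow> real"
  assumes "a < b" and h: "has_weak_partial {a<..<b} 1 h (\<lambda>_. 0)"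
  shows "\<exists>c. AE x in lebesgue_on {a<..<b}. h x = c"
proof -
  let ?I = "{a<..<b}" and ?M = "lebesgue_on {a<..<b}"
  have lm: "?I \<in> lmeasurable" using lmeasurable_box[of a b] by simp
  have hl: "locally_integrable ?I h" using h by (simp add: has_weak_partial_def)
  have cl: "locally_integrable ?I (\<lambda>_. c)" for c :: real
    using locally_integrable_L2[OF L2_const[OF lm] lm] .
  \<comment> \<open>Otherwise the fundamental lemma would make the constant \<open>1\<close> vanish
    almost everywhere on a nonempty interval.\<close>
  have "\<exists>\<zeta>\<in>test_functions ?I. (LINT x|?M. \<zeta> x) \<noteq> 0"
  proof (rule ccontr)
    assume "\<not> ?thesis"
    then have "AE x in ?M. (1::real) = 0"
      by (intro fundamental_lemma_real cl) auto
    then have "emeasure ?M (space ?M) = 0"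
      by (subst (asm) AE_iff_measurable[of "space ?M"]) auto
    then show False using assms(1) by (simp add: emeasure_restrict_space)
  qed
  then obtain \<zeta>0 where \<zeta>0: "\<zeta>0 \<in> test_functions ?I" "(LINT x|?M. \<zeta>0 x) \<noteq> 0" by blast
  define \<zeta> where "\<zeta> x = 1 / (LINT x|?M. \<zeta>0 x) * \<zeta>0 x" for x
  have \<zeta>: "\<zeta> \<in> test_functions ?I" unfolding \<zeta>_def[abs_def]
    by (rule test_functions_mult[OF Ck_const \<zeta>0(1)])
  have \<zeta>1: "(LINT x|?M. \<zeta> x) = 1" using \<zeta>0(2) by (simp add: \<zeta>_def)
  define c where "c = (LINT x|?M. \<zeta> x * h x)"
  have int: "integrable ?M (\<lambda>x. \<phi> x * u x)" if "\<phi> \<in> test_functions ?I" "locally_integrable ?I u" for \<phi> u :: "real \<Rightarrow> real"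
    using integrable_test_function_scaleR[OF that] by simp
  have int1: "integrable ?M \<phi>" if "\<phi> \<in> test_functions ?I" for \<phi>
    using int[OF that cl[of 1]] by simp
  have "AE x in ?M. h x - c = 0"
  proof (rule fundamental_lemma_real)
    show "locally_integrable ?I (\<lambda>x. h x - c)"
      using locally_integrable_add[OF hl cl[of "-c"]] by simp
    fix \<phi> assume \<phi>: "\<phi> \<in> test_functions ?I"
    define m where "m = (LINT x|?M. \<phi> x)"
    define \<eta> where "\<eta> x = \<phi> x - m * \<zeta> x" for x
    have m\<zeta>: "(\<lambda>x. (- m) * \<zeta> x) \<in> test_functions ?I"
      by (rule test_functions_mult[OF Ck_const \<zeta>])
    let ?K = "closure {x. \<phi> x \<noteq> 0} \<union> closure {x. (- m) * \<zeta> x \<noteq> 0}"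
    have "(\<lambda>x. \<phi> x + (- m) * \<zeta> x) \<in> test_functions ?I"
    proof (rule test_functionsI)
      show "Ck k (\<lambda>x. \<phi> x + (- m) * \<zeta> x)" for k
        by (intro Ck_add test_functionsD(1)[OF \<phi>] test_functionsD(1)[OF m\<zeta>])
      show "compact ?K" by (intro compact_Un test_functionsD(2)[OF \<phi>] test_functionsD(2)[OF m\<zeta>])
      show "?K \<subseteq> ?I" using test_functionsD(3)[OF \<phi>] test_functionsD(3)[OF m\<zeta>] by blast
      show "x \<in> ?K" if "\<phi> x + (- m) * \<zeta> x \<noteq> 0" for x
        using test_function_support[of \<phi> x] test_function_support[of "\<lambda>x. (- m) * \<zeta> x" x] that
        by (metis UnCI add_0)
    qed
    then have \<eta>: "\<eta> \<in> test_functions ?I" by (simp add: \<eta>_def[abs_def])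
    have "(LINT x|?M. \<eta> x) = 0"
      using int1[OF \<phi>] int1[OF \<zeta>] \<zeta>1 by (simp add: \<eta>_def m_def)
    then obtain \<Phi> where \<Phi>: "\<Phi> \<in> test_functions ?I" "\<And>x. frechet_derivative \<Phi> (at x) 1 = \<eta> x"
      using ex_test_primitive[OF \<eta>] by blast
    have "(LINT x|?M. frechet_derivative \<Phi> (at x) 1 *\<^sub>R h x) = - (LINT x|?M. \<Phi> x *\<^sub>R 0)"
      using h \<Phi>(1) unfolding has_weak_partial_def by blast
    then have "(LINT x|?M. \<eta> x * h x) = 0" by (simp add: \<Phi>(2))
    moreover have "(LINT x|?M. \<eta> x * h x) = (LINT x|?M. \<phi> x * h x) - m * c"
      using int[OF \<phi> hl] int[OF \<zeta> hl] by (simp add: \<eta>_def c_def left_diff_distrib mult.assoc)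
    moreover have "(LINT x|?M. \<phi> x * (h x - c)) = (LINT x|?M. \<phi> x * h x) - m * c"
      using int[OF \<phi> hl] int1[OF \<phi>] by (simp add: m_def right_diff_distrib)
    ultimately show "(LINT x|?M. \<phi> x * (h x - c)) = 0" by simp
  qed simp
  then have "AE x in ?M. h x = c" by eventually_elim simp
  then show ?thesis by blast
qed

text \<open>\<open>N e\<close> is the largest \<open>n\<close> with
  \<open>\<mu> n * sqrt e \<le> 1\<close>. Each fixed \<open>n\<close> satisfies this for small
  \<open>e\<close>, so \<open>N e\<close> tends to infinity; one factor \<open>sqrt e\<close>
  absorbs \<open>M (N e)\<close> and the other tends to \<open>0\<close>.\<close>

lemma ex_diagonal:
  fixes M :: "nat \<Rightarrow> real"
  obtains N where "filterlim N sequentially (at_right 0)" "((\<lambda>e. e * M (N e)) \<longlongrightarrow> 0) (at_right 0)"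
proof -
  \<comment> \<open>Dominates \<open>\<bar>M n\<bar>\<close> as well as \<open>n\<close>; the latter
    makes the set of admissible indices finite.\<close>
  define \<mu> where "\<mu> n = (\<Sum>m\<le>n. \<bar>M m\<bar>) + real n" for n
  have \<mu>: "\<bar>M n\<bar> \<le> \<mu> n" "real n \<le> \<mu> n" for n
    using member_le_sum[of n "{..n}" "\<lambda>m. \<bar>M m\<bar>"] sum_nonneg[of "{..n}" "\<lambda>m. \<bar>M m\<bar>"] by (auto simp: \<mu>_def)
  define S where "S e = {n. n = 0 \<or> \<mu> n * sqrt e \<le> 1}" for e
  define N where "N e = Max (S e)" for e
  have fin: "finite (S e)" if "e > 0" for e
  proof (rule finite_subset)
    show "S e \<subseteq> {..nat \<lceil>1 / sqrt e\<rceil>}"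
    proof
      fix n assume "n \<in> S e"
      then have "n = 0 \<or> \<mu> n \<le> 1 / sqrt e" using that by (auto simp: S_def field_simps)
      then show "n \<in> {..nat \<lceil>1 / sqrt e\<rceil>}" using \<mu>(2)[of n] by (auto simp: ) linarith
    qed
  qed simp
  have "filterlim N sequentially (at_right 0)"
    unfolding filterlim_at_top
  proof
    fix k
    have "((\<lambda>e. \<mu> k * sqrt e) \<longlongrightarrow> \<mu> k * sqrt 0) (at_right 0)"
      by (intro tendsto_intros)
    then have "\<forall>\<^sub>F e in at_right 0. \<mu> k * sqrt e < 1"
      by (rule order_tendstoD) simp
    then show "\<forall>\<^sub>F e in at_right 0. k \<le> N e"
      using eventually_at_right_less[of 0]
      by eventually_elim (auto simp: N_def S_def intro!: Max_ge fin[unfolded S_def])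
  qed
  moreover have "((\<lambda>e. e * M (N e)) \<longlongrightarrow> 0) (at_right 0)"
  proof (rule Lim_null_comparison)
    show "\<forall>\<^sub>F e in at_right 0. norm (e * M (N e)) \<le> sqrt e + e * \<bar>M 0\<bar>"
      using eventually_at_right_less[of 0]
    proof eventually_elim
      case (elim e)
      have "S e \<noteq> {}" by (auto simp: S_def)
      then have "N e \<in> S e" unfolding N_def by (rule Max_in[OF fin[OF elim]])
      then consider "N e = 0" | "\<mu> (N e) * sqrt e \<le> 1" by (auto simp: S_def)
      then show ?case
      proof cases
        case 1
        then show ?thesis using elim by (simp add: abs_mult)
      next
        case 2
        have "sqrt e * (\<bar>M (N e)\<bar> * sqrt e) = (sqrt e * sqrt e) * \<bar>M (N e)\<bar>"
          by (simp only: ac_simps)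
        then have "e * \<bar>M (N e)\<bar> = sqrt e * (\<bar>M (N e)\<bar> * sqrt e)"
          using elim by simp
        also have "\<dots> \<le> sqrt e * (\<mu> (N e) * sqrt e)"
          using \<mu>(1) elim by (intro mult_left_mono mult_right_mono) auto
        also have "\<dots> \<le> sqrt e * 1" using 2 elim by (intro mult_left_mono) auto
        finally show ?thesis using elim by (simp add: abs_mult add_increasing2)
      qed
    qed
    show "((\<lambda>e. sqrt e + e * \<bar>M 0\<bar>) \<longlongrightarrow> 0) (at_right 0)"
      by (auto intro!: tendsto_eq_intros)
  qed
  ultimately show ?thesis using that by blast
qed

section \<open>Strong convergence\<close>

text \<open>Membership in \<open>L2\<close> is part of the notion: the integral of a nonintegrable
  function is \<open>0\<close> by convention, so the limit alone could hold vacuously.\<close>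

definition L2_tendsto ::
    "'a::euclidean_space set \<Rightarrow> ('i \<Rightarrow> 'a \<Rightarrow> 'b::euclidean_space) \<Rightarrow> ('a \<Rightarrow> 'b) \<Rightarrow> 'i filter \<Rightarrow> bool" where
  "L2_tendsto S u v net \<longleftrightarrow> (\<forall>\<^sub>F i in net. u i \<in> L2 S) \<and> v \<in> L2 S \<and>
     ((\<lambda>i. LINT x|lebesgue_on S. (norm (u i x - v x))\<^sup>2) \<longlongrightarrow> 0) net"

lemma L2_tendsto_const: "v \<in> L2 S \<Longrightarrow> L2_tendsto S (\<lambda>_. v) v net"
  by (simp add: L2_tendsto_def)

lemma L2_norm_sq_add_le:
  assumes "f \<in> L2 S" "g \<in> L2 S"
  shows "(LINT x|lebesgue_on S. (norm (f x + g x))\<^sup>2) \<le>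
    2 * (LINT x|lebesgue_on S. (norm (f x))\<^sup>2) + 2 * (LINT x|lebesgue_on S. (norm (g x))\<^sup>2)"
proof -
  have "(LINT x|lebesgue_on S. (norm (f x + g x))\<^sup>2) \<le>
      (LINT x|lebesgue_on S. 2 * (norm (f x))\<^sup>2 + 2 * (norm (g x))\<^sup>2)"
    using L2_D(2)[OF assms(1)] L2_D(2)[OF assms(2)] L2_D(2)[OF L2_add[OF assms]] norm_add_sq_le
    by (intro integral_mono) auto
  then show ?thesis
    using L2_D(2)[OF assms(1)] L2_D(2)[OF assms(2)] by simp
qed

lemma L2_tendsto_add:
  assumes "L2_tendsto S u v net" "L2_tendsto S u' v' net"
  shows "L2_tendsto S (\<lambda>i x. u i x + u' i x) (\<lambda>x. v x + v' x) net"
  unfolding L2_tendsto_def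
proof (intro conjI)
  have ev: "\<forall>\<^sub>F i in net. u i \<in> L2 S" "\<forall>\<^sub>F i in net. u' i \<in> L2 S" and v: "v \<in> L2 S" "v' \<in> L2 S"
    using assms by (auto simp: L2_tendsto_def)
  show "\<forall>\<^sub>F i in net. (\<lambda>x. u i x + u' i x) \<in> L2 S"
    using ev by eventually_elim (rule L2_add)
  show "(\<lambda>x. v x + v' x) \<in> L2 S" using v by (rule L2_add)
  show "((\<lambda>i. LINT x|lebesgue_on S. (norm (u i x + u' i x - (v x + v' x)))\<^sup>2) \<longlongrightarrow> 0) net"
  proof (rule Lim_null_comparison)
    show "\<forall>\<^sub>F i in net. norm (LINT x|lebesgue_on S. (norm (u i x + u' i x - (v x + v' x)))\<^sup>2) \<le>
        2 * (LINT x|lebesgue_on S. (norm (u i x - v x))\<^sup>2) + 2 * (LINT x|lebesgue_on S. (norm (u' i x - v' x))\<^sup>2)"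
      using ev
    proof eventually_elim
      case (elim i)
      show ?case
        using L2_norm_sq_add_le[OF L2_diff[OF elim(1) v(1)] L2_diff[OF elim(2) v(2)]]
        by (simp add: algebra_simps)
    qed
    show "((\<lambda>i. 2 * (LINT x|lebesgue_on S. (norm (u i x - v x))\<^sup>2) +
        2 * (LINT x|lebesgue_on S. (norm (u' i x - v' x))\<^sup>2)) \<longlongrightarrow> 0) net"
      using assms unfolding L2_tendsto_def by (auto intro!: tendsto_eq_intros)
  qed
qed

lemma L2_tendsto_bounded_linear:
  fixes T :: "'b::euclidean_space \<Rightarrow> 'c::euclidean_space"
  assumes "L2_tendsto S u v net" "bounded_linear T"
  shows "L2_tendsto S (\<lambda>i x. T (u i x)) (\<lambda>x. T (v x)) net"
  unfolding L2_tendsto_def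
proof (intro conjI)
  interpret T: bounded_linear T by fact
  obtain C where C: "\<And>x. norm (T x) \<le> norm x * C" using T.bounded by blast
  have ev: "\<forall>\<^sub>F i in net. u i \<in> L2 S" and v: "v \<in> L2 S"
    using assms by (auto simp: L2_tendsto_def)
  show "\<forall>\<^sub>F i in net. (\<lambda>x. T (u i x)) \<in> L2 S"
    using ev by eventually_elim (rule L2_bounded_linear[OF _ assms(2)])
  show "(\<lambda>x. T (v x)) \<in> L2 S" using L2_bounded_linear[OF v assms(2)] .
  have sq: "(norm (T x))\<^sup>2 \<le> C\<^sup>2 * (norm x)\<^sup>2" for x
    using power_mono[OF C norm_ge_zero, of x 2] by (simp add: power_mult_distrib mult.commute)
  show "((\<lambda>i. LINT x|lebesgue_on S. (norm (T (u i x) - T (v x)))\<^sup>2) \<longlongrightarrow> 0) net"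
  proof (rule Lim_null_comparison)
    show "\<forall>\<^sub>F i in net. norm (LINT x|lebesgue_on S. (norm (T (u i x) - T (v x)))\<^sup>2) \<le>
        C\<^sup>2 * (LINT x|lebesgue_on S. (norm (u i x - v x))\<^sup>2)"
      using ev
    proof eventually_elim
      case (elim i)
      have d: "(\<lambda>x. u i x - v x) \<in> L2 S" by (rule L2_diff[OF elim v])
      have "(LINT x|lebesgue_on S. (norm (T (u i x - v x)))\<^sup>2) \<le> (LINT x|lebesgue_on S. C\<^sup>2 * (norm (u i x - v x))\<^sup>2)"
        by (rule integral_mono)
          (use L2_D(2)[OF d] L2_D(2)[OF L2_bounded_linear[OF d assms(2)]] sq in auto)
      then show ?case by (simp add: T.diff)
    qed
    show "((\<lambda>i. C\<^sup>2 * (LINT x|lebesgue_on S. (norm (u i x - v x))\<^sup>2)) \<longlongrightarrow> 0) net"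
      using assms unfolding L2_tendsto_def by (auto intro!: tendsto_eq_intros)
  qed
qed

lemma L2_tendsto_Pair:
  fixes u u' :: "'i \<Rightarrow> 'a::euclidean_space \<Rightarrow> real"
  assumes "L2_tendsto S u v net" "L2_tendsto S u' v' net"
  shows "L2_tendsto S (\<lambda>i x. (u i x, u' i x)) (\<lambda>x. (v x, v' x)) net"
proof -
  have "bounded_linear (\<lambda>s::real. (s, 0::real))" "bounded_linear (\<lambda>t::real. (0::real, t))"
    by (intro bounded_linear_intros)+
  from L2_tendsto_add[OF L2_tendsto_bounded_linear[OF assms(1) this(1)] L2_tendsto_bounded_linear[OF assms(2) this(2)]]
  show ?thesis by simp
qed

lemma L2_tendsto_cong_AE:
  assumes "L2_tendsto S u v net" "\<forall>\<^sub>F i in net. AE x in lebesgue_on S. u i x = u' i x" "S \<in> sets lebesgue"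
  shows "L2_tendsto S u' v net"
  unfolding L2_tendsto_def
proof (intro conjI)
  have ev: "\<forall>\<^sub>F i in net. u i \<in> L2 S" and lim: "((\<lambda>i. LINT x|lebesgue_on S. (norm (u i x - v x))\<^sup>2) \<longlongrightarrow> 0) net"
    using assms(1) by (auto simp: L2_tendsto_def)
  show "v \<in> L2 S" using assms(1) by (simp add: L2_tendsto_def)
  show "\<forall>\<^sub>F i in net. u' i \<in> L2 S"
    using ev assms(2) by eventually_elim (rule L2_AE[OF _ _ assms(3)])
  have "\<forall>\<^sub>F i in net. (LINT x|lebesgue_on S. (norm (u i x - v x))\<^sup>2) = (LINT x|lebesgue_on S. (norm (u' i x - v x))\<^sup>2)"
    using assms(2)
  proof eventually_elim
    case (elim i)
    then have "AE x in lebesgue_on S. (norm (u i x - v x))\<^sup>2 = (norm (u' i x - v x))\<^sup>2"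
      by eventually_elim simp
    then show ?case by (rule integral_lebesgue_on_cong_AE[OF _ assms(3)])
  qed
  then show "((\<lambda>i. LINT x|lebesgue_on S. (norm (u' i x - v x))\<^sup>2) \<longlongrightarrow> 0) net"
    by (rule Lim_transform_eventually[OF lim])
qed

text \<open>Splitting both factors around their limits leaves three products, each small by
  Cauchy-Schwarz. Through this lemma strong convergence passes to quadratic energies.\<close>

lemma L2_tendsto_integral_mult:
  fixes u u' :: "'i \<Rightarrow> 'a::euclidean_space \<Rightarrow> real"
  assumes u: "L2_tendsto S u v net" and u': "L2_tendsto S u' v' net"
  shows "((\<lambda>i. LINT x|lebesgue_on S. u i x * u' i x) \<longlongrightarrow> (LINT x|lebesgue_on S. v x * v' x)) net"
proof -
  let ?n = "\<lambda>f. sqrt (LINT x|lebesgue_on S. (norm (f x :: real))\<^sup>2)"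
  have ev: "\<forall>\<^sub>F i in net. u i \<in> L2 S" "\<forall>\<^sub>F i in net. u' i \<in> L2 S" and v: "v \<in> L2 S" "v' \<in> L2 S"
    using assms by (auto simp: L2_tendsto_def)
  have l: "((\<lambda>i. ?n (\<lambda>x. u i x - v x)) \<longlongrightarrow> sqrt 0) net" "((\<lambda>i. ?n (\<lambda>x. u' i x - v' x)) \<longlongrightarrow> sqrt 0) net"
    using assms unfolding L2_tendsto_def by (intro tendsto_real_sqrt; simp)+
  have "((\<lambda>i. (LINT x|lebesgue_on S. u i x * u' i x) - (LINT x|lebesgue_on S. v x * v' x)) \<longlongrightarrow> 0) net"
  proof (rule Lim_null_comparison)
    show "\<forall>\<^sub>F i in net. norm ((LINT x|lebesgue_on S. u i x * u' i x) - (LINT x|lebesgue_on S. v x * v' x)) \<le>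
        ?n (\<lambda>x. u i x - v x) * ?n (\<lambda>x. u' i x - v' x) + ?n v * ?n (\<lambda>x. u' i x - v' x) + ?n (\<lambda>x. u i x - v x) * ?n v'"
      using ev
    proof eventually_elim
      case (elim i)
      have d: "(\<lambda>x. u i x - v x) \<in> L2 S" "(\<lambda>x. u' i x - v' x) \<in> L2 S"
        by (rule L2_diff[OF elim(1) v(1)], rule L2_diff[OF elim(2) v(2)])
      have "(LINT x|lebesgue_on S. u i x * u' i x) - (LINT x|lebesgue_on S. v x * v' x) =
          (LINT x|lebesgue_on S. u i x * u' i x - v x * v' x)"
        using integrable_mult_L2[OF elim] integrable_mult_L2[OF v] by simp
      also have "\<dots> = (LINT x|lebesgue_on S. (u i x - v x) * (u' i x - v' x) + v x * (u' i x - v' x) + (u i x - v x) * v' x)"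
        by (simp add: algebra_simps)
      also have "\<dots> = (LINT x|lebesgue_on S. (u i x - v x) * (u' i x - v' x)) + (LINT x|lebesgue_on S. v x * (u' i x - v' x)) +
          (LINT x|lebesgue_on S. (u i x - v x) * v' x)"
        using integrable_mult_L2[OF d] integrable_mult_L2[OF v(1) d(2)] integrable_mult_L2[OF d(1) v(2)]
        by (simp only: Bochner_Integration.integral_add Bochner_Integration.integrable_add)
      finally show ?case
        using Cauchy_Schwarz_L2[OF d] Cauchy_Schwarz_L2[OF v(1) d(2)] Cauchy_Schwarz_L2[OF d(1) v(2)]
        by (simp only: inner_real_def real_norm_def)
    qed
    show "((\<lambda>i. ?n (\<lambda>x. u i x - v x) * ?n (\<lambda>x. u' i x - v' x) + ?n v * ?n (\<lambda>x. u' i x - v' x) +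
        ?n (\<lambda>x. u i x - v x) * ?n v') \<longlongrightarrow> 0) net"
      by (rule tendsto_eq_rhs[OF tendsto_add[OF tendsto_add[OF tendsto_mult[OF l]
              tendsto_mult[OF tendsto_const l(2)]] tendsto_mult[OF l(1) tendsto_const]]]) simp
  qed
  then show ?thesis using LIM_zero_iff by blast
qed

lemma L2_tendsto_filterlim:
  assumes "L2_tendsto S u v F" "filterlim N F G"
  shows "L2_tendsto S (\<lambda>i. u (N i)) v G"
  using assms eventually_compose_filterlim[OF _ assms(2)] filterlim_compose[OF _ assms(2)]
  unfolding L2_tendsto_def by fast

text \<open>Squaring produces \<open>e ^ (2 * j + 2)\<close>; one factor \<open>e\<close> is spent
  on \<open>M e\<close>, which bounds the squared norm, and the remaining power still tends to
  \<open>0\<close>.\<close>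

lemma L2_tendsto_vanishing:
  fixes u :: "real \<Rightarrow> 'a::euclidean_space \<Rightarrow> real"
  assumes u: "\<And>e. u e \<in> L2 S" "\<And>e. (LINT x|lebesgue_on S. (u e x)\<^sup>2) \<le> M e"
    and M: "((\<lambda>e. e * M e) \<longlongrightarrow> 0) (at_right 0)" and zero: "(\<lambda>_. 0::real) \<in> L2 S"
  shows "L2_tendsto S (\<lambda>e x. e ^ Suc j * u e x) (\<lambda>_. 0) (at_right 0)"
  unfolding L2_tendsto_def
proof (intro conjI zero)
  show "\<forall>\<^sub>F e in at_right 0. (\<lambda>x. e ^ Suc j * u e x) \<in> L2 S"
    using u(1) L2_cmult by (intro always_eventually allI) blast
  show "((\<lambda>e. LINT x|lebesgue_on S. (norm (e ^ Suc j * u e x - 0))\<^sup>2) \<longlongrightarrow> 0) (at_right 0)"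
  proof (rule Lim_null_comparison)
    show "\<forall>\<^sub>F e in at_right 0. norm (LINT x|lebesgue_on S. (norm (e ^ Suc j * u e x - 0))\<^sup>2) \<le> e ^ (2 * j + 1) * (e * M e)"
      using eventually_at_right_less[of 0]
    proof eventually_elim
      case (elim e)
      have eq: "(e ^ Suc j)\<^sup>2 = e ^ (2 * j + 1) * e"
        by (simp add: power_mult[symmetric] power_add power2_eq_square power_mult_distrib mult.assoc)
          (simp add: mult_2 power_add)
      have "(e ^ Suc j)\<^sup>2 * (LINT x|lebesgue_on S. (u e x)\<^sup>2) \<le> (e ^ Suc j)\<^sup>2 * M e"
        by (intro mult_left_mono u) simp
      then have "(LINT x|lebesgue_on S. (norm (c * u e x - 0))\<^sup>2) \<le> c\<^sup>2 * M e" if "c = e ^ Suc j" for c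
        using that by (simp only: power_mult_distrib real_norm_def diff_0_right power2_abs
            Bochner_Integration.integral_mult_right_zero)
      from this[OF refl] show ?case unfolding eq by (simp add: mult.assoc)
    qed
    show "((\<lambda>e. e ^ (2 * j + 1) * (e * M e)) \<longlongrightarrow> 0) (at_right 0)"
      by (rule tendsto_eq_rhs[OF tendsto_mult[OF tendsto_power[OF tendsto_ident_at] M]]) simp
  qed
qed

lemma L2_tendsto_ansatz:
  assumes "L2_tendsto (rod_interval l) f f0 net" "L2_tendsto (rod_interval l) g g0 net"
    "L2_tendsto (rod_interval l) h h0 net"
  shows "L2_tendsto (rod_strip l) (\<lambda>i. ansatz (f i) (g i) (h i)) (ansatz f0 g0 h0) net"
  unfolding L2_tendsto_def
proof (intro conjI)
  let ?I = "rod_interval l"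
  have ev: "\<forall>\<^sub>F i in net. f i \<in> L2 ?I" "\<forall>\<^sub>F i in net. g i \<in> L2 ?I"
      "\<forall>\<^sub>F i in net. h i \<in> L2 ?I"
    and L0: "f0 \<in> L2 ?I" "g0 \<in> L2 ?I" "h0 \<in> L2 ?I"
    using assms by (auto simp: L2_tendsto_def)
  show "\<forall>\<^sub>F i in net. ansatz (f i) (g i) (h i) \<in> L2 (rod_strip l)"
    using ev by eventually_elim (rule ansatz_L2)
  show "ansatz f0 g0 h0 \<in> L2 (rod_strip l)" by (rule ansatz_L2[OF L0])
  let ?n = "\<lambda>u u0. LINT t|lebesgue_on ?I. (norm (u t - u0 t :: real))\<^sup>2"
  show "((\<lambda>i. LINT x|lebesgue_on (rod_strip l). (norm (ansatz (f i) (g i) (h i) x - ansatz f0 g0 h0 x))\<^sup>2) \<longlongrightarrow> 0) net"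
  proof (rule Lim_null_comparison)
    show "\<forall>\<^sub>F i in net. norm (LINT x|lebesgue_on (rod_strip l). (norm (ansatz (f i) (g i) (h i) x - ansatz f0 g0 h0 x))\<^sup>2) \<le>
        3 * (?n (f i) f0 + ?n (g i) g0 + ?n (h i) h0)"
      using ev
    proof eventually_elim
      case (elim i)
      show ?case
        using ansatz_L2_bound[OF L2_diff[OF elim(1) L0(1)] L2_diff[OF elim(2) L0(2)] L2_diff[OF elim(3) L0(3)]]
        by (simp add: ansatz_diff)
    qed
    show "((\<lambda>i. 3 * (?n (f i) f0 + ?n (g i) g0 + ?n (h i) h0)) \<longlongrightarrow> 0) net"
      using assms unfolding L2_tendsto_def by (auto intro!: tendsto_eq_intros)
  qed
qed

text \<open>The defining identity sees a function and its derivative only through pairings with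
  fixed test functions, which are continuous in L2: weak differentiation is a closed
  operator.\<close>

lemma has_weak_partial_L2_limit:
  fixes u :: "nat \<Rightarrow> 'a::euclidean_space \<Rightarrow> real"
  assumes u: "L2_tendsto S u v sequentially" and du: "L2_tendsto S du dv sequentially"
    and D: "\<And>n. has_weak_partial S b (u n) (du n)" and S: "S \<in> lmeasurable"
  shows "has_weak_partial S b v dv"
  unfolding has_weak_partial_def
proof (intro conjI ballI)
  show "locally_integrable S v" "locally_integrable S dv"
    using u du locally_integrable_L2[OF _ S] by (auto simp: L2_tendsto_def)
  fix \<phi> assume \<phi>: "\<phi> \<in> test_functions S"
  define d where "d x = frechet_derivative \<phi> (at x) b" for x
  have d: "d \<in> test_functions S"
    using test_functions_frechet_derivative[OF \<phi>] by (simp add: d_def[abs_def])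
  have "(\<lambda>n. LINT x|lebesgue_on S. d x * u n x) \<longlonglongrightarrow> (LINT x|lebesgue_on S. d x * v x)"
    by (rule L2_tendsto_integral_mult[OF L2_tendsto_const[OF test_function_L2[OF d S]] u])
  moreover have "(\<lambda>n. LINT x|lebesgue_on S. d x * u n x) = (\<lambda>n. - (LINT x|lebesgue_on S. \<phi> x * du n x))"
    using D \<phi> by (simp add: has_weak_partial_def d_def fun_eq_iff)
  moreover have "(\<lambda>n. - (LINT x|lebesgue_on S. \<phi> x * du n x)) \<longlonglongrightarrow> - (LINT x|lebesgue_on S. \<phi> x * dv x)"
    by (intro tendsto_minus L2_tendsto_integral_mult[OF L2_tendsto_const[OF test_function_L2[OF \<phi> S]] du])
  ultimately have "(LINT x|lebesgue_on S. d x * v x) = - (LINT x|lebesgue_on S. \<phi> x * dv x)"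
    using LIMSEQ_unique by metis
  then show "(LINT x|lebesgue_on S. frechet_derivative \<phi> (at x) b *\<^sub>R v x) = - (LINT x|lebesgue_on S. \<phi> x *\<^sub>R dv x)"
    by (simp add: d_def)
qed

text \<open>Strong convergence in W^{k,2} with witnesses for the derivatives in place of
  \<open>weak_partial\<close>. It can be checked on explicit formulas;
  \<open>sobolev_tendsto_norm\<close> then makes the passage to the chosen derivatives once and for
  all.\<close>

primrec sobolev_tendsto ::
    "nat \<Rightarrow> 'a::euclidean_space set \<Rightarrow> ('i \<Rightarrow> 'a \<Rightarrow> 'b::euclidean_space) \<Rightarrow> ('a \<Rightarrow> 'b) \<Rightarrow> 'i filter \<Rightarrow> bool" where
  "sobolev_tendsto 0 S u v net = L2_tendsto S u v net"
| "sobolev_tendsto (Suc k) S u v net = (L2_tendsto S u v net \<and>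
     (\<forall>b\<in>Basis. \<exists>du dv. (\<forall>\<^sub>F i in net. has_weak_partial S b (u i) (du i)) \<and> has_weak_partial S b v dv \<and>
        sobolev_tendsto k S du dv net))"

lemma sobolev_tendsto_SucE:
  assumes "sobolev_tendsto (Suc k) S u v net" "b \<in> Basis"
  obtains du dv where "\<forall>\<^sub>F i in net. has_weak_partial S b (u i) (du i)" "has_weak_partial S b v dv"
    "sobolev_tendsto k S du dv net"
proof -
  from assms have "\<exists>du dv. (\<forall>\<^sub>F i in net. has_weak_partial S b (u i) (du i)) \<and>
      has_weak_partial S b v dv \<and> sobolev_tendsto k S du dv net"
    by simp
  then show ?thesis using that by blast
qed

lemma sobolev_tendsto_imp_sobolev:
  "sobolev_tendsto k S u v net \<Longrightarrow> (\<forall>\<^sub>F i in net. u i \<in> sobolev k S) \<and> v \<in> sobolev k S"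
proof (induction k arbitrary: u v)
  case 0
  then show ?case by (simp add: L2_tendsto_def)
next
  case (Suc k)
  have L: "\<forall>\<^sub>F i in net. u i \<in> L2 S" "v \<in> L2 S"
    using Suc.prems by (auto simp: L2_tendsto_def)
  have "\<forall>b\<in>Basis. \<forall>\<^sub>F i in net. \<exists>g\<in>sobolev k S. has_weak_partial S b (u i) g"
  proof
    fix b :: 'a assume "b \<in> Basis"
    from sobolev_tendsto_SucE[OF Suc.prems this]
    obtain du dv where d: "\<forall>\<^sub>F i in net. has_weak_partial S b (u i) (du i)" "sobolev_tendsto k S du dv net" .
    have "\<forall>\<^sub>F i in net. du i \<in> sobolev k S" using Suc.IH[OF d(2)] by blast
    with d(1) show "\<forall>\<^sub>F i in net. \<exists>g\<in>sobolev k S. has_weak_partial S b (u i) g"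
      by eventually_elim blast
  qed
  then have "\<forall>\<^sub>F i in net. \<forall>b\<in>Basis. \<exists>g\<in>sobolev k S. has_weak_partial S b (u i) g"
    by (rule eventually_ball_finite[OF finite_Basis])
  then have "\<forall>\<^sub>F i in net. u i \<in> sobolev (Suc k) S"
    using L(1) by eventually_elim simp
  moreover have "v \<in> sobolev (Suc k) S"
  proof -
    have "\<exists>g\<in>sobolev k S. has_weak_partial S b v g" if "b \<in> Basis" for b
      using sobolev_tendsto_SucE[OF Suc.prems that] Suc.IH by metis
    then show ?thesis using L(2) by simp
  qed
  ultimately show ?case by blast
qed

lemma has_weak_partial_diff:
  fixes f f' :: "'a::euclidean_space \<Rightarrow> 'b::euclidean_space"
  assumes "has_weak_partial S b f g" "has_weak_partial S b f' g'" "S \<in> sets lebesgue"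
  shows "has_weak_partial S b (\<lambda>x. f x - f' x) (\<lambda>x. g x - g' x)"
  using has_weak_partial_add[OF assms(1) has_weak_partial_bounded_linear[OF
        bounded_linear_minus[OF bounded_linear_ident] assms(2,3)] assms(3)] by simp

lemma sobolev_tendsto_norm:
  fixes u :: "'i \<Rightarrow> 'a::euclidean_space \<Rightarrow> 'b::euclidean_space"
  assumes "open S"
  shows "sobolev_tendsto k S u v net \<Longrightarrow> ((\<lambda>i. sobolev_norm_sq k S (\<lambda>x. u i x - v x)) \<longlongrightarrow> 0) net"
proof (induction k arbitrary: u v)
  case 0
  then show ?case by (simp add: L2_tendsto_def)
next
  case (Suc k)
  have "((\<lambda>i. sobolev_norm_sq k S (weak_partial S b (\<lambda>x. u i x - v x))) \<longlongrightarrow> 0) net" if "b \<in> Basis" for b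
  proof -
    from sobolev_tendsto_SucE[OF Suc.prems that]
    obtain du dv where d: "\<forall>\<^sub>F i in net. has_weak_partial S b (u i) (du i)"
        "has_weak_partial S b v dv" "sobolev_tendsto k S du dv net" .
    have "\<forall>\<^sub>F i in net. sobolev_norm_sq k S (\<lambda>x. du i x - dv x) = sobolev_norm_sq k S (weak_partial S b (\<lambda>x. u i x - v x))"
      using d(1)
    proof eventually_elim
      case (elim i)
      have "AE x in lebesgue_on S. weak_partial S b (\<lambda>x. u i x - v x) x = du i x - dv x"
        using weak_partial_eq_AE[OF assms has_weak_partial_diff[OF elim d(2)]] assms by simp
      then show ?case using sobolev_norm_sq_cong_AE assms by (metis borel_open lborelD sets_completionI_sets)
    qed
    then show ?thesis by (rule Lim_transform_eventually[OF Suc.IH[OF d(3)]])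
  qed
  then have "((\<lambda>i. (LINT x|lebesgue_on S. (norm (u i x - v x))\<^sup>2) +
      (\<Sum>b\<in>Basis. sobolev_norm_sq k S (weak_partial S b (\<lambda>x. u i x - v x)))) \<longlongrightarrow> 0 + (\<Sum>b\<in>(Basis::'a set). 0)) net"
    using Suc.prems by (intro tendsto_add tendsto_sum) (auto simp: L2_tendsto_def)
  then show ?case by simp
qed

lemma sobolev_tendsto_imp_weakly_converges:
  assumes "open S" "sobolev_tendsto k S u v net"
  shows "sobolev_weakly_converges k S u v net"
  using sobolev_weakly_convergesI[OF assms(1) _ _ sobolev_tendsto_norm[OF assms]]
    sobolev_tendsto_imp_sobolev[OF assms(2)] by blast

text \<open>For \<open>scaled_gradient\<close>, whose chosen derivatives match the explicit formulas
  only almost everywhere and for positive \<open>e\<close>.\<close>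

lemma sobolev_tendsto_cong_AE:
  assumes "sobolev_tendsto k S u v net" "\<forall>\<^sub>F i in net. AE x in lebesgue_on S. u i x = u' i x" "S \<in> sets lebesgue"
  shows "sobolev_tendsto k S u' v net"
proof (cases k)
  case 0
  then show ?thesis using assms L2_tendsto_cong_AE by simp
next
  case (Suc j)
  have "\<exists>du dv. (\<forall>\<^sub>F i in net. has_weak_partial S b (u' i) (du i)) \<and> has_weak_partial S b v dv \<and>
      sobolev_tendsto j S du dv net" if b: "b \<in> Basis" for b
  proof -
    from sobolev_tendsto_SucE[OF assms(1)[unfolded Suc] b]
    obtain du dv where d: "\<forall>\<^sub>F i in net. has_weak_partial S b (u i) (du i)"
        "has_weak_partial S b v dv" "sobolev_tendsto j S du dv net" .
    have "\<forall>\<^sub>F i in net. has_weak_partial S b (u' i) (du i)"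
      using d(1) assms(2) by eventually_elim (rule has_weak_partial_cong_AE[OF _ _ AE_I2 assms(3)]; simp)
    then show ?thesis using d by blast
  qed
  then show ?thesis using L2_tendsto_cong_AE[OF _ assms(2,3)] assms(1) Suc by simp
qed

text \<open>On a bounded interval, L2 convergence of the derivatives makes the primitives converge
  uniformly. The limit has weak derivative \<open>\<theta>'\<close>, so it differs from
  \<open>\<theta>\<close> by a constant, and the mean value fixes that constant.\<close>

lemma ex_smooth_approximation:
  fixes \<theta> \<theta>' :: "real \<Rightarrow> real"
  assumes "a < b" and \<theta>: "\<theta> \<in> L2 {a<..<b}" and \<theta>': "\<theta>' \<in> L2 {a<..<b}"
    and D: "has_weak_partial {a<..<b} 1 \<theta> \<theta>'" and mean: "(LINT t|lebesgue_on {a<..<b}. \<theta> t) = 0"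
  obtains u \<psi> where "\<And>n::nat. \<psi> n \<in> test_functions {a<..<b}" "\<And>n x. (u n has_real_derivative \<psi> n x) (at x)"
    "\<And>n. (LINT t|lebesgue_on {a<..<b}. u n t) = 0"
    "L2_tendsto {a<..<b} u \<theta> sequentially" "L2_tendsto {a<..<b} \<psi> \<theta>' sequentially"
proof -
  let ?I = "{a<..<b}" and ?M = "lebesgue_on {a<..<b}"
  have lm: "?I \<in> lmeasurable" using lmeasurable_box[of a b] by simp
  have vol: "(LINT t|?M. c) = (b - a) * c" for c :: real
    using assms(1) by (simp add: measure_restrict_space)
  obtain \<psi> where \<psi>: "\<And>n::nat. \<psi> n \<in> test_functions ?I"
      and \<psi>_lim: "(\<lambda>n. LINT t|?M. (\<psi> n t - \<theta>' t)\<^sup>2) \<longlonglongrightarrow> 0"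
    using ex_test_functions_L2_tendsto[of \<theta>' a b] \<theta>' by auto
  have \<psi>L: "\<psi> n \<in> L2 ?I" for n using test_function_L2[OF \<psi> lm] .
  have \<psi>_conv: "L2_tendsto ?I \<psi> \<theta>' sequentially"
    using \<psi>L \<theta>' \<psi>_lim by (simp add: L2_tendsto_def)
  define U where "U n x = (LINT t|?M. indicator {..x} t * \<psi> n t)" for n x
  define G0 where "G0 x = (LINT t|?M. indicator {..x} t * \<theta>' t)" for x
  \<comment> \<open>The L1 error of the derivatives bounds the difference of the primitives at every
    point.\<close>
  define e where "e n = (LINT t|?M. \<bar>\<psi> n t - \<theta>' t\<bar>)" for n
  have U_der: "(U n has_real_derivative \<psi> n x) (at x)" for n x
    unfolding U_def[abs_def] by (rule has_real_derivative_integral_test_function[OF \<psi>])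
  have dL: "(\<lambda>t. \<psi> n t - \<theta>' t) \<in> L2 ?I" for n by (rule L2_diff[OF \<psi>L \<theta>'])
  have int: "integrable ?M (\<psi> n)" "integrable ?M \<theta>'" "integrable ?M (\<lambda>t. \<psi> n t - \<theta>' t)" for n
    using integrable_L2[OF _ lm] \<psi>L \<theta>' dL by blast+
  have ind: "integrable ?M (\<lambda>t. indicator {..x} t * f t)" if "integrable ?M f" for f :: "real \<Rightarrow> real" and x
  proof (rule Bochner_Integration.integrable_bound[OF that])
    show "(\<lambda>t. indicator {..x} t * f t) \<in> borel_measurable ?M"
      by (intro borel_measurable_times measurable_restrict_space1 borel_measurable_indicator
          borel_measurable_integrable[OF that]) simp
  qed (auto simp: indicator_def)
  have "e \<longlonglongrightarrow> 0"
  proof (rule Lim_null_comparison)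
    have one: "(\<lambda>_. 1::real) \<in> L2 ?I" by (rule L2_const[OF lm])
    have absL: "(\<lambda>t. \<bar>\<psi> n t - \<theta>' t\<bar>) \<in> L2 ?I" for n
      by (rule L2_bound[OF dL[of n], of _ 1]) (use borel_measurable_integrable[OF int(3)[of n]] in auto)
    show "\<forall>\<^sub>F n in sequentially. norm (e n) \<le> sqrt (b - a) * sqrt (LINT t|?M. (\<psi> n t - \<theta>' t)\<^sup>2)"
      using Cauchy_Schwarz_L2[OF one absL] vol[of 1] by (intro always_eventually allI) (simp add: e_def)
    show "(\<lambda>n. sqrt (b - a) * sqrt (LINT t|?M. (\<psi> n t - \<theta>' t)\<^sup>2)) \<longlonglongrightarrow> 0"
      by (auto intro!: tendsto_eq_intros \<psi>_lim)
  qed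
  have e0: "0 \<le> e n" for n by (simp add: e_def)
  have UG: "\<bar>U n x - G0 x\<bar> \<le> e n" for n x
  proof -
    have "U n x - G0 x = (LINT t|?M. indicator {..x} t * (\<psi> n t - \<theta>' t))"
      using ind[OF int(1)] ind[OF int(2)] by (simp add: U_def G0_def right_diff_distrib)
    also have "\<bar>\<dots>\<bar> \<le> (LINT t|?M. \<bar>indicator {..x} t * (\<psi> n t - \<theta>' t)\<bar>)"
      by (rule integral_abs_bound)
    also have "\<dots> \<le> e n"
      unfolding e_def
      by (rule integral_mono) (use ind[OF int(3)] int(3) in \<open>auto simp: indicator_def intro: integrable_abs\<close>)
    finally show ?thesis .
  qed
  have U_meas: "U n \<in> borel_measurable ?M" for n
    by (intro continuous_imp_measurable_on_sets_lebesgue continuous_at_imp_continuous_on ballI DERIV_isCont[OF U_der]) simp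
  \<comment> \<open>The pointwise limit of the continuous \<open>U n\<close> gives measurability of
    \<open>G0\<close>.\<close>
  have "(\<lambda>n. U n x) \<longlonglongrightarrow> G0 x" for x
    by (rule LIM_zero_cancel, rule Lim_null_comparison[OF _ \<open>e \<longlonglongrightarrow> 0\<close>]) (use UG in auto)
  then have G0_meas: "G0 \<in> borel_measurable ?M"
    by (intro borel_measurable_LIMSEQ_metric[OF U_meas])
  have "\<bar>G0 x\<bar> \<le> (LINT t|?M. \<bar>\<theta>' t\<bar>)" for x
  proof -
    have "\<bar>G0 x\<bar> \<le> (LINT t|?M. \<bar>indicator {..x} t * \<theta>' t\<bar>)"
      unfolding G0_def by (rule integral_abs_bound)
    also have "\<dots> \<le> (LINT t|?M. \<bar>\<theta>' t\<bar>)"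
      by (rule integral_mono) (use ind[OF int(2)] int(2) in \<open>auto simp: indicator_def intro: integrable_abs\<close>)
    finally show ?thesis .
  qed
  then have G0L: "G0 \<in> L2 ?I"
    by (intro L2_bound[OF L2_const[OF lm, of "1::real"] G0_meas]) auto
  have UL: "U n \<in> L2 ?I" for n
  proof -
    have "(\<lambda>x. U n x - G0 x) \<in> L2 ?I"
      using U_meas G0_meas UG e0
      by (intro L2_bound[OF L2_const[OF lm, of "1::real"], of _ "e n"]) auto
    from L2_add[OF this G0L] show ?thesis by simp
  qed
  define m where "m n = (LINT t|?M. U n t) / (b - a)" for n
  define m0 where "m0 = (LINT t|?M. G0 t) / (b - a)"
  define u where "u n x = U n x - m n" for n x
  define G where "G x = G0 x - m0" for x
  have Ui: "integrable ?M (U n)" "integrable ?M G0" for n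
    using integrable_L2[OF UL lm] integrable_L2[OF G0L lm] by auto
  have "\<bar>m n - m0\<bar> \<le> e n" for n
  proof -
    have "\<bar>(LINT t|?M. U n t) - (LINT t|?M. G0 t)\<bar> = \<bar>LINT t|?M. U n t - G0 t\<bar>"
      using Ui by simp
    also have "\<dots> \<le> (LINT t|?M. \<bar>U n t - G0 t\<bar>)" by (rule integral_abs_bound)
    also have "\<dots> \<le> (LINT t|?M. e n)"
      by (rule integral_mono) (use Ui UG integrable_L2[OF L2_const[OF lm] lm] in auto)
    also have "\<dots> = (b - a) * e n" by (rule vol)
    finally show ?thesis
      using assms(1) by (simp add: m_def m0_def diff_divide_distrib[symmetric] abs_divide divide_le_eq mult.commute)
  qed
  \<comment> \<open>One \<open>e n\<close> comes from the primitives and one from their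
    means.\<close>
  then have uG: "\<bar>u n x - G x\<bar> \<le> 2 * e n" for n x
    using UG[of n x] by (auto simp: u_def G_def) (smt (verit))
  have uL: "u n \<in> L2 ?I" "G \<in> L2 ?I" for n
    unfolding u_def[abs_def] G_def[abs_def] by (intro L2_diff UL G0L L2_const lm)+
  have u_conv: "L2_tendsto ?I u G sequentially"
    unfolding L2_tendsto_def
  proof (intro conjI always_eventually allI uL)
    show "(\<lambda>n. LINT x|?M. (norm (u n x - G x))\<^sup>2) \<longlonglongrightarrow> 0"
    proof (rule Lim_null_comparison)
      have "(LINT x|?M. (norm (u n x - G x))\<^sup>2) \<le> (LINT x|?M. (2 * e n)\<^sup>2)" for n
      proof (rule integral_mono)
        show "integrable ?M (\<lambda>x. (norm (u n x - G x))\<^sup>2)" using L2_D(2)[OF L2_diff[OF uL]] .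
        show "integrable ?M (\<lambda>x. (2 * e n)\<^sup>2)" by (rule integrable_L2[OF L2_const[OF lm] lm])
        show "(norm (u n x - G x))\<^sup>2 \<le> (2 * e n)\<^sup>2" for x
          using power_mono[OF uG[of n x] abs_ge_zero, of 2] by simp
      qed
      then show "\<forall>\<^sub>F n in sequentially. norm (LINT x|?M. (norm (u n x - G x))\<^sup>2) \<le> (b - a) * (2 * e n)\<^sup>2"
        unfolding vol by (intro always_eventually allI) simp
      have "(\<lambda>n. (b - a) * (2 * e n)\<^sup>2) \<longlonglongrightarrow> (b - a) * (2 * 0)\<^sup>2"
        by (intro tendsto_intros \<open>e \<longlonglongrightarrow> 0\<close>)
      then show "(\<lambda>n. (b - a) * (2 * e n)\<^sup>2) \<longlonglongrightarrow> 0" by simp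
    qed
  qed
  have u_der: "(u n has_real_derivative \<psi> n x) (at x)" for n x
    unfolding u_def[abs_def] using U_der by (auto intro!: derivative_eq_intros)
  have "has_weak_partial ?I 1 (u n) (\<psi> n)" for n
    using test_functionsD(1)[OF \<psi>[of n], of 0] by (intro has_weak_partial_C1 u_der) simp
  \<comment> \<open>Closedness of the weak derivative replaces an integration by parts for the
    merely square-integrable \<open>\<theta>'\<close>.\<close>
  then have G_wp: "has_weak_partial ?I 1 G \<theta>'"
    by (rule has_weak_partial_L2_limit[OF u_conv \<psi>_conv _ lm])
  have "has_weak_partial ?I 1 (\<lambda>x. \<theta> x - G x) (\<lambda>_. 0)"
    using has_weak_partial_diff[OF D G_wp] by simp
  then obtain c where c: "AE x in ?M. \<theta> x - G x = c"
    using weak_partial_0_imp_const[OF assms(1)] by blast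
  \<comment> \<open>\<open>\<theta>\<close> and \<open>G\<close> both have mean zero, so the
    constant is \<open>0\<close>.\<close>
  have "(LINT x|?M. \<theta> x - G x) = (LINT x|?M. c)"
    by (rule integral_lebesgue_on_cong_AE[OF c]) simp
  moreover have "(LINT x|?M. \<theta> x - G x) = 0"
    using integrable_L2[OF \<theta> lm] Ui vol[of m0] mean integrable_L2[OF L2_const[OF lm] lm, of m0] assms(1)
    by (simp add: G_def m0_def)
  ultimately have "c = 0" using vol[of c] assms(1) by auto
  have "L2_tendsto ?I u \<theta> sequentially"
  proof -
    have eq: "(LINT x|?M. (norm (u n x - G x))\<^sup>2) = (LINT x|?M. (norm (u n x - \<theta> x))\<^sup>2)" for n
    proof (rule integral_lebesgue_on_cong_AE)
      show "AE x in ?M. (norm (u n x - G x))\<^sup>2 = (norm (u n x - \<theta> x))\<^sup>2"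
        using c by eventually_elim (use \<open>c = 0\<close> in simp)
    qed simp
    then show ?thesis using u_conv \<theta> unfolding L2_tendsto_def by simp
  qed
  moreover have "(LINT t|?M. u n t) = 0" for n
    using Ui vol[of "m n"] integrable_L2[OF L2_const[OF lm] lm, of "m n"] assms(1)
    by (simp add: u_def m_def)
  ultimately show ?thesis using that \<psi> u_der \<psi>_conv by blast
qed

section \<open>The recovery sequence\<close>

lemma Basis_strip: "(Basis :: (real \<times> real) set) = {e1, e2}"
  by (auto simp: Basis_prod_def)

lemma sobolev_tendsto_stripI:
  assumes "L2_tendsto (rod_strip l) u v net"
    "\<forall>\<^sub>F i in net. has_weak_partial (rod_strip l) e1 (u i) (u1 i)" "has_weak_partial (rod_strip l) e1 v v1"
    "sobolev_tendsto k (rod_strip l) u1 v1 net"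
    "\<forall>\<^sub>F i in net. has_weak_partial (rod_strip l) e2 (u i) (u2 i)" "has_weak_partial (rod_strip l) e2 v v2"
    "sobolev_tendsto k (rod_strip l) u2 v2 net"
  shows "sobolev_tendsto (Suc k) (rod_strip l) u v net"
  using assms unfolding sobolev_tendsto.simps Basis_strip by blast

text \<open>The smooth coefficients \<open>\<theta>\<^sub>n \<rightarrow> \<theta>\<close> and \<open>\<gamma>\<^sub>n \<rightarrow> g\<close> (the minimiser in \<open>Q1\<close>) have derivatives without
  uniform bounds; the diagonal index \<open>N e\<close> grows so slowly that the factors \<open>e\<close> absorb them.\<close>

lemma recovery_sequence:
  assumes "l > 0" and Q2: "positive_definite_quadratic_form_on symmetric_matrices Q2"
    and w0: "w0 \<in> W22_0 (rod_interval l)" and \<theta>: "\<theta> \<in> W12_0 (rod_interval l)"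
  shows "\<exists>w. (\<forall>e>0. w e \<in> W22_0 (rod_strip l)) \<and> rod_converges l w w0 \<theta> \<and>
    Limsup (at_right 0) (\<lambda>e. ereal (J_ben Q2 l e (w e))) \<le> ereal (J_LvK Q2 l w0 \<theta>)"
proof -
  obtain A B D c p q where
    R: "\<And>\<kappa> \<tau> \<gamma>. Q2 (sym_mat \<kappa> \<tau> \<gamma>) = A * \<kappa>\<^sup>2 + B * \<tau>\<^sup>2 + D * (\<kappa> * \<tau>) + c * (\<gamma> - (p * \<kappa> + q * \<tau>))\<^sup>2"
    and Q1: "\<And>\<kappa> \<tau>. Q1 Q2 \<kappa> \<tau> = A * \<kappa>\<^sup>2 + B * \<tau>\<^sup>2 + D * (\<kappa> * \<tau>)"
    by (rule quadratic_form_reduction[OF Q2]) (rule that; assumption)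
  let ?I = "rod_interval l" and ?S = "rod_strip l"
  let ?L = "lebesgue_on ?I"
  let ?M = "lebesgue_on ?S"
  have I: "?I = {- l / 2 <..< l / 2}" and lt: "- l / 2 < l / 2"
    using assms(1) by (simp_all add: rod_interval_def)
  have box: "?I = box (- l / 2) (l / 2)" by (simp add: rod_interval_def)
  define w1 where "w1 = weak_partial ?I 1 w0"
  define \<kappa> where "\<kappa> = weak_partial ?I 1 w1"
  define \<tau> where "\<tau> = weak_partial ?I 1 \<theta>"
  note W = W22_0_D[OF w0, folded w1_def, folded \<kappa>_def]
  note T = W12_0_D[OF \<theta>, folded \<tau>_def]
  \<comment> \<open>The optimal third entry at the limit.\<close>
  define g where "g t = p * \<kappa> t + q * \<tau> t" for t
  have gL: "g \<in> L2 ?I"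
    unfolding g_def[abs_def] by (intro L2_add L2_cmult W(3) T(2))
  have zero: "(\<lambda>_. 0::real) \<in> L2 ?I" by (simp add: L2_const lmeasurable_rod_interval)
  have zero': "has_weak_partial ?I 1 (\<lambda>_. 0::real) (\<lambda>_. 0)"
    using has_weak_partial_bounded_linear[OF bounded_linear_zero W(4)] by simp
  obtain \<theta>n \<psi> where \<psi>: "\<And>n::nat. \<psi> n \<in> test_functions ?I"
      and \<theta>n: "\<And>n x. (\<theta>n n has_real_derivative \<psi> n x) (at x)" "\<And>n. (LINT t|?L. \<theta>n n t) = 0"
      and \<theta>n_lim: "L2_tendsto ?I \<theta>n \<theta> sequentially" and \<psi>_lim: "L2_tendsto ?I \<psi> \<tau> sequentially"
    using ex_smooth_approximation[OF lt T(1)[unfolded I] T(2)[unfolded I] T(3)[unfolded I] T(4)[unfolded I], folded I]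
    by metis
  obtain \<gamma> where \<gamma>: "\<And>n::nat. \<gamma> n \<in> test_functions ?I"
      and \<gamma>_lim: "(\<lambda>n. LINT t|?L. (\<gamma> n t - g t)\<^sup>2) \<longlonglongrightarrow> 0"
    by (rule ex_test_functions_L2_tendsto[OF gL[unfolded box], folded box]) (rule that; assumption)
  define d where "d f x = frechet_derivative f (at x) 1" for f :: "real \<Rightarrow> real" and x
  have d: "d f \<in> test_functions ?I" "has_weak_partial ?I 1 f (d f)" if "f \<in> test_functions ?I" for f
    using test_functions_frechet_derivative[OF that, of 1] test_function_has_weak_partial[OF that[unfolded I], folded I]
    by (simp_all add: d_def[abs_def])
  have tL: "f \<in> L2 ?I" if "f \<in> test_functions ?I" for f
    using test_function_L2[OF that lmeasurable_rod_interval] .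
  have \<theta>n_cont: "continuous_on UNIV (\<theta>n n)" for n
    by (intro continuous_at_imp_continuous_on ballI DERIV_isCont[OF \<theta>n(1)])
  have \<theta>nL: "\<theta>n n \<in> L2 ?I" for n
  proof -
    have "bounded (\<theta>n n ` {- l / 2..l / 2})"
      by (intro compact_imp_bounded compact_continuous_image continuous_on_subset[OF \<theta>n_cont]) auto
    then obtain C where C: "\<forall>y\<in>\<theta>n n ` {- l / 2..l / 2}. norm y \<le> C"
      using bounded_iff by blast
    show ?thesis
    proof (rule L2_bound[OF L2_const[OF lmeasurable_rod_interval, of "1::real"], of _ _ C])
      show "\<theta>n n \<in> borel_measurable ?L"
        by (intro continuous_imp_measurable_on_sets_lebesgue continuous_on_subset[OF \<theta>n_cont]) auto
      show "norm (\<theta>n n x) \<le> C * norm (1::real)" if "x \<in> ?I" for x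
        using C[rule_format, of "\<theta>n n x"] that by (simp add: I)
    qed
  qed
  have \<theta>n_wp: "has_weak_partial ?I 1 (\<theta>n n) (\<psi> n)" for n
    unfolding I using test_functionsD(1)[OF \<psi>[of n], of 0] by (intro has_weak_partial_C1 \<theta>n(1)) simp
  define nrm where "nrm f = (LINT t|?L. (f t)\<^sup>2)" for f :: "real \<Rightarrow> real"
  have nrm0: "nrm f \<ge> 0" for f by (simp add: nrm_def)
  \<comment> \<open>Every squared norm of a smoothed coefficient or of its derivatives that occurs
    up to order two; the diagonal index controls them together.\<close>
  define M where "M n = nrm (\<theta>n n) + nrm (\<psi> n) + nrm (d (\<psi> n)) + nrm (\<gamma> n) + nrm (d (\<gamma> n)) + nrm (d (d (\<gamma> n)))" for n
  obtain N where N: "filterlim N sequentially (at_right 0)" and NM: "((\<lambda>e. e * M (N e)) \<longlongrightarrow> 0) (at_right 0)"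
    using ex_diagonal[of M] by blast
  define a where "a e = \<theta>n (N e)" for e
  define a' where "a' e = \<psi> (N e)" for e
  define a'' where "a'' e = d (\<psi> (N e))" for e
  define b where "b e = \<gamma> (N e)" for e
  define b' where "b' e = d (\<gamma> (N e))" for e
  define b'' where "b'' e = d (d (\<gamma> (N e)))" for e
  note ab_defs = a_def a'_def a''_def b_def b'_def b''_def
  have L: "a e \<in> L2 ?I" "a' e \<in> L2 ?I" "a'' e \<in> L2 ?I" "b e \<in> L2 ?I" "b' e \<in> L2 ?I" "b'' e \<in> L2 ?I" for e
    unfolding ab_defs by (intro \<theta>nL tL d(1) \<psi> \<gamma>)+
  have wp: "has_weak_partial ?I 1 (a e) (a' e)" "has_weak_partial ?I 1 (a' e) (a'' e)"
      "has_weak_partial ?I 1 (b e) (b' e)" "has_weak_partial ?I 1 (b' e) (b'' e)" for e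
    unfolding ab_defs by (intro \<theta>n_wp d \<psi> \<gamma>)+
  have cwp: "has_weak_partial ?I 1 (\<lambda>t. k * f t) (\<lambda>t. k * f' t)" if "has_weak_partial ?I 1 f f'" for k :: real and f f' :: "real \<Rightarrow> real"
    using has_weak_partial_bounded_linear[OF bounded_linear_mult_right that] by simp
  have van: "L2_tendsto ?I (\<lambda>e t. e ^ Suc j * u e t) (\<lambda>_. 0) (at_right 0)" if "u \<in> {a, a', a'', b, b', b''}" for u j
  proof (rule L2_tendsto_vanishing[OF _ _ NM zero])
    show "u e \<in> L2 ?I" for e using that L by auto
    show "(LINT t|?L. (u e t)\<^sup>2) \<le> M (N e)" for e
    proof -
      have "nrm (u e) \<le> M (N e)"
        using that nrm0[of "\<theta>n (N e)"] nrm0[of "\<psi> (N e)"] nrm0[of "d (\<psi> (N e))"] nrm0[of "\<gamma> (N e)"]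
          nrm0[of "d (\<gamma> (N e))"] nrm0[of "d (d (\<gamma> (N e)))"]
        by (auto simp: M_def ab_defs)
      then show ?thesis by (simp add: nrm_def)
    qed
  qed
  have v1: "L2_tendsto ?I (\<lambda>e t. e * u e t) (\<lambda>_. 0) (at_right 0)"
      and v2: "L2_tendsto ?I (\<lambda>e t. e\<^sup>2 * u e t) (\<lambda>_. 0) (at_right 0)" if "u \<in> {a, a', a'', b, b', b''}" for u
    using van[OF that, of 0] van[OF that, of 1] by (simp_all add: power2_eq_square)
  have lim: "L2_tendsto ?I a \<theta> (at_right 0)" "L2_tendsto ?I a' \<tau> (at_right 0)" "L2_tendsto ?I b g (at_right 0)"
  proof -
    have "L2_tendsto ?I \<gamma> g sequentially"
      using \<gamma>_lim gL tL[OF \<gamma>] by (simp add: L2_tendsto_def)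
    then show "L2_tendsto ?I a \<theta> (at_right 0)" "L2_tendsto ?I a' \<tau> (at_right 0)" "L2_tendsto ?I b g (at_right 0)"
      using L2_tendsto_filterlim[OF _ N] \<theta>n_lim \<psi>_lim by (simp_all add: a_def[abs_def] a'_def[abs_def] b_def[abs_def])
  qed
  \<comment> \<open>Dividing the first derivative along \<open>e2\<close> by \<open>e\<close> and
    the second by \<open>e\<^sup>2\<close> leaves \<open>a e\<close> and \<open>b e\<close> as
    leading coefficients.\<close>
  define w where "w e = ansatz w0 (\<lambda>t. e * a e t) (\<lambda>t. e\<^sup>2 * b e t)" for e
  define W1 where "W1 e = ansatz w1 (\<lambda>t. e * a' e t) (\<lambda>t. e\<^sup>2 * b' e t)" for e
  define W2 where "W2 e = ansatz (\<lambda>t. e * a e t) (\<lambda>t. e\<^sup>2 * b e t) (\<lambda>_. 0)" for e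
  define W11 where "W11 e = ansatz \<kappa> (\<lambda>t. e * a'' e t) (\<lambda>t. e\<^sup>2 * b'' e t)" for e
  define W12 where "W12 e = ansatz (\<lambda>t. e * a' e t) (\<lambda>t. e\<^sup>2 * b' e t) (\<lambda>_. 0)" for e
  define W22 where "W22 e = ansatz (\<lambda>t. e\<^sup>2 * b e t) (\<lambda>_. 0) (\<lambda>_. 0)" for e
  note W_defs = w_def W1_def W2_def W11_def W12_def W22_def
  have WL: "w e \<in> L2 ?S" "W1 e \<in> L2 ?S" "W2 e \<in> L2 ?S" "W11 e \<in> L2 ?S" "W12 e \<in> L2 ?S" "W22 e \<in> L2 ?S" for e
    unfolding W_defs by (intro ansatz_L2 W(1-3) L L2_cmult zero)+
  have D1: "has_weak_partial ?S e1 (w e) (W1 e)" "has_weak_partial ?S e1 (W1 e) (W11 e)"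
      "has_weak_partial ?S e1 (W2 e) (W12 e)" for e
    unfolding W_defs by (intro has_weak_partial_ansatz_e1 W(1-5) L L2_cmult zero cwp wp zero')+
  have D2: "has_weak_partial ?S e2 (w e) (W2 e)" "has_weak_partial ?S e2 (W1 e) (W12 e)"
      "has_weak_partial ?S e2 (W2 e) (W22 e)" for e
    unfolding W_defs by (intro has_weak_partial_ansatz_e2 W(1-5) L L2_cmult zero)+
  have "w e \<in> W22_0 ?S" for e
  proof -
    have "W1 e \<in> sobolev (Suc 0) ?S" "W2 e \<in> sobolev (Suc 0) ?S"
      using WL(2-6)[of e] D1(2,3)[of e] D2(2,3)[of e] by (auto simp: Basis_strip)
    then have "w e \<in> sobolev 2 ?S"
      using WL(1)[of e] D1(1)[of e] D2(1)[of e]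
      unfolding numeral_2_eq_2 sobolev.simps(2)[of "Suc 0"] Basis_strip by blast
    \<comment> \<open>The three means reduce to those of \<open>w0\<close>, \<open>w1\<close> and
      the smoothed \<open>\<theta>n\<close>, which is why the latter were normalised.\<close>
    moreover have "(LINT x|?M. w e x) = 0"
      unfolding w_def integral_ansatz[OF W(1) L2_cmult[OF L(1)] L2_cmult[OF L(4)]] by (rule W(6))
    moreover have "(LINT x|?M. weak_gradient ?S (w e) x) = 0"
    proof -
      have "AE x in ?M. weak_gradient ?S (w e) x = W1 e x *\<^sub>R e1 + W2 e x *\<^sub>R e2"
        using weak_partial_eq_AE[OF open_rod_strip D1(1)[of e]] weak_partial_eq_AE[OF open_rod_strip D2(1)[of e]]
        by eventually_elim (simp add: weak_gradient_def Basis_strip)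
      then have "(LINT x|?M. weak_gradient ?S (w e) x) = (LINT x|?M. W1 e x *\<^sub>R e1 + W2 e x *\<^sub>R e2)"
        by (rule integral_lebesgue_on_cong_AE) simp
      also have "\<dots> = (LINT x|?M. W1 e x) *\<^sub>R e1 + (LINT x|?M. W2 e x) *\<^sub>R e2"
        using WL(2,3)[of e, THEN integrable_L2[OF _ lmeasurable_rod_strip]]
        by (subst Bochner_Integration.integral_add) (simp_all del: scaleR_Pair)
      also have "(LINT x|?M. W1 e x) = 0"
        unfolding W1_def integral_ansatz[OF W(2) L2_cmult[OF L(2)] L2_cmult[OF L(5)]] by (rule W(7))
      also have "(LINT x|?M. W2 e x) = 0"
        unfolding W2_def integral_ansatz[OF L2_cmult[OF L(1)] L2_cmult[OF L(4)] zero]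
        by (simp add: a_def \<theta>n(2))
      finally show ?thesis by (simp add: zero_prod_def)
    qed
    ultimately show ?thesis by (simp add: W22_0_def)
  qed
  moreover have "rod_converges l w w0 \<theta>"
    unfolding rod_converges_def
  proof
    have Z: "L2_tendsto ?I (\<lambda>_. f) f (at_right 0)" if "f \<in> L2 ?I" for f :: "real \<Rightarrow> real"
      using that by (rule L2_tendsto_const)
    have A0: "L2_tendsto ?S u (\<lambda>x. 0) F" if "L2_tendsto ?S u (ansatz (\<lambda>_. 0) (\<lambda>_. 0) (\<lambda>_. 0)) F" for u and F :: "real filter"
      using that by (simp add: ansatz_simple)
    have c0: "L2_tendsto ?S w (\<lambda>x. w0 (fst x)) (at_right 0)" "L2_tendsto ?S W1 (\<lambda>x. w1 (fst x)) (at_right 0)"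
        "L2_tendsto ?S W2 (\<lambda>x. 0) (at_right 0)" "L2_tendsto ?S W11 (\<lambda>x. \<kappa> (fst x)) (at_right 0)"
        "L2_tendsto ?S W12 (\<lambda>x. 0) (at_right 0)" "L2_tendsto ?S W22 (\<lambda>x. 0) (at_right 0)"
    proof -
      show "L2_tendsto ?S w (\<lambda>x. w0 (fst x)) (at_right 0)" "L2_tendsto ?S W1 (\<lambda>x. w1 (fst x)) (at_right 0)"
          "L2_tendsto ?S W11 (\<lambda>x. \<kappa> (fst x)) (at_right 0)"
        unfolding W_defs[abs_def] ansatz_simple[symmetric]
        by (intro L2_tendsto_ansatz Z v1 v2 W(1-3); simp)+
      show "L2_tendsto ?S W2 (\<lambda>x. 0) (at_right 0)" "L2_tendsto ?S W12 (\<lambda>x. 0) (at_right 0)"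
          "L2_tendsto ?S W22 (\<lambda>x. 0) (at_right 0)"
        unfolding W_defs[abs_def]
        by (rule A0, intro L2_tendsto_ansatz Z v1 v2 zero; simp)+
    qed
    have P1: "has_weak_partial ?S e1 (\<lambda>x. f (fst x)) (\<lambda>x. f' (fst x))"
      if "f \<in> L2 ?I" "f' \<in> L2 ?I" "has_weak_partial ?I 1 f f'" for f f' :: "real \<Rightarrow> real"
      using has_weak_partial_ansatz_e1[OF that(1) zero zero that(2) zero zero that(3) zero' zero'] by (simp add: ansatz_simple)
    have P2: "has_weak_partial ?S e2 (\<lambda>x. f (fst x)) (\<lambda>x. 0 :: real)" if "f \<in> L2 ?I" for f :: "real \<Rightarrow> real"
      using has_weak_partial_ansatz_e2[OF that zero zero] by (simp add: ansatz_simple)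
    have P0: "has_weak_partial ?S b (\<lambda>x. 0::real) (\<lambda>x. 0)" if "b \<in> {e1, e2}" for b
      using P1[OF zero zero zero'] P2[OF zero] that by auto
    have "sobolev_tendsto 1 ?S W1 (\<lambda>x. w1 (fst x)) (at_right 0)"
      unfolding One_nat_def
      by (rule sobolev_tendsto_stripI[OF c0(2) always_eventually[OF allI[OF D1(2)]] P1[OF W(2,3,5)] _
            always_eventually[OF allI[OF D2(2)]] P2[OF W(2)]]) (simp_all add: c0)
    moreover have "sobolev_tendsto 1 ?S W2 (\<lambda>x. 0) (at_right 0)"
      unfolding One_nat_def
      by (rule sobolev_tendsto_stripI[OF c0(3) always_eventually[OF allI[OF D1(3)]] P0 _
            always_eventually[OF allI[OF D2(3)]] P0]) (simp_all add: c0)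
    ultimately have "sobolev_tendsto 2 ?S w (\<lambda>x. w0 (fst x)) (at_right 0)"
      unfolding numeral_2_eq_2 One_nat_def
      by (intro sobolev_tendsto_stripI[OF c0(1) always_eventually[OF allI[OF D1(1)]] P1[OF W(1,2,4)] _
            always_eventually[OF allI[OF D2(1)]] P2[OF W(1)]])
    then show "sobolev_weakly_converges 2 ?S w (\<lambda>x. w0 (fst x)) (at_right 0)"
      by (rule sobolev_tendsto_imp_weakly_converges[OF open_rod_strip])
    \<comment> \<open>\<open>V\<close> is \<open>W2\<close> divided by \<open>e\<close>, the second
      component of the scaled gradient, with the division carried out; \<open>V1\<close> and
      \<open>V2\<close> are its partial derivatives.\<close>
    define V where "V e = ansatz (a e) (\<lambda>t. e * b e t) (\<lambda>_. 0)" for e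
    define V1 where "V1 e = ansatz (a' e) (\<lambda>t. e * b' e t) (\<lambda>_. 0)" for e
    define V2 where "V2 e = ansatz (\<lambda>t. e * b e t) (\<lambda>_. 0) (\<lambda>_. 0)" for e
    have cV: "L2_tendsto ?S V (\<lambda>x. \<theta> (fst x)) (at_right 0)" "L2_tendsto ?S V1 (\<lambda>x. \<tau> (fst x)) (at_right 0)"
        "L2_tendsto ?S V2 (\<lambda>x. 0) (at_right 0)"
    proof -
      show "L2_tendsto ?S V (\<lambda>x. \<theta> (fst x)) (at_right 0)" "L2_tendsto ?S V1 (\<lambda>x. \<tau> (fst x)) (at_right 0)"
        unfolding V_def[abs_def] V1_def[abs_def] ansatz_simple[symmetric]
        by (intro L2_tendsto_ansatz Z v1 lim zero; simp)+
      show "L2_tendsto ?S V2 (\<lambda>x. 0) (at_right 0)"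
        unfolding V2_def[abs_def] by (rule A0, intro L2_tendsto_ansatz Z v1 zero; simp)
    qed
    have DV: "has_weak_partial ?S e1 (V e) (V1 e)" "has_weak_partial ?S e2 (V e) (V2 e)" for e
      unfolding V_def V1_def V2_def
      by (intro has_weak_partial_ansatz_e1 has_weak_partial_ansatz_e2 L L2_cmult zero cwp wp zero')+
    have sob: "sobolev_tendsto 1 ?S (\<lambda>e x. (W1 e x, V e x)) (\<lambda>x. (w1 (fst x), \<theta> (fst x))) (at_right 0)"
      unfolding One_nat_def
    proof (rule sobolev_tendsto_stripI)
      show "L2_tendsto ?S (\<lambda>e x. (W1 e x, V e x)) (\<lambda>x. (w1 (fst x), \<theta> (fst x))) (at_right 0)"
        by (intro L2_tendsto_Pair c0 cV)
      show "\<forall>\<^sub>F e in at_right 0. has_weak_partial ?S e1 (\<lambda>x. (W1 e x, V e x)) (\<lambda>x. (W11 e x, V1 e x))"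
        by (intro always_eventually allI has_weak_partial_Pair D1 DV sets_rod)
      show "\<forall>\<^sub>F e in at_right 0. has_weak_partial ?S e2 (\<lambda>x. (W1 e x, V e x)) (\<lambda>x. (W12 e x, V2 e x))"
        by (intro always_eventually allI has_weak_partial_Pair D2 DV sets_rod)
      show "has_weak_partial ?S e1 (\<lambda>x. (w1 (fst x), \<theta> (fst x))) (\<lambda>x. (\<kappa> (fst x), \<tau> (fst x)))"
        by (intro has_weak_partial_Pair P1 W(2,3,5) T(1-3) sets_rod)
      show "has_weak_partial ?S e2 (\<lambda>x. (w1 (fst x), \<theta> (fst x))) (\<lambda>x. (0, 0))"
        by (intro has_weak_partial_Pair P2 W(2) T(1) sets_rod)
    qed (auto intro!: L2_tendsto_Pair c0 cV)
    have "sobolev_weakly_converges 1 ?S (\<lambda>e. scaled_gradient l e (w e)) (\<lambda>x. (w1 (fst x), \<theta> (fst x))) (at_right 0)"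
    proof (rule sobolev_tendsto_imp_weakly_converges[OF open_rod_strip sobolev_tendsto_cong_AE[OF sob]])
      show "\<forall>\<^sub>F e in at_right 0. AE x in ?M. (W1 e x, V e x) = scaled_gradient l e (w e) x"
        using eventually_at_right_less[of 0]
      proof eventually_elim
        case (elim e)
        show ?case
          using weak_partial_eq_AE[OF open_rod_strip D1(1)[of e]] weak_partial_eq_AE[OF open_rod_strip D2(1)[of e]]
          by eventually_elim
            (use elim in \<open>simp add: scaled_gradient_def V_def W2_def ansatz_def power2_eq_square field_simps\<close>)
      qed
    qed simp_all
    then show "sobolev_weakly_converges 1 ?S (\<lambda>e. scaled_gradient l e (w e))
        (\<lambda>x. (weak_partial ?I 1 w0 (fst x), \<theta> (fst x))) (at_right 0)"
      by (simp add: w1_def)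
  qed
  moreover have "Limsup (at_right 0) (\<lambda>e. ereal (J_ben Q2 l e (w e))) \<le> ereal (J_LvK Q2 l w0 \<theta>)"
  proof -
    define k where "k e = W11 e" for e
    define t where "t e = ansatz (a' e) (\<lambda>t. e * b' e t) (\<lambda>_. 0)" for e
    \<comment> \<open>The completed square of the energy: the third entry minus the minimiser
      belonging to the current first two. It vanishes in the limit because \<open>b\<close> tends to
      \<open>g\<close>.\<close>
    define r where "r e x = ansatz (b e) (\<lambda>_. 0) (\<lambda>_. 0) x + (- p) * k e x + (- q) * t e x" for e x
    have kt: "L2_tendsto ?S k (\<lambda>x. \<kappa> (fst x)) (at_right 0)" "L2_tendsto ?S t (\<lambda>x. \<tau> (fst x)) (at_right 0)"
      unfolding k_def[abs_def] t_def[abs_def] W11_def[abs_def] ansatz_simple[symmetric]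
      by (intro L2_tendsto_ansatz v1 v2 lim L2_tendsto_const W zero; simp)+
    have rl: "L2_tendsto ?S r (\<lambda>x. 0) (at_right 0)"
    proof -
      have bg: "L2_tendsto ?S (\<lambda>e. ansatz (b e) (\<lambda>_. 0) (\<lambda>_. 0)) (\<lambda>x. g (fst x)) (at_right 0)"
        unfolding ansatz_simple[of g, symmetric] by (intro L2_tendsto_ansatz lim L2_tendsto_const zero)
      have "L2_tendsto ?S r (\<lambda>x. g (fst x) + (- p) * \<kappa> (fst x) + (- q) * \<tau> (fst x)) (at_right 0)"
        unfolding r_def[abs_def]
        by (intro L2_tendsto_add L2_tendsto_bounded_linear[OF _ bounded_linear_mult_right] kt bg)
      then show ?thesis by (simp add: g_def)
    qed
    have kL: "k e \<in> L2 ?S" "t e \<in> L2 ?S" "r e \<in> L2 ?S" for e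
      unfolding r_def[abs_def] k_def t_def
      by (intro L2_add L2_cmult WL ansatz_L2 L zero)+
    \<comment> \<open>Four integrals of products of strongly convergent functions, so the energy
      itself converges.\<close>
    let ?J = "\<lambda>e. 1 / 24 * (A * (LINT x|?M. k e x * k e x) + B * (LINT x|?M. t e x * t e x) +
        D * (LINT x|?M. k e x * t e x) + c * (LINT x|?M. r e x * r e x))"
    have J: "J_ben Q2 l e (w e) = ?J e" if "e > 0" for e
    proof -
      have eq: "1 / e * W12 e x = t e x" "1 / e\<^sup>2 * W22 e x - (p * k e x + q * t e x) = r e x" for x
        using that by (simp_all add: W12_def W22_def t_def r_def ansatz_def power2_eq_square field_simps)
      have "J_ben Q2 l e (w e) = 1 / 24 * (LINT x|?M. A * (W11 e x)\<^sup>2 + B * (1 / e * W12 e x)\<^sup>2 +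
          D * (W11 e x * (1 / e * W12 e x)) + c * (1 / e\<^sup>2 * W22 e x - (p * W11 e x + q * (1 / e * W12 e x)))\<^sup>2)"
        by (rule J_ben_eq[OF D1(1) D2(1) D1(2,3) D2(3),
            of Q2 "\<lambda>\<kappa> \<tau> \<gamma>. A * \<kappa>\<^sup>2 + B * \<tau>\<^sup>2 + D * (\<kappa> * \<tau>) + c * (\<gamma> - (p * \<kappa> + q * \<tau>))\<^sup>2"]) (rule R)
      also have "\<dots> = 1 / 24 * (LINT x|?M. A * (k e x * k e x) + B * (t e x * t e x) +
          D * (k e x * t e x) + c * (r e x * r e x))"
        unfolding eq(1) k_def[symmetric] unfolding eq(2) unfolding power2_eq_square ..
      finally show ?thesis
        using integrable_mult_L2[OF kL(1,1)] integrable_mult_L2[OF kL(2,2)] integrable_mult_L2[OF kL(1,2)]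
          integrable_mult_L2[OF kL(3,3)] by simp
    qed
    let ?m = "LINT x|?M. A * (\<kappa> (fst x))\<^sup>2 + B * (\<tau> (fst x))\<^sup>2 + D * (\<kappa> (fst x) * \<tau> (fst x))"
    have fL: "(\<lambda>x. \<kappa> (fst x)) \<in> L2 ?S" "(\<lambda>x. \<tau> (fst x)) \<in> L2 ?S"
      using kt by (auto simp: L2_tendsto_def)
    have m: "?m = A * (LINT x|?M. \<kappa> (fst x) * \<kappa> (fst x)) + B * (LINT x|?M. \<tau> (fst x) * \<tau> (fst x)) +
        D * (LINT x|?M. \<kappa> (fst x) * \<tau> (fst x))"
      using integrable_mult_L2[OF fL(1,1)] integrable_mult_L2[OF fL(2,2)] integrable_mult_L2[OF fL]
      by (simp add: power2_eq_square)
    have "((\<lambda>e. ?J e) \<longlongrightarrow>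
        1 / 24 * (A * (LINT x|?M. \<kappa> (fst x) * \<kappa> (fst x)) + B * (LINT x|?M. \<tau> (fst x) * \<tau> (fst x)) +
        D * (LINT x|?M. \<kappa> (fst x) * \<tau> (fst x)) + c * (LINT x|?M. 0 * 0))) (at_right 0)"
      by (intro tendsto_intros L2_tendsto_integral_mult kt rl)
    then have J_lim: "((\<lambda>e. J_ben Q2 l e (w e)) \<longlongrightarrow> 1 / 24 * (?m + c * 0)) (at_right 0)"
      using eventually_mono[OF eventually_at_right_less J[symmetric]]
      unfolding m mult_zero_right Bochner_Integration.integral_zero by (rule Lim_transform_eventually)
    have J_eq: "J_LvK Q2 l w0 \<theta> = 1 / 24 * ?m"
      by (rule J_LvK_eq[OF Q1 _ _ W(3) T(2)]) (simp_all add: \<kappa>_def \<tau>_def w1_def)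
    have "((\<lambda>e. ereal (J_ben Q2 l e (w e))) \<longlongrightarrow> ereal (J_LvK Q2 l w0 \<theta>)) (at_right 0)"
      using J_lim unfolding J_eq by simp
    from lim_imp_Limsup[OF _ this] show ?thesis by simp
  qed
  ultimately show ?thesis by blast
qed

theorem theorem2p2:
  fixes l :: real and Q2 :: "real^2^2 \<Rightarrow> real"
  assumes "l > 0"
    and "positive_definite_quadratic_form_on symmetric_matrices Q2"
  shows
    "(\<forall>(w :: real \<Rightarrow> real \<times> real \<Rightarrow> real) (w0 :: real \<Rightarrow> real) (\<theta> :: real \<Rightarrow> real).
        (\<forall>\<epsilon>>0. w \<epsilon> \<in> W22_0 (rod_strip l)) \<and>
        w0 \<in> W22_0 (rod_interval l) \<and> \<theta> \<in> W12_0 (rod_interval l) \<and>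
        rod_converges l w w0 \<theta> \<longrightarrow>
        Liminf (at_right 0) (\<lambda>\<epsilon>. ereal (J_ben Q2 l \<epsilon> (w \<epsilon>))) \<ge> ereal (J_LvK Q2 l w0 \<theta>))
     \<and>
     (\<forall>w0 \<in> W22_0 (rod_interval l). \<forall>\<theta> \<in> W12_0 (rod_interval l).
        \<exists>w :: real \<Rightarrow> real \<times> real \<Rightarrow> real.
          (\<forall>\<epsilon>>0. w \<epsilon> \<in> W22_0 (rod_strip l)) \<and>
          rod_converges l w w0 \<theta> \<and>
          Limsup (at_right 0) (\<lambda>\<epsilon>. ereal (J_ben Q2 l \<epsilon> (w \<epsilon>))) \<le> ereal (J_LvK Q2 l w0 \<theta>))"
proof (intro conjI allI impI ballI)
  fix w w0 \<theta>
  assume "(\<forall>\<epsilon>>0. w \<epsilon> \<in> W22_0 (rod_strip l)) \<and> w0 \<in> W22_0 (rod_interval l) \<and>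
    \<theta> \<in> W12_0 (rod_interval l) \<and> rod_converges l w w0 \<theta>"
  then show "Liminf (at_right 0) (\<lambda>\<epsilon>. ereal (J_ben Q2 l \<epsilon> (w \<epsilon>))) \<ge> ereal (J_LvK Q2 l w0 \<theta>)"
    by (intro liminf_inequality assms(2)) (auto simp: W22_0_def[of "rod_strip l"])
qed (rule recovery_sequence[OF assms])

end
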